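(* Let $(\mathbb{R}^N = E \oplus F, \mathbb{Z}^N, \pi, K)$ be the data of an $(N,d)$-cut and projection method with $K$ almost-canonical, and let $p$ be the associated complexity function. Let $H_1,\dots,H_m$ be the singular hyperplanes in $F$ and $\Gamma := \pi_F(\mathbb{Z}^N)$. For all $1 \le i \le m$, let $\Gamma^i := \mathrm{Stab}_\Gamma(H_i)$ and let $\alpha_i + 1$ be the rank of $\Gamma/\Gamma^i$. Let $I \subseteq \{1,\dots,m\}$ be a set of $N-d$ indices satisfying $\bigcap_{i\in I} H_i = \{0\}$ and such that $\alpha := \sum_{i \in I} \alpha_i$ is maximal among all such sets of indices. Then there exist $C_1, C_2 > 0$ such that for all $n \in \mathbb{N}$, $$C_1 n^\alpha \le p(n) \le C_2 n^\alpha .$$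
   Context: $\mathbb{N}=\{1,2,\dots\}$. $\mathbb{R}^N$ has standard basis $(e_i)_{i=1}^N$ and is normed by the $1$-norm $\|x\|_1=\sum_i |x_i|$; $\mathcal{B}(x,r)$ is the closed $1$-norm ball. Cut and projection data: $E$ is a linear subspace of $\mathbb{R}^N$ of dimension $d$ ($1\le d<N$), $F$ a complementary subspace, $\pi$ and $\pi_F$ the projections on $E$ and $F$ associated to $\mathbb{R}^N=E\oplus F$. Standing assumptions: $\pi|_{\mathbb{Z}^N}$ is one-to-one and $\Gamma:=\pi_F(\mathbb{Z}^N)$ is dense in $F$. The acceptance domain $K\subset F$ is a convex polytope (the closed convex hull of a finite set) which is the closure of its interior in $F$. $S:=K+E$ is the acceptance strip, $\partial S$ its boundary in $\mathbb{R}^N$. $K$ is almost-canonical if: (i) $\partial K+\Gamma$ is a countable union of (affine) hyperplanes of $F$; (ii) for every $(N-d-1)$-dimensional face $f$ of $K$ and every vertex $v$ of $f$, with $H_f$ the linear hyperplane of $F$ parallel to $f$, there is a neighborhood of $0$ in $H_f$ which can be covered by finitely many translates of $f$ of the form $(f-v)+\gamma$ with $\gamma\in\Gamma\cap H_f$. A point $x\in\mathbb{R}^N$ is singular if $(x+\mathbb{Z}^N)\cap\partial S\ne\varnothing$, and regular ($x \in \mathrm{Reg}$) otherwise. For an integer $n\ge 0$, $x\in S$ is $n$-singular if $(x+\mathbb{Z}^N)\cap\mathcal{B}(x,n)\cap\partial S\neq\varnothing$; $x\in S$ is $n$-regular ($x\in\mathrm{Reg}_n$) if it is not $n$-singular.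 For $x\in\mathrm{Reg}$, $\widetilde{\mathcal P}(x):=(x+\mathbb{Z}^N)\cap S$ and the Delone set associated to $x$ is $\mathcal P(x):=\pi(\widetilde{\mathcal P}(x))\subseteq E$. For $x\in\mathrm{Reg}_n$, $\widetilde A(x,n):=(x+\mathbb{Z}^N)\cap\mathcal{B}(x,n)\cap S$ and the patch of size $n$ is $A(x,n):=\pi(\widetilde A(x,n))\subset E$. The complexity function $p$ counts patches of size $n$ up to translation by elements of $E$: for $x\in\mathrm{Reg}$, $p(n):=\mathrm{Card}(\{A(y,n): y\in\widetilde{\mathcal P}(x)\}/E)$. This does not depend on the choice of $x\in\mathrm{Reg}$, and equals $\mathrm{Card}(\{A(y,n): y\in K\cap\mathrm{Reg}_n\}/E)$. The singular hyperplanes $H_1,\dots,H_m$ are all the distinct linear hyperplanes of $F$ which are parallel to ($(N-d-1)$-dimensional) faces of $K$. $\mathrm{Stab}_\Gamma(H_i)$ is the stabilizer of $H_i$ under translation by $\Gamma$, i.e. $\Gamma\cap H_i$. *)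

theory Defs
  imports "HOL-Analysis.Analysis" "HOL-Algebra.Coset" "HOL-Algebra.FiniteProduct"
begin

text \<open>Sums of sets are Minkowski sums, and \<open>x +o B\<close> is the translate of \<open>B\<close> by \<open>x\<close>
  (\<^theory>\<open>HOL-Library.Set_Algebras\<close>).\<close>


section \<open>Rank of an abelian group\<close>

definition int_independent :: "('a, 'b) monoid_scheme \<Rightarrow> 'a set \<Rightarrow> bool" where
  "int_independent G B \<longleftrightarrow> finite B \<and> B \<subseteq> carrier G \<and>
     (\<forall>c :: 'a \<Rightarrow> int. finprod G (\<lambda>b. b [^]\<^bsub>G\<^esub> c b) B = \<one>\<^bsub>G\<^esub> \<longrightarrow> (\<forall>b\<in>B. c b = 0))"

text \<open>For abelian groups of finite rank only (such as quotients of finitely generated groups):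
  on \<open>nat\<close>, the supremum of an unbounded set is a dummy value.\<close>

definition group_rank :: "('a, 'b) monoid_scheme \<Rightarrow> nat" where
  "group_rank G = Sup {card B | B. int_independent G B}"

definition additive_group :: "'a::ab_group_add set \<Rightarrow> 'a monoid" where
  "additive_group A = \<lparr>carrier = A, monoid.mult = (+), one = 0\<rparr>"


section \<open>Cut and projection data\<close>

definition int_lattice :: "(real ^ 'n) set" where
  "int_lattice = {x. \<forall>i. x $ i \<in> \<int>}"

definition norm1 :: "real ^ 'n \<Rightarrow> real" where
  "norm1 x = (\<Sum>i\<in>UNIV. \<bar>x $ i\<bar>)"

definition cball1 :: "real ^ 'n \<Rightarrow> real \<Rightarrow> (real ^ 'n) set" where
  "cball1 x r = {y. norm1 (y - x) \<le> r}"

definition complementary :: "'a::real_vector set \<Rightarrow> 'a set \<Rightarrow> bool" where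
  "complementary E F \<longleftrightarrow> subspace E \<and> subspace F \<and> E \<inter> F = {0} \<and> E + F = UNIV"

text \<open>\<open>proj E F\<close> is the projection onto \<open>E\<close> along \<open>F\<close>: thus \<open>\<pi> = proj E F\<close> and
  \<open>\<pi>\<^sub>F = proj F E\<close>.\<close>

definition proj :: "'a::real_vector set \<Rightarrow> 'a set \<Rightarrow> 'a \<Rightarrow> 'a" where
  "proj E F x = (THE e. e \<in> E \<and> x - e \<in> F)"

definition Gam :: "(real ^ 'n) set \<Rightarrow> (real ^ 'n) set \<Rightarrow> (real ^ 'n) set" where
  "Gam E F = proj F E ` int_lattice"

definition cut_and_projection ::
    "nat \<Rightarrow> (real ^ 'n) set \<Rightarrow> (real ^ 'n) set \<Rightarrow> (real ^ 'n) set \<Rightarrow> bool" where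
  "cut_and_projection d E F K \<longleftrightarrow>
     complementary E F \<and> dim E = d \<and> 1 \<le> d \<and> d < CARD('n) \<and>
     inj_on (proj E F) int_lattice \<and> F \<subseteq> closure (Gam E F) \<and>
     K \<subseteq> F \<and> polytope K \<and> K = closure (top_of_set F interior_of K)"


section \<open>Faces and almost-canonical acceptance domains\<close>

text \<open>In what follows \<open>K\<close> is full-dimensional in \<open>F\<close>, and \<open>dim F = N - d\<close>.\<close>

definition affine_hyperplane_of :: "'a::euclidean_space set \<Rightarrow> 'a set \<Rightarrow> bool" where
  "affine_hyperplane_of F h \<longleftrightarrow> h \<subseteq> F \<and> affine h \<and> aff_dim h = int (dim F) - 1"

definition facet_in :: "'a::euclidean_space set \<Rightarrow> 'a set \<Rightarrow> 'a set \<Rightarrow> bool" where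
  "facet_in F K f \<longleftrightarrow> f face_of K \<and> aff_dim f = int (dim F) - 1"

definition direction :: "'a::real_vector set \<Rightarrow> 'a set" where
  "direction f = span {x - y | x y. x \<in> f \<and> y \<in> f}"

definition singular_hyperplanes :: "'a::euclidean_space set \<Rightarrow> 'a set \<Rightarrow> 'a set set" where
  "singular_hyperplanes F K = {direction f | f. facet_in F K f}"

definition almost_canonical ::
    "(real ^ 'n) set \<Rightarrow> (real ^ 'n) set \<Rightarrow> (real ^ 'n) set \<Rightarrow> bool" where
  "almost_canonical E F K \<longleftrightarrow>
     (\<exists>\<H>. countable \<H> \<and> (\<forall>h\<in>\<H>. affine_hyperplane_of F h) \<and>
          (top_of_set F frontier_of K) + Gam E F = \<Union>\<H>) \<and>
     (\<forall>f v. facet_in F K f \<longrightarrow> v extreme_point_of f \<longrightarrow>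
        (\<exists>U. openin (top_of_set (direction f)) U \<and> 0 \<in> U \<and>
          (\<exists>G. finite G \<and> G \<subseteq> Gam E F \<inter> direction f \<and>
               U \<subseteq> (\<Union>\<gamma>\<in>G. (\<lambda>x. (x - v) + \<gamma>) ` f))))"

definition Stab :: "'a::ab_group_add set \<Rightarrow> 'a set \<Rightarrow> 'a set" where
  "Stab A H = {\<gamma>\<in>A. \<gamma> +o H = H}"

text \<open>The exponent \<open>\<alpha>\<^sub>i\<close> attached to \<open>H = H\<^sub>i\<close>; it is an integer, so that the subtraction is
  not truncated.\<close>

definition sing_exponent ::
    "(real ^ 'n) set \<Rightarrow> (real ^ 'n) set \<Rightarrow> (real ^ 'n) set \<Rightarrow> int" where
  "sing_exponent E F H =
     int (group_rank (additive_group (Gam E F) Mod Stab (Gam E F) H)) - 1"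


section \<open>Patches and complexity\<close>

definition strip :: "'a::real_vector set \<Rightarrow> 'a set \<Rightarrow> 'a set" where
  "strip E K = K + E"

definition singular_pt :: "(real ^ 'n) set \<Rightarrow> (real ^ 'n) set \<Rightarrow> (real ^ 'n) \<Rightarrow> bool" where
  "singular_pt E K x \<longleftrightarrow> (x +o int_lattice) \<inter> frontier (strip E K) \<noteq> {}"

definition Reg :: "(real ^ 'n) set \<Rightarrow> (real ^ 'n) set \<Rightarrow> (real ^ 'n) set" where
  "Reg E K = {x. \<not> singular_pt E K x}"

definition lifted_points ::
    "(real ^ 'n) set \<Rightarrow> (real ^ 'n) set \<Rightarrow> (real ^ 'n) \<Rightarrow> (real ^ 'n) set" where
  "lifted_points E K x = (x +o int_lattice) \<inter> strip E K"

text \<open>Patches are meaningful around \<open>n\<close>-regular points; every point of \<open>lifted_points E K x\<close>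
  with \<open>x\<close> regular is \<open>n\<close>-regular for all \<open>n\<close>.\<close>

definition patch ::
    "(real ^ 'n) set \<Rightarrow> (real ^ 'n) set \<Rightarrow> (real ^ 'n) set \<Rightarrow> real ^ 'n \<Rightarrow> nat \<Rightarrow> (real ^ 'n) set"
  where
  "patch E F K y n =
     proj E F ` ((y +o int_lattice) \<inter> cball1 y (real n) \<inter> strip E K)"

definition translation_rel :: "'a::ab_group_add set \<Rightarrow> ('a set \<times> 'a set) set" where
  "translation_rel E = {(A, B). \<exists>e\<in>E. B = e +o A}"

definition complexity ::
    "(real ^ 'n) set \<Rightarrow> (real ^ 'n) set \<Rightarrow> (real ^ 'n) set \<Rightarrow> real ^ 'n \<Rightarrow> nat \<Rightarrow> nat" where
  "complexity E F K x n =
     card ({patch E F K y n | y. y \<in> lifted_points E K x} // translation_rel E)"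

end

theory Submission
  imports Defs
begin

text \<open>Write \<open>P\<close> for the projection onto \<open>F\<close>. The patch of size \<open>n\<close> at \<open>y\<close> is a
  translate of the image of the set of lattice vectors \<open>z\<close> of norm at most \<open>n\<close> with \<open>P y + P z \<in> K\<close>,
  and its translation class determines this set up to boundedly many choices, uniformly in \<open>n\<close>.
  So one counts how the translates \<open>K - P z\<close> separate the points of
  \<open>K\<close>. If \<open>a\<close> is a normal of a singular hyperplane \<open>H\<^sub>i\<close>, then \<open>z \<mapsto> a \<bullet> P z\<close> takes about
  \<open>n^\<alpha>\<^sub>i\<close> bounded values on lattice vectors of norm at most \<open>n\<close>.

  For the upper bound, a patch is determined by which of the half-spaces bounding these
  translates contain the point. By
  Pajor's inequality the number of such patterns is at most the number of shattered families of
  half-spaces, and shattered families have independent normals; a family of directions extends to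
  a basis and contributes at most \<open>n^\<alpha>\<close>.

  For the lower bound, the second condition on almost-canonical \<open>K\<close> implies that the stabilizer of \<open>H\<^sub>i\<close> spans
  \<open>H\<^sub>i\<close>. With a pigeonhole argument this brings, for a positive proportion of those values, a
  translate of the centre of a facet close to a prescribed point. Near this point the translated facets are
  full hyperplanes with a translate of \<open>K\<close> on one side, and for \<open>i \<in> I\<close> they form a grid with about \<open>n^\<alpha>\<close>
  boxes, any two of which are separated by some translate of \<open>K\<close>.\<close>


section \<open>Ranks of subgroups of the reals\<close>

text \<open>A normal \<open>a\<close> of H_i carries \<Gamma>/\<Gamma>^i injectively into the reals,
  so its rank is the dimension over the rationals of the set of values
  \<open>a \<bullet> P z\<close>. With dimension \<alpha>_i + 1 there are about n^(\<alpha>_i + 1)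
  values spread over an interval of length of order n; restricting to a bounded interval costs one
  power. Patterns are counted for all points of \<open>K\<close>, including those on the boundary
  hyperplanes, so counting the open cells of an arrangement would not suffice. Shattering treats all
  points alike and replaces cells by independent sets of normals. In the lower bound, distinct
  values alone are worthless: a facet is only a bounded piece of its hyperplane, and translates that
  lie far apart along H_i do not form a grid. Translations in \<Gamma>^i leave the value unchanged
  while moving the piece along H_i, which is why \<Gamma>^i has to span H_i. A translation class
  forgets the centre of its patch. If the number of possible centres grew with n, passing from
  patterns to classes could lower the exponent; hence the emphasis on a bound for the translation
  that is independent of n.\<close>

interpretation rat_real: vector_space "\<lambda>(q::rat) (x::real). real_of_rat q * x"
  by unfold_locales (simp_all add: algebra_simps of_rat_add of_rat_mult)

lemma common_denominator:
  assumes "finite (S :: rat set)"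
  shows "\<exists>D::int. D > 0 \<and> (\<forall>q\<in>S. of_int D * q \<in> \<int>)"
  using assms
proof induction
  case empty
  show ?case by (intro exI[of _ 1]) auto
next
  case (insert q S)
  then obtain D :: int where D: "D > 0" "\<forall>q\<in>S. of_int D * q \<in> \<int>" by auto
  obtain a b where q: "quotient_of q = (a, b)" by fastforce
  have b: "b > 0" and qd: "q = of_int a / of_int b"
    using quotient_of_denom_pos[OF q] quotient_of_div[OF q] by auto
  have "of_int (D * b) * q = of_int (D * a)" using b by (simp add: qd)
  then have 1: "of_int (D * b) * q \<in> \<int>" by (metis Ints_of_int)
  have 2: "of_int (D * b) * r \<in> \<int>" if "r \<in> S" for r
  proof -
    have "of_int (D * b) * r = of_int b * (of_int D * r)" by simp
    then show ?thesis using D(2) that by (metis Ints_mult Ints_of_int)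
  qed
  show ?case using D(1) b 1 2 by (intro exI[of _ "D * b"]) auto
qed

text \<open>Multiplying a rational relation by a common denominator makes it integral. This links
  the integer combinations in \<open>int_independent\<close> to linear algebra over the
  rationals.\<close>

lemma rat_independent_iff_int:
  assumes "finite B"
  shows "rat_real.independent B \<longleftrightarrow> (\<forall>c::real \<Rightarrow> int. (\<Sum>b\<in>B. of_int (c b) * b) = 0 \<longrightarrow> (\<forall>b\<in>B. c b = 0))"
proof
  assume ind: "rat_real.independent B"
  show "\<forall>c::real \<Rightarrow> int. (\<Sum>b\<in>B. of_int (c b) * b) = 0 \<longrightarrow> (\<forall>b\<in>B. c b = 0)"
  proof (intro allI impI ballI)
    fix c :: "real \<Rightarrow> int" and b
    assume 0: "(\<Sum>b\<in>B. of_int (c b) * b) = 0" and b: "b \<in> B"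
    have "(\<Sum>b\<in>B. real_of_rat (of_int (c b)) * b) = 0" using 0 by simp
    moreover have "\<not> (\<exists>u. (\<exists>v\<in>B. u v \<noteq> 0) \<and> (\<Sum>b\<in>B. real_of_rat (u b) * b) = 0)"
      using ind unfolding rat_real.dependent_finite[OF assms] .
    ultimately have "\<not> (\<exists>v\<in>B. (of_int (c v)::rat) \<noteq> 0)"
      by (auto dest: spec[of _ "\<lambda>b. of_int (c b)"])
    then show "c b = 0" using b by auto
  qed
next
  assume int: "\<forall>c::real \<Rightarrow> int. (\<Sum>b\<in>B. of_int (c b) * b) = 0 \<longrightarrow> (\<forall>b\<in>B. c b = 0)"
  show "rat_real.independent B"
  proof
    assume "rat_real.dependent B"
    then obtain u v where v: "v \<in> B" "u v \<noteq> 0" and 0: "(\<Sum>b\<in>B. real_of_rat (u b) * b) = 0"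
      unfolding rat_real.dependent_finite[OF assms] by auto
    obtain D :: int where D: "D > 0" "\<forall>q\<in>u ` B. of_int D * q \<in> \<int>"
      using common_denominator[of "u ` B"] assms by auto
    then have "\<forall>b\<in>B. \<exists>c::int. of_int D * u b = of_int c" by (auto simp: Ints_def)
    then obtain c where c: "\<And>b. b \<in> B \<Longrightarrow> of_int D * u b = of_int (c b)" by metis
    have c': "real_of_int (c b) = real_of_int D * real_of_rat (u b)" if "b \<in> B" for b
      using arg_cong[OF c[OF that], of real_of_rat] by (simp add: of_rat_mult)
    have "(\<Sum>b\<in>B. of_int (c b) * b) = of_int D * (\<Sum>b\<in>B. real_of_rat (u b) * b)"
      by (simp add: sum_distrib_left c' mult.assoc)
    then have "c v = 0" using int 0 v by auto
    then show False using c'[of v] v D by auto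
  qed
qed

lemma additive_group_simps [simp]:
  "carrier (additive_group A) = A" "monoid.mult (additive_group A) = (+)" "one (additive_group A) = 0"
  by (simp_all add: additive_group_def)

lemma comm_group_additive_group:
  assumes "0 \<in> A" "\<And>x y. x \<in> A \<Longrightarrow> y \<in> A \<Longrightarrow> x + y \<in> A" "\<And>x. x \<in> A \<Longrightarrow> - x \<in> A"
  shows "comm_group (additive_group A)"
proof (rule comm_groupI, goal_cases)
  case (6 x)
  then show ?case using assms(3) by (intro bexI[of _ "-x"]) auto
qed (auto simp: assms add_ac)

lemma int_pow_additive_real: "x [^]\<^bsub>additive_group (UNIV :: real set)\<^esub> (k::int) = of_int k * x"
proof -
  interpret comm_group "additive_group (UNIV :: real set)"
    by (rule comm_group_additive_group) auto
  have n: "x [^]\<^bsub>additive_group (UNIV :: real set)\<^esub> (n::nat) = of_nat n * x" for n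
    by (induction n) (simp_all add: algebra_simps)
  have i: "inv\<^bsub>additive_group (UNIV :: real set)\<^esub> y = - y" for y
    by (rule inv_equality) auto
  show ?thesis
    by (cases k rule: int_cases2) (simp_all add: int_pow_int int_pow_neg_int n i)
qed

text \<open>A group that embeds in the additive group of the reals is torsion free, so its rank is the
  dimension over the rationals of the span of its image.\<close>

lemma group_rank_eq_dim:
  assumes G: "comm_group G" and h: "h \<in> hom G (additive_group (UNIV :: real set))"
    and inj: "inj_on h (carrier G)" and fin: "finite S" and span: "h ` carrier G \<subseteq> rat_real.span S"
  shows "group_rank G = rat_real.dim (h ` carrier G)"
proof -
  interpret G: comm_group G by fact
  interpret R: comm_group "additive_group (UNIV :: real set)"
    by (rule comm_group_additive_group) auto
  interpret h: group_hom G "additive_group (UNIV :: real set)" h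
    by unfold_locales (rule h)
  have hsum: "h (finprod G (\<lambda>b. b [^]\<^bsub>G\<^esub> (c b :: int)) B) = (\<Sum>b\<in>B. of_int (c b) * h b)"
    if "finite B" "B \<subseteq> carrier G" for B and c
    using that
  proof (induction B)
    case empty
    then show ?case using h.hom_one by simp
  next
    case (insert x B)
    have "finprod G (\<lambda>b. b [^]\<^bsub>G\<^esub> (c b :: int)) (insert x B) =
            x [^]\<^bsub>G\<^esub> c x \<otimes>\<^bsub>G\<^esub> finprod G (\<lambda>b. b [^]\<^bsub>G\<^esub> c b) B"
      using insert by (intro G.finprod_insert) auto
    moreover have "finprod G (\<lambda>b. b [^]\<^bsub>G\<^esub> c b) B \<in> carrier G"
      using insert by (intro G.finprod_closed) auto
    moreover have "h (x [^]\<^bsub>G\<^esub> c x) = of_int (c x) * h x"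
      using insert h.hom_int_pow[of x "c x"] by (simp add: int_pow_additive_real)
    ultimately show ?case using insert by simp
  qed
  have indep: "int_independent G B \<longleftrightarrow> finite B \<and> B \<subseteq> carrier G \<and> rat_real.independent (h ` B)" for B
  proof (cases "finite B \<and> B \<subseteq> carrier G")
    case True
    then have injB: "inj_on h B" using inj inj_on_subset by blast
    have one: "finprod G (\<lambda>b. b [^]\<^bsub>G\<^esub> (c b :: int)) B = \<one>\<^bsub>G\<^esub> \<longleftrightarrow> (\<Sum>b\<in>B. of_int (c b) * h b) = 0" for c
    proof -
      have "finprod G (\<lambda>b. b [^]\<^bsub>G\<^esub> c b) B \<in> carrier G"
        using True by (intro G.finprod_closed) auto
      then have "finprod G (\<lambda>b. b [^]\<^bsub>G\<^esub> (c b :: int)) B = \<one>\<^bsub>G\<^esub> \<longleftrightarrow> h (finprod G (\<lambda>b. b [^]\<^bsub>G\<^esub> c b) B) = h \<one>\<^bsub>G\<^esub>"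
        using inj_on_eq_iff[OF inj, of _ "\<one>\<^bsub>G\<^esub>"] by auto
      then show ?thesis using hsum[of B c] True h.hom_one by simp
    qed
    have "(\<forall>c::real \<Rightarrow> int. (\<Sum>b\<in>h ` B. of_int (c b) * b) = 0 \<longrightarrow> (\<forall>b\<in>h ` B. c b = 0))
       \<longleftrightarrow> (\<forall>c::'a \<Rightarrow> int. (\<Sum>b\<in>B. of_int (c b) * h b) = 0 \<longrightarrow> (\<forall>b\<in>B. c b = 0))" (is "?L \<longleftrightarrow> ?R")
    proof
      assume L: ?L
      show ?R
      proof (intro allI impI)
        fix c :: "'a \<Rightarrow> int" assume 0: "(\<Sum>b\<in>B. of_int (c b) * h b) = 0"
        have "(\<Sum>b\<in>h ` B. of_int ((c \<circ> inv_into B h) b) * b) = 0"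
          using 0 injB by (simp add: sum.reindex)
        then have "\<forall>b\<in>h ` B. (c \<circ> inv_into B h) b = 0" using L by blast
        then show "\<forall>b\<in>B. c b = 0" using injB by auto
      qed
    next
      assume R: ?R
      show ?L
      proof (intro allI impI)
        fix c :: "real \<Rightarrow> int" assume 0: "(\<Sum>b\<in>h ` B. of_int (c b) * b) = 0"
        then have "(\<Sum>b\<in>B. of_int ((c \<circ> h) b) * h b) = 0"
          using injB by (simp add: sum.reindex)
        then have "\<forall>b\<in>B. (c \<circ> h) b = 0" using R by blast
        then show "\<forall>b\<in>h ` B. c b = 0" by auto
      qed
    qed
    then show ?thesis
      using True one unfolding int_independent_def by (simp add: rat_independent_iff_int)
  next
    case False
    then show ?thesis unfolding int_independent_def by auto
  qed
  let ?V = "h ` carrier G"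
  obtain B where B: "B \<subseteq> ?V" "rat_real.independent B" "?V \<subseteq> rat_real.span B" "card B = rat_real.dim ?V"
    using rat_real.basis_exists by blast
  \<comment> \<open>Finite rational dimension bounds the cardinalities whose supremum is
    \<open>group_rank\<close>, so that the supremum is not a dummy value.\<close>
  have Bfin: "finite B"
    using rat_real.independent_span_bound[OF fin B(2)] B(1) span by auto
  have le: "card C \<le> rat_real.dim ?V" if "int_independent G C" for C
  proof -
    have C: "finite C" "C \<subseteq> carrier G" "rat_real.independent (h ` C)" using that indep by auto
    then have "card (h ` C) \<le> card B"
      using rat_real.independent_span_bound[OF Bfin C(3)] B(3) by blast
    moreover have "card (h ` C) = card C" using C inj card_image inj_on_subset by metis
    ultimately show ?thesis using B by simp
  qed
  define B' where "B' = inv_into (carrier G) h ` B"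
  have "h ` B' = B" "B' \<subseteq> carrier G" using B(1) unfolding B'_def
    by (auto simp: image_image f_inv_into_f inv_into_into subset_iff cong: image_cong)
  moreover have "card B' = card B" unfolding B'_def
    by (rule card_image) (meson B(1) inj_on_inv_into)
  ultimately have "int_independent G B'" "card B' = rat_real.dim ?V"
    using indep B Bfin B'_def by auto
  then show ?thesis unfolding group_rank_def
    using le by (intro cSup_eq_maximum) (auto intro!: exI[of _ B'])
qed


lemma group_rank_FactGroup_real_hom:
  fixes l :: "'a::ab_group_add \<Rightarrow> real"
  assumes A: "0 \<in> A" "\<And>x y. x \<in> A \<Longrightarrow> y \<in> A \<Longrightarrow> x + y \<in> A" "\<And>x. x \<in> A \<Longrightarrow> - x \<in> A"
    and add: "\<And>x y. x \<in> A \<Longrightarrow> y \<in> A \<Longrightarrow> l (x + y) = l x + l y"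
    and fin: "finite S" and span: "l ` A \<subseteq> rat_real.span S"
  shows "group_rank (additive_group A Mod {x\<in>A. l x = 0}) = rat_real.dim (l ` A)"
proof -
  interpret A: comm_group "additive_group A" by (rule comm_group_additive_group) (use A in auto)
  interpret R: comm_group "additive_group (UNIV :: real set)"
    by (rule comm_group_additive_group) auto
  interpret lh: group_hom "additive_group A" "additive_group (UNIV :: real set)" l
    by unfold_locales (auto simp: hom_def add)
  have ker: "kernel (additive_group A) (additive_group (UNIV :: real set)) l = {x\<in>A. l x = 0}"
    by (auto simp: kernel_def)
  let ?Q = "additive_group A Mod {x\<in>A. l x = 0}"
  let ?h = "\<lambda>X. the_elem (l ` X)"
  have sub: "subgroup {x\<in>A. l x = 0} (additive_group A)"
    using lh.subgroup_kernel ker by simp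
  have Q: "comm_group ?Q" by (rule A.abelian_FactGroup[OF sub])
  have hom: "?h \<in> hom ?Q (additive_group UNIV)"
    using lh.FactGroup_hom ker by simp
  have inj: "inj_on ?h (carrier ?Q)" using lh.FactGroup_inj_on ker by simp
  have im: "?h ` carrier ?Q = l ` A"
  proof -
    \<comment> \<open>The codomain is cut down to the image, which makes \<open>l\<close> surjective
      and identifies the quotient with all of it.\<close>
    interpret lh': group_hom "additive_group A" "additive_group (l ` A)" l
    proof -
      interpret B: comm_group "additive_group (l ` A)"
      proof (rule comm_group_additive_group)
        show "0 \<in> l ` A" using lh.hom_one A(1) by (metis additive_group_simps(3) image_eqI)
        show "x + y \<in> l ` A" if "x \<in> l ` A" "y \<in> l ` A" for x y
          using that A(2) by (auto simp flip: add)
        show "- x \<in> l ` A" if x: "x \<in> l ` A" for x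
        proof -
          obtain y where y: "y \<in> A" "x = l y" using x by auto
          have "l y + l (- y) = 0" using add[OF y(1) A(3)[OF y(1)]] lh.hom_one by simp
          then have "- x = l (- y)" using y(2) by simp
          then show ?thesis using A(3)[OF y(1)] by simp
        qed
      qed
      show "group_hom (additive_group A) (additive_group (l ` A)) l"
        by unfold_locales (auto simp: hom_def add)
    qed
    have "kernel (additive_group A) (additive_group (l ` A)) l = {x\<in>A. l x = 0}"
      by (auto simp: kernel_def)
    then show ?thesis using lh'.FactGroup_onto by simp
  qed
  show ?thesis using group_rank_eq_dim[OF Q hom inj fin] im span by simp
qed

section \<open>Counting values of a linear form on lattice vectors\<close>

lemma int_lattice_0 [simp]: "0 \<in> int_lattice"
  by (simp add: int_lattice_def)

lemma int_lattice_add: "x \<in> int_lattice \<Longrightarrow> y \<in> int_lattice \<Longrightarrow> x + y \<in> int_lattice"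
  by (simp add: int_lattice_def)

lemma int_lattice_uminus: "x \<in> int_lattice \<Longrightarrow> - x \<in> int_lattice"
  by (simp add: int_lattice_def)

lemma int_lattice_diff: "x \<in> int_lattice \<Longrightarrow> y \<in> int_lattice \<Longrightarrow> x - y \<in> int_lattice"
  by (simp add: int_lattice_def)

lemma int_lattice_scaleR: "x \<in> int_lattice \<Longrightarrow> of_int k *\<^sub>R x \<in> int_lattice"
  by (simp add: int_lattice_def)

lemma int_lattice_sum: "(\<And>i. i \<in> S \<Longrightarrow> f i \<in> int_lattice) \<Longrightarrow> sum f S \<in> int_lattice"
  by (induction S rule: infinite_finite_induct) (auto intro: int_lattice_add)

lemma int_lattice_axis: "axis j 1 \<in> int_lattice"
  by (simp add: int_lattice_def axis_def)

lemma norm1_0 [simp]: "norm1 0 = 0"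
  by (simp add: norm1_def)

lemma norm1_nonneg: "norm1 x \<ge> 0"
  by (simp add: norm1_def sum_nonneg)

lemma norm1_minus [simp]: "norm1 (- x) = norm1 x"
  by (simp add: norm1_def)

lemma norm1_triangle: "norm1 (x + y) \<le> norm1 x + norm1 y"
  unfolding norm1_def sum.distrib[symmetric] by (intro sum_mono) (simp add: abs_triangle_ineq)

lemma norm1_triangle_diff: "norm1 (x - y) \<le> norm1 x + norm1 y"
  using norm1_triangle[of x "-y"] by simp

lemma norm1_scaleR: "norm1 (c *\<^sub>R x) = \<bar>c\<bar> * norm1 x"
  by (simp add: norm1_def abs_mult sum_distrib_left)

lemma norm1_sum: "norm1 (sum f S) \<le> (\<Sum>i\<in>S. norm1 (f i))"
proof (induction S rule: infinite_finite_induct)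
  case (insert x S)
  then show ?case using norm1_triangle[of "f x" "sum f S"] by simp
qed auto

lemma norm1_axis: "norm1 (axis j 1) = 1"
  by (simp add: norm1_def axis_def if_distrib cong: if_cong)

lemma norm_le_norm1: "norm x \<le> norm1 x"
  unfolding norm1_def by (rule norm_le_l1_cart)

lemma norm1_le_norm: "norm1 (x :: real ^ 'n) \<le> CARD('n) * norm x"
proof -
  have "norm1 x \<le> (\<Sum>i\<in>(UNIV :: 'n set). norm x)"
    unfolding norm1_def by (intro sum_mono) (rule component_le_norm_cart)
  then show ?thesis by simp
qed

lemma finite_lattice_ball: "finite {z \<in> int_lattice. norm1 (z :: real ^ 'n) \<le> r}"
proof -
  let ?J = "of_int ` {\<lfloor>-r\<rfloor>..\<lceil>r\<rceil>} :: real set"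
  let ?P = "PiE (UNIV :: 'n set) (\<lambda>_. ?J)"
  have "{z \<in> int_lattice. norm1 (z :: real ^ 'n) \<le> r} \<subseteq> (\<lambda>f. \<chi> i. f i) ` ?P"
  proof
    fix z :: "real ^ 'n" assume z: "z \<in> {z \<in> int_lattice. norm1 z \<le> r}"
    have "z $ i \<in> ?J" for i
    proof -
      have "\<bar>z $ i\<bar> \<le> norm1 z"
        unfolding norm1_def by (rule member_le_sum) auto
      then have "\<bar>z $ i\<bar> \<le> r" using z by simp
      moreover obtain k where k: "z $ i = of_int k"
        using z by (auto simp: int_lattice_def Ints_def)
      ultimately have "k \<in> {\<lfloor>-r\<rfloor>..\<lceil>r\<rceil>}"
        by (auto simp: floor_le_iff le_ceiling_iff)
      then show ?thesis using k by auto
    qed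
    then have "($) z \<in> ?P" by auto
    moreover have "z = (\<chi> i. z $ i)" by simp
    ultimately show "z \<in> (\<lambda>f. \<chi> i. f i) ` ?P" by blast
  qed
  moreover have "finite ?P" by (intro finite_PiE) auto
  ultimately show ?thesis using finite_surj by blast
qed

lemma card_PiE_const: "finite S \<Longrightarrow> card (PiE S (\<lambda>_. T)) = card T ^ card S"
  by (simp add: card_PiE)

section \<open>Rational structure of the values of a linear form\<close>

lemma linear_lattice_expansion:
  fixes l :: "real ^ 'n \<Rightarrow> real"
  assumes "linear l"
  shows "l z = (\<Sum>j\<in>UNIV. z $ j * l (axis j 1))"
proof -
  have "l z = l (\<Sum>j\<in>UNIV. z $ j *\<^sub>R axis j 1)"
    using basis_expansion[of z] by (simp add: scalar_mult_eq_scaleR)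
  also have "\<dots> = (\<Sum>j\<in>UNIV. z $ j * l (axis j 1))"
    using assms by (simp add: linear_sum linear_scale)
  finally show ?thesis .
qed

lemma lattice_image_in_span:
  fixes l :: "real ^ 'n \<Rightarrow> real"
  assumes "linear l"
  shows "l ` int_lattice \<subseteq> rat_real.span (range (\<lambda>j. l (axis j 1)))"
proof
  fix t assume "t \<in> l ` int_lattice"
  then obtain z where z: "z \<in> int_lattice" "t = l z" by auto
  then have "\<forall>j. \<exists>k. z $ j = of_int k" by (auto simp: int_lattice_def Ints_def)
  then obtain k where k: "\<And>j. z $ j = of_int (k j)" by metis
  have "t = (\<Sum>j\<in>UNIV. real_of_rat (of_int (k j)) * l (axis j 1))"
    using linear_lattice_expansion[OF assms, of z] z k by simp
  also have "\<dots> \<in> rat_real.span (range (\<lambda>j. l (axis j 1)))"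
    by (intro rat_real.span_sum rat_real.span_scale rat_real.span_base) auto
  finally show "t \<in> rat_real.span (range (\<lambda>j. l (axis j 1)))" .
qed

text \<open>The values at the unit vectors span, so a basis can be chosen among them. Each basis
  element is then attained at a lattice vector of norm 1, which gives the control of norms in the
  count from below.\<close>

lemma lattice_image_basis:
  fixes l :: "real ^ 'n \<Rightarrow> real"
  assumes l: "linear l"
  obtains B j where "finite B" "rat_real.independent B" "card B = rat_real.dim (l ` int_lattice)"
    "\<And>b. b \<in> B \<Longrightarrow> l (axis (j b) 1) = b" "l ` int_lattice \<subseteq> rat_real.span B"
proof -
  let ?A = "range (\<lambda>j. l (axis j 1))"
  obtain B where B: "B \<subseteq> ?A" "rat_real.independent B" "?A \<subseteq> rat_real.span B"
    using rat_real.maximal_independent_subset by blast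
  have fin: "finite B" by (rule finite_subset[OF B(1)]) simp
  have "\<forall>b\<in>B. \<exists>j. l (axis j 1) = b" using B(1) by auto
  then obtain j where j: "\<And>b. b \<in> B \<Longrightarrow> l (axis (j b) 1) = b" by metis
  have sp: "l ` int_lattice \<subseteq> rat_real.span B"
    using lattice_image_in_span[OF l] rat_real.span_minimal[OF B(3) rat_real.subspace_span] by blast
  have "B \<subseteq> l ` int_lattice" using j int_lattice_axis by (metis image_eqI subsetI)
  then have "card B = rat_real.dim (l ` int_lattice)"
    using sp B(2) rat_real.dim_unique by metis
  then show ?thesis using that fin B(2) j sp by blast
qed

text \<open>Guarantees that the exponent \<open>dim - 1\<close> is not a truncated
  subtraction.\<close>

lemma dim_lattice_image_pos:
  fixes l :: "real ^ 'n \<Rightarrow> real"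
  assumes l: "linear l" and z: "z \<in> int_lattice" "l z \<noteq> 0"
  shows "rat_real.dim (l ` int_lattice) \<ge> 1"
proof -
  obtain B j where B: "finite B" "card B = rat_real.dim (l ` int_lattice)" "l ` int_lattice \<subseteq> rat_real.span B"
    using lattice_image_basis[OF l] by metis
  have "B \<noteq> {}" using B(3) z by auto
  then have "card B \<noteq> 0" using B(1) by simp
  then show ?thesis using B(2) by linarith
qed

text \<open>A value is determined by its coordinates other than \<open>b0\<close> together with the integer part of
  its quotient by \<open>b0\<close>, which is bounded; this saves one power of \<open>n\<close>.\<close>

lemma count_lattice_values_le:
  fixes l :: "real ^ 'n \<Rightarrow> real"
  assumes l: "linear l" and z0: "z0 \<in> int_lattice" "l z0 \<noteq> 0"
  shows "\<exists>C>0. \<forall>n\<ge>1. real (card {t. \<bar>t\<bar> \<le> R \<and> (\<exists>z\<in>int_lattice. norm1 z \<le> real n \<and> t = l z)})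
            \<le> C * real n ^ (rat_real.dim (l ` int_lattice) - 1)"
proof -
  obtain B j where B: "finite B" "rat_real.independent B" "card B = rat_real.dim (l ` int_lattice)"
    "\<And>b. b \<in> B \<Longrightarrow> l (axis (j b) 1) = b" "l ` int_lattice \<subseteq> rat_real.span B"
    using lattice_image_basis[OF l] by metis
  have "B \<noteq> {}" using dim_lattice_image_pos[OF l z0] B(3) by auto
  then obtain b0 where b0: "b0 \<in> B" by auto
  then have b0n: "b0 \<noteq> 0" using B(2) rat_real.dependent_zero by metis
  have "\<exists>q. l (axis i 1) = (\<Sum>b\<in>B. real_of_rat (q b) * b)" for i
  proof -
    have "l (axis i 1) \<in> rat_real.span B" using B(5) int_lattice_axis by blast
    then show ?thesis unfolding rat_real.span_finite[OF B(1)] by auto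
  qed
  then obtain q where q: "\<And>i. l (axis i 1) = (\<Sum>b\<in>B. real_of_rat (q i b) * b)" by metis
  \<comment> \<open>The values at unit vectors have only rational coordinates in \<open>B\<close>.
    After multiplication by \<open>D\<close> the coordinates are integers, bounded by a multiple of
    the norm of the lattice vector.\<close>
  obtain D :: int where D: "D > 0" "\<forall>r\<in>(\<lambda>(i,b). q i b) ` (UNIV \<times> B). of_int D * r \<in> \<int>"
    using common_denominator[of "(\<lambda>(i,b). q i b) ` (UNIV \<times> B)"] B(1) by auto
  have "\<forall>i. \<forall>b\<in>B. \<exists>c::int. of_int D * q i b = of_int c" using D(2) by (auto simp: Ints_def)
  then obtain p where p: "\<And>i b. b \<in> B \<Longrightarrow> of_int D * q i b = of_int (p i b)" by metis
  have p': "real_of_int (p i b) = real_of_int D * real_of_rat (q i b)" if "b \<in> B" for i b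
    using arg_cong[OF p[OF that], of real_of_rat] by (simp add: of_rat_mult)
  define Q where "Q = (\<Sum>i\<in>UNIV. \<Sum>b\<in>B. \<bar>real_of_int (p i b)\<bar>)"
  have Q0: "Q \<ge> 0" unfolding Q_def by (intro sum_nonneg) auto
  have pQ: "\<bar>real_of_int (p i b)\<bar> \<le> Q" if "b \<in> B" for i b
  proof -
    have "\<bar>real_of_int (p i b)\<bar> \<le> (\<Sum>b\<in>B. \<bar>real_of_int (p i b)\<bar>)"
      using that B(1) by (intro member_le_sum) auto
    also have "\<dots> \<le> Q" unfolding Q_def
      by (rule member_le_sum) (auto intro: sum_nonneg)
    finally show ?thesis .
  qed
  have ex: "\<exists>k. D * l z = (\<Sum>b\<in>B. real_of_int (k b) * b) \<and> (\<forall>b\<in>B. \<bar>real_of_int (k b)\<bar> \<le> Q * norm1 z)"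
    if z: "z \<in> int_lattice" for z
  proof -
    have "\<forall>i. \<exists>k. z $ i = of_int k" using z by (auto simp: int_lattice_def Ints_def)
    then obtain y where y: "\<And>i. z $ i = of_int (y i)" by metis
    define k where "k b = (\<Sum>i\<in>UNIV. y i * p i b)" for b
    have "D * l z = (\<Sum>i\<in>UNIV. \<Sum>b\<in>B. (y i * (D * real_of_rat (q i b))) * b)"
      unfolding linear_lattice_expansion[OF l, of z] y q
      by (simp add: sum_distrib_left mult_ac)
    also have "\<dots> = (\<Sum>b\<in>B. real_of_int (k b) * b)"
      by (subst sum.swap) (simp add: k_def sum_distrib_right p')
    finally have 1: "D * l z = (\<Sum>b\<in>B. real_of_int (k b) * b)" .
    have "\<bar>real_of_int (k b)\<bar> \<le> Q * norm1 z" if "b \<in> B" for b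
    proof -
      have "\<bar>real_of_int (k b)\<bar> \<le> (\<Sum>i\<in>UNIV. \<bar>real_of_int (y i) * real_of_int (p i b)\<bar>)"
        unfolding k_def by (simp add: sum_abs)
      also have "\<dots> \<le> (\<Sum>i\<in>UNIV. \<bar>z $ i\<bar> * Q)"
        using pQ[OF that] by (intro sum_mono) (simp add: abs_mult y mult_left_mono)
      also have "\<dots> = Q * norm1 z" by (simp add: norm1_def sum_distrib_left mult.commute)
      finally show ?thesis .
    qed
    then show ?thesis using 1 by blast
  qed
  \<comment> \<open>Since \<bar>t\<bar> \<le> R, the quotient D t / b0 is at most s - 1 in absolute
    value; the extra 1 makes room for the floor. Taking \<bar>R\<bar> keeps s positive for every
    R.\<close>
  define s where "s = \<lceil>D * \<bar>R\<bar> / \<bar>b0\<bar>\<rceil> + 1"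
  define C where "C = (2 * Q + 3) ^ (card B - 1) * real (nat (2 * s + 1))"
  have "0 \<le> D * \<bar>R\<bar> / \<bar>b0\<bar>" using D(1) by simp
  from ceiling_mono[OF this] have s0: "s \<ge> 1" unfolding s_def by simp
  have C0: "C > 0" unfolding C_def using Q0 s0 by (intro mult_pos_pos zero_less_power) auto
  have "real (card {t. \<bar>t\<bar> \<le> R \<and> (\<exists>z\<in>int_lattice. norm1 z \<le> real n \<and> t = l z)}) \<le> C * real n ^ (card B - 1)"
    (is "real (card ?T) \<le> _") if n: "n \<ge> 1" for n
  proof -
    define m where "m = \<lceil>Q * n\<rceil>"
    have m0: "m \<ge> 0" unfolding m_def using Q0 by (simp add: le_ceiling_iff order_less_le_trans[of _ 0])
    have "\<forall>t\<in>?T. \<exists>k. real_of_int D * t = (\<Sum>b\<in>B. real_of_int (k b) * b) \<and> (\<forall>b\<in>B. \<bar>k b\<bar> \<le> m)"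
    proof
      fix t assume t: "t \<in> ?T"
      obtain z where z: "z \<in> int_lattice" "norm1 z \<le> real n" "t = l z" using t by auto
      obtain k where k: "D * l z = (\<Sum>b\<in>B. real_of_int (k b) * b)" "\<And>b. b \<in> B \<Longrightarrow> \<bar>real_of_int (k b)\<bar> \<le> Q * norm1 z"
        using ex[OF z(1)] by auto
      have "\<bar>k b\<bar> \<le> m" if "b \<in> B" for b
      proof -
        have "real_of_int \<bar>k b\<bar> \<le> Q * n"
          using k(2)[OF that] mult_left_mono[OF z(2) Q0] by simp
        also have "\<dots> \<le> of_int m" unfolding m_def by simp
        finally show ?thesis by linarith
      qed
      then show "\<exists>k. real_of_int D * t = (\<Sum>b\<in>B. real_of_int (k b) * b) \<and> (\<forall>b\<in>B. \<bar>k b\<bar> \<le> m)"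
        using k z by blast
    qed
    from bchoice[OF this] obtain k where
      k': "\<forall>t\<in>?T. real_of_int D * t = (\<Sum>b\<in>B. real_of_int (k t b) * b) \<and> (\<forall>b\<in>B. \<bar>k t b\<bar> \<le> m)" ..
    then have k: "real_of_int D * t = (\<Sum>b\<in>B. real_of_int (k t b) * b)" "b \<in> B \<Longrightarrow> \<bar>k t b\<bar> \<le> m"
      if "t \<in> ?T" for t b using that by blast+
    define g where "g t = (restrict (k t) (B - {b0}), \<lfloor>real_of_int D * t / b0\<rfloor>)" for t
    let ?P = "PiE (B - {b0}) (\<lambda>_. {-m..m}) \<times> {-s..s}"
    have inj: "inj_on g ?T"
    proof (rule inj_onI)
      fix t u assume t: "t \<in> ?T" and u: "u \<in> ?T" and g: "g t = g u"
      let ?r = "\<lambda>t. \<Sum>b\<in>B - {b0}. real_of_int (k t b) * b"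
      \<comment> \<open>Once the other coordinates are fixed, this floor differs from the coordinate
        of \<open>b0\<close> by a fixed integer. It therefore recovers the missing coordinate,
        although it takes only boundedly many values.\<close>
      have fl: "\<lfloor>real_of_int D * t / b0\<rfloor> = k t b0 + \<lfloor>?r t / b0\<rfloor>" if "t \<in> ?T" for t
      proof -
        have "real_of_int D * t = k t b0 * b0 + ?r t"
          using k(1)[OF that] by (simp add: sum.remove[OF B(1) b0])
        then have "real_of_int D * t / b0 = k t b0 + ?r t / b0" using b0n by (simp add: field_simps)
        then show ?thesis by simp
      qed
      have eq: "k t b = k u b" if "b \<in> B - {b0}" for b
        using g that unfolding g_def by (metis Pair_inject restrict_apply')
      then have "?r t = ?r u" by (intro sum.cong) auto
      moreover have "\<lfloor>real_of_int D * t / b0\<rfloor> = \<lfloor>real_of_int D * u / b0\<rfloor>" using g unfolding g_def by simp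
      ultimately have "k t b0 = k u b0" using fl[OF t] fl[OF u] by simp
      then have "real_of_int D * t = real_of_int D * u"
        unfolding k(1)[OF t] k(1)[OF u] using eq by (intro sum.cong) auto
      then show "t = u" using D by simp
    qed
    have sub: "g ` ?T \<subseteq> ?P"
    proof (rule image_subsetI)
      fix t assume t: "t \<in> ?T"
      have "\<bar>real_of_int D * t / b0\<bar> \<le> D * \<bar>R\<bar> / \<bar>b0\<bar>"
        unfolding abs_mult abs_divide
        using t D(1) by (intro divide_right_mono mult_mono) auto
      then have "\<bar>real_of_int D * t / b0\<bar> \<le> s - 1" unfolding s_def by linarith
      then have "\<lfloor>real_of_int D * t / b0\<rfloor> \<in> {-s..s}"
        unfolding abs_le_iff atLeastAtMost_iff by linarith
      moreover have "k t b \<in> {-m..m}" if "b \<in> B" for b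
        using k(2)[OF t that] by auto
      ultimately show "g t \<in> ?P" unfolding g_def by auto
    qed
    have "card ?T \<le> card ?P"
      using B(1) by (intro card_inj_on_le[OF inj sub]) (auto intro: finite_PiE)
    also have "\<dots> = nat (2 * m + 1) ^ (card B - 1) * nat (2 * s + 1)"
      using B(1) b0 by (simp add: card_cartesian_product card_PiE_const algebra_simps)
    finally have "real (card ?T) \<le> real (nat (2 * m + 1) ^ (card B - 1) * nat (2 * s + 1))"
      by (rule of_nat_mono)
    also have "\<dots> = real (nat (2 * m + 1)) ^ (card B - 1) * real (nat (2 * s + 1))"
      by (simp only: of_nat_mult of_nat_power)
    also have "\<dots> \<le> ((2 * Q + 3) * n) ^ (card B - 1) * real (nat (2 * s + 1))"
    proof -
      \<comment> \<open>Hence 2m + 1 \<le> 2Qn + 3, and n \<ge> 1 absorbs the 3 into the factor 2Q +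
        3.\<close>
      have "m \<le> Q * n + 1" unfolding m_def by linarith
      then have "real (nat (2 * m + 1)) \<le> 2 * (Q * n) + 3" using m0 by simp
      also have "\<dots> \<le> (2 * Q + 3) * n" using n by (simp add: algebra_simps)
      finally show ?thesis by (intro mult_right_mono power_mono) auto
    qed
    also have "\<dots> = C * real n ^ (card B - 1)"
      by (simp add: C_def power_mult_distrib)
    finally show ?thesis .
  qed
  then show ?thesis using C0 B(3) by auto
qed

text \<open>The coordinates other than that of one basis element \<open>b0\<close> run freely
  through n values each, and the coordinate of \<open>b0\<close> is then used up to bring the value
  back to bounded size. Independence keeps the values distinct.\<close>

lemma count_lattice_values_ge:
  fixes l :: "real ^ 'n \<Rightarrow> real"
  assumes l: "linear l" and z0: "z0 \<in> int_lattice" "l z0 \<noteq> 0"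
  shows "\<exists>C>0. \<forall>n\<ge>1. \<exists>Y\<subseteq>int_lattice. finite Y \<and> card Y = n ^ (rat_real.dim (l ` int_lattice) - 1) \<and>
            inj_on l Y \<and> (\<forall>z\<in>Y. norm1 z \<le> C * real n \<and> \<bar>l z\<bar> \<le> C)"
proof -
  obtain B j where B: "finite B" "rat_real.independent B" "card B = rat_real.dim (l ` int_lattice)"
    "\<And>b. b \<in> B \<Longrightarrow> l (axis (j b) 1) = b" "l ` int_lattice \<subseteq> rat_real.span B"
    using lattice_image_basis[OF l] by metis
  have "B \<noteq> {}" using dim_lattice_image_pos[OF l z0] B(3) by auto
  then obtain b0 where b0: "b0 \<in> B" by auto
  then have b0n: "b0 \<noteq> 0" using B(2) rat_real.dependent_zero by metis
  define S where "S = (\<Sum>b\<in>B - {b0}. \<bar>b\<bar>)"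
  \<comment> \<open>\<open>card B\<close> pays for the free coordinates, S / \<bar>b0\<bar> + 1 for
    the correcting coordinate, and \<bar>b0\<bar> bounds the corrected value.\<close>
  define C where "C = card B + S / \<bar>b0\<bar> + 1 + \<bar>b0\<bar>"
  have S0: "S \<ge> 0" unfolding S_def by (intro sum_nonneg) auto
  have C0: "C > 0" unfolding C_def using S0 by (intro add_nonneg_pos add_nonneg_nonneg) (use b0n in auto)
  have "\<exists>Y\<subseteq>int_lattice. finite Y \<and> card Y = n ^ (card B - 1) \<and>
            inj_on l Y \<and> (\<forall>z\<in>Y. norm1 z \<le> C * real n \<and> \<bar>l z\<bar> \<le> C)" if n: "n \<ge> 1" for n
  proof -
    let ?V = "PiE (B - {b0}) (\<lambda>_. {0..<int n})"
    define r where "r v = (\<Sum>b\<in>B - {b0}. real_of_int (v b) * b)" for v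
    \<comment> \<open>Leaves the fractional part of r v / b0, times b0.\<close>
    define k where "k v = - \<lfloor>r v / b0\<rfloor>" for v
    define Z where "Z v = (\<Sum>b\<in>B - {b0}. real_of_int (v b) *\<^sub>R axis (j b) 1) +
                       real_of_int (k v) *\<^sub>R (axis (j b0) 1 :: real ^ 'n)" for v
    have lZ: "l (Z v) = r v + k v * b0" for v
      using l B(4) b0 unfolding Z_def r_def by (simp add: linear_add linear_sum linear_scale)
    have inj: "inj_on (l \<circ> Z) ?V"
    proof (rule inj_onI)
      fix v w assume v: "v \<in> ?V" and w: "w \<in> ?V" and eq: "(l \<circ> Z) v = (l \<circ> Z) w"
      let ?c = "\<lambda>b. if b = b0 then k v - k w else v b - w b"
      have "(\<Sum>b\<in>B. real_of_int (?c b) * b) =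
              (k v - k w) * b0 + (\<Sum>b\<in>B - {b0}. real_of_int (?c b) * b)"
        by (simp add: sum.remove[OF B(1) b0])
      also have "(\<Sum>b\<in>B - {b0}. real_of_int (?c b) * b) = (\<Sum>b\<in>B - {b0}. (real_of_int (v b) * b - real_of_int (w b) * b))"
        by (intro sum.cong) (auto simp: algebra_simps)
      also have "\<dots> = r v - r w" by (simp add: r_def sum_subtractf)
      finally have "(\<Sum>b\<in>B. real_of_int (?c b) * b) = 0"
        using eq lZ by (simp add: algebra_simps)
      with B(2)[unfolded rat_independent_iff_int[OF B(1)], THEN spec[of _ ?c]]
      have c: "\<forall>b\<in>B. ?c b = 0" by (rule mp)
      show "v = w"
      proof (rule PiE_ext[OF v w])
        fix b assume "b \<in> B - {b0}"
        then show "v b = w b" using c by auto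
      qed
    qed
    have "norm1 (Z v) \<le> C * n \<and> \<bar>l (Z v)\<bar> \<le> C" if v: "v \<in> ?V" for v
    proof
      have vb: "\<bar>real_of_int (v b)\<bar> \<le> n" if "b \<in> B - {b0}" for b
        using PiE_mem[OF v that] by auto
      have "norm1 (Z v) \<le> (\<Sum>b\<in>B - {b0}. \<bar>real_of_int (v b)\<bar>) + \<bar>real_of_int (k v)\<bar>"
      proof -
        have "norm1 (\<Sum>b\<in>B - {b0}. real_of_int (v b) *\<^sub>R (axis (j b) 1 :: real ^ 'n)) \<le> (\<Sum>b\<in>B - {b0}. \<bar>real_of_int (v b)\<bar>)"
          using norm1_sum[of "\<lambda>b. real_of_int (v b) *\<^sub>R (axis (j b) 1 :: real ^ 'n)" "B - {b0}"]
          by (simp add: norm1_scaleR norm1_axis)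
        then show ?thesis
          unfolding Z_def by (intro order_trans[OF norm1_triangle] add_mono) (auto simp: norm1_scaleR norm1_axis)
      qed
      also have "(\<Sum>b\<in>B - {b0}. \<bar>real_of_int (v b)\<bar>) \<le> real (card (B - {b0})) * n"
        using sum_mono[OF vb] by (metis (no_types, lifting) sum_bounded_above vb)
      also have "\<dots> \<le> real (card B) * n"
        using B(1) by (intro mult_right_mono of_nat_mono card_mono) auto
      also have "\<bar>real_of_int (k v)\<bar> \<le> (S / \<bar>b0\<bar> + 1) * n"
      proof -
        have "\<bar>r v\<bar> \<le> (\<Sum>b\<in>B - {b0}. \<bar>real_of_int (v b) * b\<bar>)" unfolding r_def by (rule sum_abs)
        also have "\<dots> \<le> (\<Sum>b\<in>B - {b0}. n * \<bar>b\<bar>)"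
          using vb by (intro sum_mono) (simp add: abs_mult mult_right_mono)
        also have "\<dots> = n * S" by (simp add: S_def sum_distrib_left)
        finally have "\<bar>r v / b0\<bar> \<le> n * S / \<bar>b0\<bar>" by (simp add: divide_right_mono)
        then have "\<bar>real_of_int (k v)\<bar> \<le> n * S / \<bar>b0\<bar> + 1" unfolding k_def by linarith
        also have "\<dots> \<le> (S / \<bar>b0\<bar> + 1) * n" using n by (simp add: algebra_simps)
        finally show ?thesis .
      qed
      also have "real (card B) * n + (S / \<bar>b0\<bar> + 1) * n \<le> C * n"
        unfolding C_def by (simp add: algebra_simps)
      finally show "norm1 (Z v) \<le> C * n" by simp
      have "l (Z v) = (r v / b0 - \<lfloor>r v / b0\<rfloor>) * b0"
        unfolding lZ k_def using b0n by (simp add: field_simps)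
      then have "\<bar>l (Z v)\<bar> = \<bar>r v / b0 - \<lfloor>r v / b0\<rfloor>\<bar> * \<bar>b0\<bar>" by (simp add: abs_mult)
      also have "\<dots> \<le> 1 * \<bar>b0\<bar>" by (intro mult_right_mono) (auto, linarith)
      also have "\<dots> \<le> C" unfolding C_def using S0 by simp
      finally show "\<bar>l (Z v)\<bar> \<le> C" .
    qed
    moreover have "Z ` ?V \<subseteq> int_lattice"
      unfolding Z_def by (auto intro!: int_lattice_add int_lattice_sum int_lattice_scaleR int_lattice_axis)
    moreover have "finite (Z ` ?V)" using B(1) by (intro finite_imageI finite_PiE) auto
    moreover have "card (Z ` ?V) = n ^ (card B - 1)"
      using inj_on_imageI2[OF inj] B(1) b0 by (simp add: card_image card_PiE_const)
    moreover have "inj_on l (Z ` ?V)" using inj by (rule inj_on_imageI)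
    ultimately show ?thesis by (intro exI[of _ "Z ` ?V"]) auto
  qed
  then show ?thesis using C0 B(3) by auto
qed

section \<open>Patterns of half-spaces\<close>

definition shatters :: "'a set set \<Rightarrow> 'a set \<Rightarrow> bool" where
  "shatters \<A> S \<longleftrightarrow> (\<forall>T\<subseteq>S. \<exists>A\<in>\<A>. A \<inter> S = T)"

lemma shattersD: "shatters \<A> S \<Longrightarrow> T \<subseteq> S \<Longrightarrow> \<exists>A\<in>\<A>. A \<inter> S = T"
  by (auto simp: shatters_def)

text \<open>Split the family by membership of \<open>x\<close>, and delete \<open>x\<close> from the
  sets containing it. A set shattered by the union of the two halves is shattered by
  \<open>\<A>\<close>; if both halves share the members that shatter \<open>S\<close>, then
  \<open>\<A>\<close> shatters \<open>insert x S\<close>. The identity card A + card B = card (A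
  \<union> B) + card (A \<inter> B) matches the two kinds of shattered sets, which are
  disjoint.\<close>

lemma pajor:
  assumes "finite X" "\<A> \<subseteq> Pow X"
  shows "card \<A> \<le> card {S. S \<subseteq> X \<and> shatters \<A> S}"
  using assms
proof (induction X arbitrary: \<A>)
  case empty
  then have "\<A> = {} \<or> \<A> = {{}}" by auto
  then show ?case
  proof
    assume A: "\<A> = {{}}"
    have "{S. S \<subseteq> {} \<and> shatters {{}} S} = {{}::'a set}" by (auto simp: shatters_def)
    then show ?thesis unfolding A by simp
  qed simp
next
  case (insert x X)
  let ?a = "{A\<in>\<A>. x \<notin> A}" and ?b = "{A\<in>\<A>. x \<in> A}"
  let ?b' = "(\<lambda>A. A - {x}) ` ?b"
  have fin: "finite \<A>" 
    by (rule finite_subset[OF insert.prems]) (use insert.hyps in simp)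
  have "card \<A> = card ?a + card ?b"
  proof -
    have "card (?a \<union> ?b) = card ?a + card ?b" using fin by (intro card_Un_disjoint) auto
    moreover have "?a \<union> ?b = \<A>" by auto
    ultimately show ?thesis by simp
  qed
  also have "card ?b = card ?b'"
    by (rule card_image[symmetric]) (auto intro!: inj_onI)
  also have "card ?a + card ?b' = card (?a \<union> ?b') + card (?a \<inter> ?b')"
    using fin by (intro card_Un_Int) auto
  also have "\<dots> \<le> card {S. S \<subseteq> X \<and> shatters (?a \<union> ?b') S} + card {S. S \<subseteq> X \<and> shatters (?a \<inter> ?b') S}"
    using insert.prems by (intro add_mono insert.IH) auto
  also have "\<dots> = card {S. S \<subseteq> X \<and> shatters (?a \<union> ?b') S} + card (insert x ` {S. S \<subseteq> X \<and> shatters (?a \<inter> ?b') S})"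
  proof -
    have "inj_on (insert x) {S. S \<subseteq> X \<and> shatters (?a \<inter> ?b') S}"
      using insert.hyps(2) by (intro inj_onI) (auto simp: insert_eq_iff subset_iff set_eq_iff)
    then show ?thesis by (simp add: card_image)
  qed
  also have "\<dots> = card ({S. S \<subseteq> X \<and> shatters (?a \<union> ?b') S} \<union> insert x ` {S. S \<subseteq> X \<and> shatters (?a \<inter> ?b') S})"
    using insert.hyps by (intro card_Un_disjoint[symmetric]) auto
  also have "\<dots> \<le> card {S. S \<subseteq> insert x X \<and> shatters \<A> S}"
  proof (rule card_mono)
    show "finite {S. S \<subseteq> insert x X \<and> shatters \<A> S}"
      using insert.hyps(1) by (auto intro: finite_subset[of _ "Pow (insert x X)"])
    have 1: "shatters \<A> S" if S: "S \<subseteq> X" "shatters (?a \<union> ?b') S" for S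
      unfolding shatters_def
    proof (intro allI impI)
      fix T assume "T \<subseteq> S"
      from shattersD[OF S(2) this] obtain A where A: "A \<in> ?a \<union> ?b'" "A \<inter> S = T" ..
      then have "\<exists>A'. A' \<in> \<A> \<and> A = A' - {x}"
        by (cases "A \<in> ?a") (auto intro: exI[of _ A])
      then obtain A' where "A' \<in> \<A>" "A = A' - {x}" by auto
      moreover have "x \<notin> S" using S(1) insert.hyps by auto
      ultimately show "\<exists>A\<in>\<A>. A \<inter> S = T" using A(2) by (intro bexI[of _ A']) auto
    qed
    have 2: "shatters \<A> (insert x S)" if S: "S \<subseteq> X" "shatters (?a \<inter> ?b') S" for S
      unfolding shatters_def
    proof (intro allI impI)
      fix T assume T: "T \<subseteq> insert x S"
      then have "T - {x} \<subseteq> S" by auto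
      from shattersD[OF S(2) this] obtain A where A: "A \<in> ?a \<inter> ?b'" "A \<inter> S = T - {x}" ..
      then obtain B where B: "A = B - {x}" "x \<in> B" "B \<in> \<A>" and "A \<in> \<A>" by auto
      moreover have "insert x A = B" using B by auto
      ultimately have A': "A \<in> \<A>" "insert x A \<in> \<A>" "x \<notin> A" by simp_all
      have xS: "x \<notin> S" using S(1) insert.hyps by auto
      show "\<exists>A\<in>\<A>. A \<inter> insert x S = T"
      proof (cases "x \<in> T")
        case True
        then show ?thesis using A A' xS by (intro bexI[of _ "insert x A"]) auto
      next
        case False
        then show ?thesis using A A' xS by (intro bexI[of _ A]) auto
      qed
    qed
    show "{S. S \<subseteq> X \<and> shatters (?a \<union> ?b') S} \<union> insert x ` {S. S \<subseteq> X \<and> shatters (?a \<inter> ?b') S}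
            \<subseteq> {S. S \<subseteq> insert x X \<and> shatters \<A> S}"
      using 1 2 by auto
  qed
  finally show ?case .
qed

text \<open>A linear relation between the normals of a shattered family of half-spaces forces the
  same combination of the offsets to be both nonnegative and nonpositive, one of them strictly.\<close>

lemma shattered_halfspaces_independent:
  fixes a :: "'i \<Rightarrow> 'a::real_inner"
  assumes fin: "finite S" and sh: "shatters {{i\<in>X. a i \<bullet> w \<le> b i} | w. w \<in> W} S" and "S \<subseteq> X"
  shows "inj_on a S" "independent (a ` S)"
proof -
  have zero: "c j = 0" if rel: "(\<Sum>i\<in>S. c i *\<^sub>R a i) = 0" and j: "j \<in> S" for c j
  proof (rule ccontr)
    assume cj: "c j \<noteq> 0"
    have dot: "(\<Sum>i\<in>S. c i * (a i \<bullet> w)) = 0" for w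
    proof -
      have "(\<Sum>i\<in>S. c i * (a i \<bullet> w)) = (\<Sum>i\<in>S. c i *\<^sub>R a i) \<bullet> w"
        by (simp add: inner_sum_left)
      then show ?thesis using rel by simp
    qed
    have pat: "\<exists>w. \<forall>i\<in>S. (a i \<bullet> w \<le> b i \<longleftrightarrow> i \<in> T)" if "T \<subseteq> S" for T
    proof -
      from shattersD[OF sh that] obtain A where
        A: "A \<in> {{i\<in>X. a i \<bullet> w \<le> b i} | w. w \<in> W}" "A \<inter> S = T" ..
      then obtain w where "A = {i\<in>X. a i \<bullet> w \<le> b i}" by blast
      then show ?thesis using A(2) \<open>S \<subseteq> X\<close> by (intro exI[of _ w]) blast
    qed
    \<comment> \<open>Shattering provides a point inside exactly the half-spaces with positive
      coefficient, and \<open>w2\<close> one inside exactly those with negative coefficient.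
      Termwise, \<open>w1\<close> then makes c i * (a i \<bullet> w) at most c i * b i and
      \<open>w2\<close> at least that. The inequality at \<open>j\<close> is strict for
      \<open>w2\<close> if c j > 0 and for \<open>w1\<close> if c j < 0.\<close>
    obtain w1 where w1: "\<And>i. i \<in> S \<Longrightarrow> (a i \<bullet> w1 \<le> b i \<longleftrightarrow> c i > 0)"
      using pat[of "{i\<in>S. c i > 0}"] by auto
    obtain w2 where w2: "\<And>i. i \<in> S \<Longrightarrow> (a i \<bullet> w2 \<le> b i \<longleftrightarrow> c i < 0)"
      using pat[of "{i\<in>S. c i < 0}"] by auto
    have le1: "c i * (a i \<bullet> w1) \<le> c i * b i" and le2: "c i * b i \<le> c i * (a i \<bullet> w2)" if "i \<in> S" for i
      using w1[OF that] w2[OF that] by (cases "c i" "0::real" rule: linorder_cases; simp)+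
    show False
    proof (cases "c j > 0")
      case True
      have "(\<Sum>i\<in>S. c i * b i) < (\<Sum>i\<in>S. c i * (a i \<bullet> w2))"
        using fin le2 w2[OF j] True j by (intro sum_strict_mono_ex1) (auto intro!: bexI[of _ j])
      moreover have "(\<Sum>i\<in>S. c i * (a i \<bullet> w1)) \<le> (\<Sum>i\<in>S. c i * b i)" by (intro sum_mono le1)
      ultimately show False using dot by simp
    next
      case False
      then have "c j < 0" using cj by simp
      then have "(\<Sum>i\<in>S. c i * (a i \<bullet> w1)) < (\<Sum>i\<in>S. c i * b i)"
        using fin le1 w1[OF j] j by (intro sum_strict_mono_ex1) (auto intro!: bexI[of _ j])
      moreover have "(\<Sum>i\<in>S. c i * b i) \<le> (\<Sum>i\<in>S. c i * (a i \<bullet> w2))" by (intro sum_mono le2)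
      ultimately show False using dot by simp
    qed
  qed
  show inj: "inj_on a S"
  proof (rule inj_onI, rule ccontr)
    fix i j assume ij: "i \<in> S" "j \<in> S" "a i = a j" "i \<noteq> j"
    \<comment> \<open>Two half-spaces with equal normals satisfy the relation a i - a j = 0. So a
      shattered family holds at most one half-space of each normal.\<close>
    let ?c = "\<lambda>k. if k = i then 1 else if k = j then -1 else (0::real)"
    have "(\<Sum>k\<in>S. ?c k *\<^sub>R a k) = (\<Sum>k\<in>{i, j}. ?c k *\<^sub>R a k)"
      using ij fin by (intro sum.mono_neutral_right) auto
    also have "\<dots> = 0" using ij by simp
    finally show False using zero[of ?c i] ij by simp
  qed
  show "independent (a ` S)"
  proof (rule independent_if_scalars_zero)
    fix f x assume 0: "(\<Sum>x\<in>a ` S. f x *\<^sub>R x) = 0" and x: "x \<in> a ` S"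
    have "(\<Sum>i\<in>S. f (a i) *\<^sub>R a i) = 0" using 0 by (simp add: sum.reindex[OF inj])
    then show "f x = 0" using zero[of "\<lambda>i. f (a i)"] x by auto
  qed (use fin in auto)
qed

text \<open>By independence of the normals, a shattered family has at most one offset per normal: it
  is the graph of a choice function on an independent set of normals. Such graphs are counted by the
  products on the right, over independent sets of every size.\<close>

lemma card_halfspace_patterns_le:
  fixes a :: "'h \<Rightarrow> 'a::real_inner" and T :: "'h \<Rightarrow> real set"
  assumes fin: "finite Hs" "\<And>h. h \<in> Hs \<Longrightarrow> finite (T h)"
  shows "card {{i\<in>Sigma Hs T. a (fst i) \<bullet> w \<le> snd i} | w. w \<in> W}
           \<le> (\<Sum>A | A \<subseteq> Hs \<and> inj_on a A \<and> independent (a ` A). \<Prod>h\<in>A. card (T h))"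
proof -
  let ?P = "{{i\<in>Sigma Hs T. a (fst i) \<bullet> w \<le> snd i} | w. w \<in> W}"
  let ?A = "{A. A \<subseteq> Hs \<and> inj_on a A \<and> independent (a ` A)}"
  let ?S = "SIGMA A:?A. PiE A T"
  have finA: "finite ?A" using fin(1) by (auto intro: finite_subset[of _ "Pow Hs"])
  have finPi: "finite (PiE A T)" if "A \<in> ?A" for A
    using that fin by (intro finite_PiE) (auto intro: finite_subset[of A Hs])
  have finX: "finite (Sigma Hs T)" using fin by auto
  have "card ?P \<le> card {S. S \<subseteq> Sigma Hs T \<and> shatters ?P S}"
    using finX by (intro pajor) auto
  also have "\<dots> \<le> card ((\<lambda>(A, f). (\<lambda>h. (h, f h)) ` A) ` ?S)"
  proof (rule card_mono)
    show "finite ((\<lambda>(A, f). (\<lambda>h. (h, f h)) ` A) ` ?S)"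
      using finA finPi by (intro finite_imageI finite_SigmaI)
    show "{S. S \<subseteq> Sigma Hs T \<and> shatters ?P S} \<subseteq> (\<lambda>(A, f). (\<lambda>h. (h, f h)) ` A) ` ?S"
    proof
      fix S assume "S \<in> {S. S \<subseteq> Sigma Hs T \<and> shatters ?P S}"
      then have S: "S \<subseteq> Sigma Hs T" "shatters ?P S" by auto
      have finS: "finite S" by (rule finite_subset[OF S(1) finX])
      have inj: "inj_on (a \<circ> fst) S" and ind: "independent (a ` fst ` S)"
        using shattered_halfspaces_independent[OF finS, of "Sigma Hs T" "a \<circ> fst" snd W] S
        by (auto simp: image_comp)
      define f where "f = restrict (\<lambda>h. snd (inv_into S fst h)) (fst ` S)"
      have injf: "inj_on fst S" using inj by (rule inj_on_imageI2)
      have f: "f (fst s) = snd s" if "s \<in> S" for s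
        using that injf by (simp add: f_def)
      have "(\<lambda>h. (h, f h)) ` (fst ` S) = (\<lambda>s. s) ` S"
        unfolding image_image using f by (intro image_cong) auto
      then have "S = (\<lambda>h. (h, f h)) ` (fst ` S)" by simp
      moreover have "f \<in> PiE (fst ` S) T"
        using f S(1) unfolding PiE_iff by (auto simp: f_def)
      moreover have "fst ` S \<in> ?A"
        using S(1) ind inj_on_imageI[OF inj] by auto
      ultimately show "S \<in> (\<lambda>(A, f). (\<lambda>h. (h, f h)) ` A) ` ?S"
        by (intro image_eqI[of _ _ "(fst ` S, f)"]) auto
    qed
  qed
  also have "\<dots> \<le> card ?S" using finA finPi by (intro card_image_le finite_SigmaI)
  also have "\<dots> = (\<Sum>A\<in>?A. card (PiE A T))" using finA finPi by (intro card_SigmaI) auto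
  also have "\<dots> = (\<Sum>A\<in>?A. \<Prod>h\<in>A. card (T h))"
    using fin(1) by (intro sum.cong refl card_PiE) (auto intro: finite_subset[of _ Hs])
  finally show ?thesis .
qed

section \<open>Facets of a full-dimensional polytope\<close>

lemma translate_span_eq_direction:
  assumes "p \<in> f"
  shows "span ((\<lambda>x. x - p) ` f) = direction f"
proof
  show "span ((\<lambda>x. x - p) ` f) \<subseteq> direction f"
    unfolding direction_def using assms by (intro span_mono) auto
  have "x - y \<in> span ((\<lambda>x. x - p) ` f)" if "x \<in> f" "y \<in> f" for x y
  proof -
    have "(x - p) - (y - p) \<in> span ((\<lambda>x. x - p) ` f)"
      using that by (intro span_diff span_base) auto
    then show ?thesis by simp
  qed
  then show "direction f \<subseteq> span ((\<lambda>x. x - p) ` f)"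
    unfolding direction_def by (intro span_minimal) auto
qed

lemma dim_direction:
  fixes f :: "'a::euclidean_space set"
  assumes "f \<noteq> {}"
  shows "int (dim (direction f)) = aff_dim f"
proof -
  obtain p where p: "p \<in> f" using assms by auto
  then have "aff_dim f = int (dim ((\<lambda>x. x - p) ` f))"
    by (intro aff_dim_eq_dim_subtract hull_inc)
  then show ?thesis using translate_span_eq_direction[OF p] dim_span by metis
qed

lemma dim_hyperplane_less:
  fixes a :: "'a::euclidean_space"
  assumes F: "subspace F" and a: "a \<in> F" "a \<noteq> 0"
  shows "dim {x \<in> F. a \<bullet> x = 0} < dim F"
proof (rule ccontr)
  have sub: "subspace {x \<in> F. a \<bullet> x = 0}"
    using F unfolding subspace_def by (auto simp: inner_add_right)
  assume "\<not> dim {x \<in> F. a \<bullet> x = 0} < dim F"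
  then have "{x \<in> F. a \<bullet> x = 0} = F" by (intro subspace_dim_equal sub F) auto
  then have "a \<bullet> a = 0" using a(1) by blast
  then show False using a(2) by simp
qed

text \<open>Since \<open>a\<close> is constant on \<open>f\<close>, differences are orthogonal to
  it. Equality follows by dimension: the hyperplane has dimension less than \<open>dim F\<close>,
  and the direction already has dimension \<open>dim F - 1\<close>.\<close>

lemma direction_eq_hyperplane:
  fixes f :: "'a::euclidean_space set"
  assumes F: "subspace F" and f: "f \<subseteq> F" "f \<noteq> {}" "aff_dim f = int (dim F) - 1"
    and a: "a \<in> F" "a \<noteq> 0" "\<And>x. x \<in> f \<Longrightarrow> a \<bullet> x = b"
  shows "direction f = {x \<in> F. a \<bullet> x = 0}"
proof (rule subspace_dim_equal)
  show "subspace (direction f)" by (simp add: direction_def)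
  show sub: "subspace {x \<in> F. a \<bullet> x = 0}"
    using F unfolding subspace_def by (auto simp: inner_add_right)
  show "direction f \<subseteq> {x \<in> F. a \<bullet> x = 0}"
    unfolding direction_def
    using f(1) a(3) F by (intro span_minimal sub) (auto simp: inner_diff_right intro: subspace_diff)
  show "dim {x \<in> F. a \<bullet> x = 0} \<le> dim (direction f)"
    using dim_hyperplane_less[OF F a(1,2)] dim_direction[OF f(2)] f(3) by linarith
qed

lemma affine_hull_eq_hyperplane:
  fixes f :: "'a::euclidean_space set"
  assumes F: "subspace F" and p: "p \<in> f" "f \<subseteq> F" and pb: "a \<bullet> p = b"
    and dir: "direction f = {x \<in> F. a \<bullet> x = 0}" and y: "y \<in> F" "a \<bullet> y = b"
  shows "y \<in> affine hull f"
proof -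
  have "y - p \<in> direction f"
    unfolding dir using y pb p F by (auto simp: inner_diff_right intro: subspace_diff)
  then have "y - p \<in> span ((\<lambda>x. x - p) ` f)" using translate_span_eq_direction[OF p(1)] by simp
  also have "span ((\<lambda>x. x - p) ` f) = span ((\<lambda>x. - p + x) ` (f - {p}))"
  proof -
    have "(\<lambda>x. x - p) ` f = insert 0 ((\<lambda>x. - p + x) ` (f - {p}))" using p(1) by force
    then show ?thesis by simp
  qed
  finally have "y - p \<in> span ((\<lambda>x. - p + x) ` (f - {p}))" .
  then show ?thesis unfolding affine_hull_span2[OF p(1)] by (force intro: image_eqI[of _ _ "y - p"])
qed

locale full_polytope =
  fixes F K :: "'a::euclidean_space set"
  assumes F: "subspace F" and dimF: "dim F \<ge> 1"
    and K: "K \<subseteq> F" "polytope K" "K = closure (top_of_set F interior_of K)" "K \<noteq> {}"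
begin

lemma interior_point:
  obtains w0 \<eta> where "w0 \<in> K" "\<eta> > 0" "\<And>w. w \<in> F \<Longrightarrow> norm (w - w0) \<le> \<eta> \<Longrightarrow> w \<in> K"
proof -
  have "top_of_set F interior_of K \<noteq> {}" using K(3,4) by auto
  then obtain w0 where w0: "w0 \<in> top_of_set F interior_of K" by auto
  then have "w0 \<in> K" using interior_of_subset by fastforce
  have "openin (top_of_set F) (top_of_set F interior_of K)" by simp
  then obtain e where e: "e > 0" "\<And>x. x \<in> F \<Longrightarrow> dist x w0 < e \<Longrightarrow> x \<in> top_of_set F interior_of K"
    using w0 unfolding openin_euclidean_subtopology_iff by blast
  have "w \<in> K" if "w \<in> F" "norm (w - w0) \<le> e / 2" for w
  proof -
    have "dist w w0 < e" using that e(1) by (simp add: dist_norm)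
    then show ?thesis using e(2)[OF that(1)] interior_of_subset by fastforce
  qed
  then show ?thesis using that[of w0 "e / 2"] \<open>w0 \<in> K\<close> e(1) by simp
qed

lemma affine_hull_K: "affine hull K = F"
proof -
  have aF: "affine hull F = F" using F by (simp add: subspace_imp_affine)
  have ne: "top_of_set F interior_of K \<noteq> {}" using K(3,4) by auto
  have "openin (top_of_set (affine hull F)) (top_of_set F interior_of K)" unfolding aF by simp
  then have "affine hull (top_of_set F interior_of K) = F"
    using affine_hull_openin ne aF by metis
  moreover have "affine hull (top_of_set F interior_of K) \<subseteq> affine hull K"
    by (intro hull_mono interior_of_subset)
  moreover have "affine hull K \<subseteq> F" using hull_mono[OF K(1), of affine] aF by simp
  ultimately show ?thesis by auto
qed

lemma aff_dim_K: "aff_dim K = int (dim F)"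
  using affine_hull_K aff_dim_affine_hull aff_dim_subspace[OF F] by metis

lemma facet_nonempty:
  assumes "facet_in F K f"
  shows "f \<noteq> {}"
proof
  assume "f = {}"
  then have "aff_dim ({} :: 'a set) = int (dim F) - 1" using assms unfolding facet_in_def by blast
  then show False unfolding aff_dim_empty_eq using dimF by linarith
qed

lemma facet_subset: "facet_in F K f \<Longrightarrow> f \<subseteq> K"
  by (auto simp: facet_in_def dest: face_of_imp_subset)

text \<open>Faces of polytopes are exposed. Replacing the exposing normal by its orthogonal
  projection to \<open>F\<close> changes no value on \<open>K\<close>, and the projection is nonzero
  because a facet is smaller than \<open>K\<close>. A normal in \<open>F\<close> is what the density
  of \<Gamma> can be applied to.\<close>

lemma facet_support:
  assumes "facet_in F K f"
  obtains a b where "a \<in> F" "a \<noteq> 0" "\<And>x. x \<in> K \<Longrightarrow> a \<bullet> x \<le> b" "f = K \<inter> {x. a \<bullet> x = b}"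
    "direction f = {x \<in> F. a \<bullet> x = 0}"
proof -
  have "f exposed_face_of K"
    using assms K(2) exposed_face_of_polyhedron polytope_imp_polyhedron by (auto simp: facet_in_def)
  then obtain a' b where a': "K \<subseteq> {x. a' \<bullet> x \<le> b}" "f = K \<inter> {x. a' \<bullet> x = b}"
    unfolding exposed_face_of_def by auto
  obtain a z where a: "a \<in> span F" "\<And>w. w \<in> span F \<Longrightarrow> orthogonal z w" "a' = a + z"
    using orthogonal_subspace_decomp_exists[of F a'] by metis
  have sF: "span F = F" using F by (simp add: span_eq_iff)
  have eq: "a' \<bullet> x = a \<bullet> x" if "x \<in> F" for x
    using a(2)[of x] that sF a(3) by (simp add: inner_add_left orthogonal_def)
  have f: "f = K \<inter> {x. a \<bullet> x = b}" using a'(2) eq K(1) by auto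
  have "a \<noteq> 0"
  proof
    assume "a = 0"
    moreover obtain x where "x \<in> f" using facet_nonempty[OF assms] by auto
    ultimately have "f = K" using f by auto
    then show False using assms aff_dim_K by (simp add: facet_in_def)
  qed
  moreover have "direction f = {x \<in> F. a \<bullet> x = 0}"
    using assms facet_nonempty[OF assms] K(1) f a(1) sF \<open>a \<noteq> 0\<close>
    by (intro direction_eq_hyperplane F) (auto simp: facet_in_def)
  ultimately show ?thesis using that[of a b] a(1) sF a'(1) eq K(1) f by (auto simp: subset_iff)
qed

text \<open>The representation is taken minimal, so that each of its half-spaces cuts out a facet
  and its boundary is parallel to a singular hyperplane. Without minimality, directions foreign to
  the maximality condition could enter the upper bound.\<close>

lemma halfspace_representation:
  obtains Hs :: "'a set set" and a b where "finite Hs" "\<And>h. h \<in> Hs \<Longrightarrow> a h \<in> F"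
    "\<And>h. h \<in> Hs \<Longrightarrow> a h \<noteq> 0" "\<And>x. x \<in> F \<Longrightarrow> x \<in> K \<longleftrightarrow> (\<forall>h\<in>Hs. a h \<bullet> x \<le> b h)"
    "\<And>h. h \<in> Hs \<Longrightarrow> {x \<in> F. a h \<bullet> x = 0} \<in> singular_hyperplanes F K"
proof -
  have "polyhedron K" using K(2) by (rule polytope_imp_polyhedron)
  then obtain Hs where Hs: "finite Hs" "K = affine hull K \<inter> \<Inter>Hs"
    "\<forall>h\<in>Hs. \<exists>a b. a \<noteq> 0 \<and> h = {x. a \<bullet> x \<le> b} \<and> (\<forall>x\<in>affine hull K. x + a \<in> affine hull K)"
    "\<forall>F'. F' \<subset> Hs \<longrightarrow> K \<subset> affine hull K \<inter> \<Inter>F'"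
    unfolding polyhedron_Int_affine_parallel_minimal by blast
  from bchoice[OF Hs(3)] obtain a where
    "\<forall>h\<in>Hs. \<exists>b. a h \<noteq> 0 \<and> h = {x. a h \<bullet> x \<le> b} \<and> (\<forall>x\<in>affine hull K. x + a h \<in> affine hull K)" ..
  from bchoice[OF this] obtain b where
    ab: "\<forall>h\<in>Hs. a h \<noteq> 0 \<and> h = {x. a h \<bullet> x \<le> b h} \<and> (\<forall>x\<in>affine hull K. x + a h \<in> affine hull K)" ..
  have aF: "a h \<in> F" if "h \<in> Hs" for h
  proof -
    have "0 \<in> affine hull K" using affine_hull_K F by (simp add: subspace_0)
    then have "0 + a h \<in> affine hull K" using ab that by blast
    then show ?thesis using affine_hull_K by simp
  qed
  have mem: "x \<in> K \<longleftrightarrow> (\<forall>h\<in>Hs. a h \<bullet> x \<le> b h)" if "x \<in> F" for x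
  proof -
    have "x \<in> K \<longleftrightarrow> (\<forall>h\<in>Hs. x \<in> h)" using Hs(2) that affine_hull_K by auto
    also have "\<dots> \<longleftrightarrow> (\<forall>h\<in>Hs. a h \<bullet> x \<le> b h)" using ab by blast
    finally show ?thesis .
  qed
  have sing: "{x \<in> F. a h \<bullet> x = 0} \<in> singular_hyperplanes F K" if h: "h \<in> Hs" for h
  proof -
    have ab': "a h \<noteq> 0 \<and> h = {x. a h \<bullet> x \<le> b h}" if "h \<in> Hs" for h using ab that by blast
    let ?f = "K \<inter> {x. a h \<bullet> x = b h}"
    have "?f facet_of K"
      by (rule iffD2[OF facet_of_polyhedron_explicit[where a = a and b = b, OF Hs(1,2) ab' Hs(4)[rule_format]]])
        (use h in blast)+
    then have f: "facet_in F K ?f" "?f \<noteq> {}"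
      by (auto simp: facet_of_def facet_in_def aff_dim_K)
    have "direction ?f = {x \<in> F. a h \<bullet> x = 0}"
      using f K(1) aF[OF h] ab h by (intro direction_eq_hyperplane F) (auto simp: facet_in_def)
    then show ?thesis unfolding singular_hyperplanes_def using f by blast
  qed
  show ?thesis using that[of Hs a b] Hs(1) aF ab mem sing by blast
qed

text \<open>A point near \<open>p\<close> on the inner side is a convex combination of a point of the facet near \<open>p\<close>
  and of a fixed point of \<open>K\<close> off the facet.\<close>

lemma half_ball:
  assumes f: "facet_in F K f" and a: "\<And>x. x \<in> K \<Longrightarrow> a \<bullet> x \<le> b" "f = K \<inter> {x. a \<bullet> x = b}"
    and dir: "direction f = {x \<in> F. a \<bullet> x = 0}"
  obtains p \<delta> where "p \<in> f" "\<delta> > 0"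
    "\<And>x. x \<in> F \<Longrightarrow> norm (x - p) \<le> \<delta> \<Longrightarrow> a \<bullet> x \<le> b \<Longrightarrow> x \<in> K"
proof -
  have convK: "convex K" using K(2) by (rule polytope_imp_convex)
  then have "convex f" using f by (auto simp: facet_in_def dest: face_of_imp_convex)
  then have "rel_interior f \<noteq> {}" using facet_nonempty[OF f] rel_interior_eq_empty by blast
  then obtain p where "p \<in> rel_interior f" by auto
  then obtain e where p: "p \<in> f" and e: "e > 0" "cball p e \<inter> affine hull f \<subseteq> f"
    unfolding mem_rel_interior_cball by auto
  have fF: "f \<subseteq> F" using facet_subset[OF f] K(1) by auto
  have pb: "a \<bullet> p = b" using p a(2) by auto
  have pF: "p \<in> F" using p fF by auto
  have "f \<noteq> K" using f aff_dim_K by (auto simp: facet_in_def)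
  then obtain q where q: "q \<in> K" "a \<bullet> q < b" using a facet_subset[OF f] by force
  define t where "t = b - a \<bullet> q"
  have t0: "t > 0" using q by (simp add: t_def)
  define M where "M = norm (q - p)"
  \<comment> \<open>The first term forces \<mu> \<le> 1/2 below, so that division by 1 - \<mu> costs
    at most a factor 2; the second then keeps \<open>y\<close> within \<open>e\<close> of
    \<open>p\<close>.\<close>
  define \<delta> where "\<delta> = min (t / (2 * (norm a + 1))) (e / (2 * (1 + (norm a + 1) * M / t)))"
  have M0: "M \<ge> 0" by (simp add: M_def)
  have D0: "1 + (norm a + 1) * M / t > 0" using M0 t0 by (intro add_pos_nonneg) auto
  have \<delta>0: "\<delta> > 0" unfolding \<delta>_def using t0 e(1) D0 by (simp add: add_nonneg_pos)
  have "x \<in> K" if x: "x \<in> F" "norm (x - p) \<le> \<delta>" "a \<bullet> x \<le> b" for x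
  proof -
    define s where "s = b - a \<bullet> x"
    define \<mu> where "\<mu> = s / t"
    have s0: "s \<ge> 0" using x(3) by (simp add: s_def)
    have "s = a \<bullet> (p - x)" by (simp add: s_def pb inner_diff_right)
    also have "\<dots> \<le> norm a * norm (p - x)" by (rule norm_cauchy_schwarz)
    also have "\<dots> \<le> (norm a + 1) * \<delta>'" if "norm (x - p) \<le> \<delta>'" for \<delta>'
      using that by (intro mult_mono) (auto simp: norm_minus_commute)
    finally have sle: "s \<le> (norm a + 1) * \<delta>'" if "norm (x - p) \<le> \<delta>'" for \<delta>' using that by blast
    have "s \<le> (norm a + 1) * (t / (2 * (norm a + 1)))"
      using x(2) by (intro sle) (simp add: \<delta>_def)
    also have "\<dots> = t / 2" by (simp add: field_simps add_nonneg_pos[THEN less_imp_neq, THEN not_sym] add_nonneg_eq_0_iff)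
    finally have mu: "\<mu> \<le> 1 / 2" "\<mu> \<ge> 0" using t0 s0 by (auto simp: \<mu>_def field_simps)
    \<comment> \<open>The point where the line from \<open>q\<close> through \<open>x\<close> meets
      the hyperplane of the facet; \<mu> is chosen so that a \<bullet> y = b.\<close>
    define y where "y = (1 / (1 - \<mu>)) *\<^sub>R (x - \<mu> *\<^sub>R q)"
    have xy: "x = (1 - \<mu>) *\<^sub>R y + \<mu> *\<^sub>R q" using mu by (simp add: y_def)
    have yF: "y \<in> F" unfolding y_def using x(1) q(1) K(1) F by (auto intro!: subspace_scale subspace_diff)
    have yb: "a \<bullet> y = b"
    proof -
      have "a \<bullet> x - \<mu> * (a \<bullet> q) = b - s - \<mu> * (b - t)" by (simp add: s_def t_def)
      also have "\<dots> = (1 - \<mu>) * b" using t0 by (simp add: \<mu>_def field_simps)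
      finally show ?thesis using mu by (simp add: y_def inner_diff_right)
    qed
    have "norm (y - p) \<le> e"
    proof -
      have "y - p = (1 / (1 - \<mu>)) *\<^sub>R ((x - p) - \<mu> *\<^sub>R (q - p))"
      proof -
        have "p = (1 / (1 - \<mu>)) *\<^sub>R ((1 - \<mu>) *\<^sub>R p)" using mu by simp
        then have "y - p = (1 / (1 - \<mu>)) *\<^sub>R (x - \<mu> *\<^sub>R q) - (1 / (1 - \<mu>)) *\<^sub>R ((1 - \<mu>) *\<^sub>R p)"
          by (simp add: y_def)
        also have "\<dots> = (1 / (1 - \<mu>)) *\<^sub>R ((x - \<mu> *\<^sub>R q) - (1 - \<mu>) *\<^sub>R p)"
          by (simp only: scaleR_right_diff_distrib)
        also have "(x - \<mu> *\<^sub>R q) - (1 - \<mu>) *\<^sub>R p = (x - p) - \<mu> *\<^sub>R (q - p)"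
          by (simp add: algebra_simps)
        finally show ?thesis .
      qed
      then have "norm (y - p) = (1 / (1 - \<mu>)) * norm ((x - p) - \<mu> *\<^sub>R (q - p))" using mu by simp
      also have "\<dots> \<le> 2 * (norm (x - p) + \<mu> * M)"
      proof (intro mult_mono)
        show "1 / (1 - \<mu>) \<le> 2" using mu by (simp add: field_simps)
        show "norm ((x - p) - \<mu> *\<^sub>R (q - p)) \<le> norm (x - p) + \<mu> * M"
          using norm_triangle_ineq4[of "x - p" "\<mu> *\<^sub>R (q - p)"] mu by (simp add: M_def)
      qed auto
      also have "\<dots> \<le> 2 * (\<delta> + (norm a + 1) * \<delta> / t * M)"
        unfolding \<mu>_def using x(2) sle[OF x(2)] t0 M0
        by (intro mult_left_mono add_mono mult_right_mono divide_right_mono) auto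
      also have "\<dots> = 2 * (1 + (norm a + 1) * M / t) * \<delta>" by (simp add: field_simps)
      also have "\<dots> \<le> e"
      proof -
        have "\<delta> \<le> e / (2 * (1 + (norm a + 1) * M / t))" by (simp add: \<delta>_def)
        then show ?thesis using D0 by (simp add: pos_le_divide_eq mult.commute)
      qed
      finally show ?thesis .
    qed
    then have "y \<in> cball p e" by (simp add: dist_norm norm_minus_commute)
    moreover have "y \<in> affine hull f"
      using affine_hull_eq_hyperplane[OF F p fF pb dir yF yb] .
    ultimately have "y \<in> K" using e(2) facet_subset[OF f] by auto
    then show "x \<in> K" unfolding xy using q(1) mu convexD[OF convK] by simp
  qed
  then show ?thesis using that p \<delta>0 by blast
qed

end

section \<open>Cut and projection data\<close>

lemma complementary_commute: "complementary E F \<Longrightarrow> complementary F E"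
  by (auto simp: complementary_def add.commute)

lemma proj_eqI:
  assumes "complementary E F" "e \<in> E" "x - e \<in> F"
  shows "proj E F x = e"
  unfolding proj_def
proof (rule the_equality)
  show "e \<in> E \<and> x - e \<in> F" using assms by simp
  fix e' assume e': "e' \<in> E \<and> x - e' \<in> F"
  have sub: "subspace E" "subspace F" using assms(1) by (auto simp: complementary_def)
  have "e - e' \<in> E" using subspace_diff[OF sub(1) assms(2)] e' by blast
  moreover have "(x - e') - (x - e) \<in> F" using subspace_diff[OF sub(2) _ assms(3)] e' by blast
  then have "e - e' \<in> F" by (simp add: algebra_simps)
  moreover have "E \<inter> F = {0}" using assms(1) by (simp add: complementary_def)
  ultimately have "e - e' = 0" by blast
  then show "e' = e" by simp
qed

lemma proj_mem:
  assumes "complementary E F"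
  shows "proj E F x \<in> E" "x - proj E F x \<in> F"
proof -
  have "x \<in> E + F" using assms by (simp add: complementary_def)
  then obtain e f where "e \<in> E" "f \<in> F" "x = e + f" by (auto simp: set_plus_def)
  then have "proj E F x = e" "x - e \<in> F" using proj_eqI[OF assms, of e x] by auto
  then show "proj E F x \<in> E" "x - proj E F x \<in> F" using \<open>e \<in> E\<close> by auto
qed

lemma linear_proj:
  assumes "complementary E F"
  shows "linear (proj E F)"
proof -
  have E: "subspace E" and F: "subspace F" using assms by (auto simp: complementary_def)
  show ?thesis
  proof (rule linearI)
    fix x y :: 'a and c :: real
    have "x + y - (proj E F x + proj E F y) = (x - proj E F x) + (y - proj E F y)" by simp
    also have "\<dots> \<in> F" by (intro subspace_add[OF F] proj_mem[OF assms])
    finally show "proj E F (x + y) = proj E F x + proj E F y"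
      by (intro proj_eqI[OF assms] subspace_add[OF E] proj_mem[OF assms])
    have "c *\<^sub>R x - c *\<^sub>R proj E F x = c *\<^sub>R (x - proj E F x)" by (simp add: scaleR_right_diff_distrib)
    also have "\<dots> \<in> F" by (intro subspace_scale[OF F] proj_mem[OF assms])
    finally show "proj E F (c *\<^sub>R x) = c *\<^sub>R proj E F x"
      by (intro proj_eqI[OF assms] subspace_scale[OF E] proj_mem[OF assms])
  qed
qed

lemma card_pigeonhole_le:
  assumes "finite Q" "finite Y" "Y \<subseteq> (\<Union>y\<in>Q. B y)" "Y \<noteq> {}"
  shows "\<exists>y\<in>Q. card Y \<le> card Q * card (Y \<inter> B y)"
proof (rule ccontr)
  assume no: "\<not> (\<exists>y\<in>Q. card Y \<le> card Q * card (Y \<inter> B y))"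
  have Q: "Q \<noteq> {}" using assms by auto
  have "Y = (\<Union>y\<in>Q. Y \<inter> B y)" using assms(3) by auto
  then have "card Y \<le> (\<Sum>y\<in>Q. card (Y \<inter> B y))" using card_UN_le[OF assms(1)] by metis
  then have "card Q * card Y \<le> (\<Sum>y\<in>Q. card Q * card (Y \<inter> B y))"
    by (simp add: sum_distrib_left[symmetric] mult_left_mono)
  also have "\<dots> < (\<Sum>y\<in>Q. card Y)" using no Q assms(1) by (intro sum_strict_mono) auto
  finally show False by simp
qed

locale cut_data =
  fixes E F K :: "(real ^ 'n) set" and d :: nat
  assumes data: "cut_and_projection d E F K" and ac: "almost_canonical E F K" and Kne: "K \<noteq> {}"
begin

abbreviation P where "P \<equiv> proj F E"

lemma compl: "complementary E F" "complementary F E"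
  using data complementary_commute by (auto simp: cut_and_projection_def)

lemma subspace_E: "subspace E" and subspace_F: "subspace F"
  using compl by (auto simp: complementary_def)

lemma linear_P: "linear P"
  by (rule linear_proj[OF compl(2)])

lemma P_mem: "P x \<in> F" and P_ker: "x - P x \<in> E"
  using proj_mem[OF compl(2)] by auto

lemma P_add: "P (x + y) = P x + P y" and P_diff: "P (x - y) = P x - P y" and P_uminus: "P (- x) = - P x"
  and P_scale: "P (c *\<^sub>R x) = c *\<^sub>R P x" and P_0: "P 0 = 0"
  using linear_P by (simp_all add: linear_add linear_diff linear_scale linear_neg linear_0)

lemma P_sum: "P (sum f S) = (\<Sum>i\<in>S. P (f i))"
  using linear_P by (simp add: linear_sum)

lemma P_on_F: "x \<in> F \<Longrightarrow> P x = x"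
  using subspace_0[OF subspace_E] by (intro proj_eqI compl) auto

lemma P_on_E: "x \<in> E \<Longrightarrow> P x = 0"
  using subspace_0[OF subspace_F] by (intro proj_eqI compl) auto

lemma proj_E_eq: "proj E F x = x - P x"
  by (rule proj_eqI[OF compl(1) P_ker]) (simp add: P_mem)

lemma dim_F: "dim F = CARD('n) - d" "dim F \<ge> 1"
proof -
  have "dim {x + y |x y. x \<in> E \<and> y \<in> F} + dim (E \<inter> F) = dim E + dim F"
    by (rule dim_sums_Int[OF subspace_E subspace_F])
  moreover have "{x + y |x y. x \<in> E \<and> y \<in> F} = UNIV"
  proof -
    have "E + F = UNIV" using compl(1) by (simp add: complementary_def)
    then show ?thesis unfolding set_plus_def by blast
  qed
  moreover have "E \<inter> F = {0}" using compl(1) by (simp add: complementary_def)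
  moreover have "dim E = d" "d < CARD('n)" using data by (auto simp: cut_and_projection_def)
  ultimately show "dim F = CARD('n) - d" "dim F \<ge> 1" by auto
qed

sublocale full_polytope F K
  using subspace_F dim_F(2) data Kne by unfold_locales (auto simp: cut_and_projection_def)

lemma P_bound: obtains BP where "BP > 0" "\<And>x. norm (P x) \<le> BP * norm1 x"
proof -
  obtain B where B: "B > 0" "\<And>x. norm (P x) \<le> B * norm x" using linear_bounded_pos[OF linear_P] by auto
  have "norm (P x) \<le> B * norm1 x" for x
    using B(2)[of x] mult_left_mono[OF norm_le_norm1[of x], of B] B(1) by linarith
  then show ?thesis using that B(1) by blast
qed

lemma P_lattice_dense:
  assumes "q \<in> F" "\<epsilon> > 0"
  shows "\<exists>z\<in>int_lattice. norm (P z - q) < \<epsilon>"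
proof -
  have "q \<in> closure (Gam E F)" using assms data by (auto simp: cut_and_projection_def)
  then obtain y where "y \<in> Gam E F" "dist y q < \<epsilon>" using assms(2) closure_approachable by blast
  then show ?thesis by (auto simp: Gam_def dist_norm)
qed

section \<open>Linear forms on the projected lattice and their exponents\<close>

lemma linear_inner_P: "linear (\<lambda>z. a \<bullet> P z)"
  by (rule linearI) (simp_all add: P_add P_scale inner_add_right)

text \<open>By density some \<open>P z\<close> is closer to \<open>a\<close> than the origin is, and
  such a point cannot be orthogonal to \<open>a\<close>.\<close>

lemma inner_P_nonzero:
  assumes "a \<in> F" "a \<noteq> 0"
  shows "\<exists>z\<in>int_lattice. a \<bullet> P z \<noteq> 0"
proof -
  obtain z where z: "z \<in> int_lattice" "norm (P z - a) < norm a"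
    using P_lattice_dense[of a "norm a"] assms by auto
  have "a \<bullet> P z \<noteq> 0"
  proof
    assume 0: "a \<bullet> P z = 0"
    have "norm a * norm a = a \<bullet> (a - P z)" using 0 by (simp add: inner_diff_right dot_square_norm power2_eq_square)
    also have "\<dots> \<le> norm a * norm (a - P z)" by (rule norm_cauchy_schwarz)
    also have "\<dots> < norm a * norm a" using z(2) assms(2) by (simp add: norm_minus_commute)
    finally show False by simp
  qed
  then show ?thesis using z by blast
qed

text \<open>The exponent \<alpha>_i as a natural number, expressed through a normal \<open>a\<close>
  of H_i. The subtraction is exact for nonzero \<open>a\<close> in \<open>F\<close>, where the
  dimension is positive.\<close>

definition expo :: "real ^ 'n \<Rightarrow> nat" where
  "expo a = rat_real.dim ((\<lambda>z. a \<bullet> P z) ` int_lattice) - 1"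

lemma Gam_eq: "Gam E F = P ` int_lattice"
  by (simp add: Gam_def)

text \<open>A translation by \<gamma> preserves the hyperplane exactly when \<gamma> lies in it, as
  the image of 0 shows. So the stabilizer is the kernel of \<open>a\<close> on \<Gamma>, and the
  rank of the quotient is a rational dimension.\<close>

lemma sing_exponent_eq:
  assumes a: "a \<in> F" "a \<noteq> 0"
  shows "sing_exponent E F {x \<in> F. a \<bullet> x = 0} = int (expo a)"
proof -
  let ?H = "{x \<in> F. a \<bullet> x = 0}"
  let ?l = "\<lambda>z. a \<bullet> P z"
  have "\<gamma> +o ?H = ?H \<longleftrightarrow> a \<bullet> \<gamma> = 0" if "\<gamma> \<in> F" for \<gamma>
  proof
    assume "\<gamma> +o ?H = ?H"
    moreover have "\<gamma> + 0 \<in> \<gamma> +o ?H" using subspace_0[OF subspace_F] by (intro set_plus_intro2) auto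
    ultimately show "a \<bullet> \<gamma> = 0" by auto
  next
    assume 0: "a \<bullet> \<gamma> = 0"
    show "\<gamma> +o ?H = ?H"
    proof
      show "\<gamma> +o ?H \<subseteq> ?H"
        using 0 that subspace_F by (auto simp: elt_set_plus_def inner_add_right intro: subspace_add)
      show "?H \<subseteq> \<gamma> +o ?H"
      proof
        fix x assume x: "x \<in> ?H"
        then have "x - \<gamma> \<in> ?H" using 0 that subspace_F by (auto simp: inner_diff_right intro: subspace_diff)
        then have "\<gamma> + (x - \<gamma>) \<in> \<gamma> +o ?H" by (rule set_plus_intro2)
        then show "x \<in> \<gamma> +o ?H" by simp
      qed
    qed
  qed
  then have St: "Stab (Gam E F) ?H = {x \<in> Gam E F. a \<bullet> x = 0}"
    unfolding Stab_def using P_mem by (auto simp: Gam_eq)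
  have im: "(\<bullet>) a ` Gam E F = ?l ` int_lattice" by (simp add: Gam_eq image_image)
  have "group_rank (additive_group (Gam E F) Mod {x \<in> Gam E F. a \<bullet> x = 0}) = rat_real.dim ((\<bullet>) a ` Gam E F)"
  proof (rule group_rank_FactGroup_real_hom)
    show "(\<bullet>) a ` Gam E F \<subseteq> rat_real.span (range (\<lambda>j. ?l (axis j 1)))"
      unfolding im by (rule lattice_image_in_span[OF linear_inner_P])
    show "0 \<in> Gam E F" unfolding Gam_eq using P_0 int_lattice_0 by (metis image_eqI)
    show "x + y \<in> Gam E F" if "x \<in> Gam E F" "y \<in> Gam E F" for x y
      using that unfolding Gam_eq by (auto simp: P_add[symmetric] intro: int_lattice_add)
    show "- x \<in> Gam E F" if "x \<in> Gam E F" for x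
      using that unfolding Gam_eq by (auto simp: P_uminus[symmetric] intro: int_lattice_uminus)
  qed (auto simp: inner_add_right)
  moreover obtain z0 where "z0 \<in> int_lattice" "?l z0 \<noteq> 0" using inner_P_nonzero[OF a] by blast
  then have "rat_real.dim (?l ` int_lattice) \<ge> 1" by (rule dim_lattice_image_pos[OF linear_inner_P])
  ultimately show ?thesis unfolding sing_exponent_def St expo_def im by (simp add: of_nat_diff)
qed

text \<open>Otherwise some nonzero \<open>u\<close> in the direction of \<open>f\<close> is
  orthogonal to the whole stabilizer. For a vertex \<open>v\<close> of \<open>f\<close> at which
  \<open>u\<close> is minimal, every translate (f - v) + \<gamma> lies in the half-space where
  \<open>u\<close> is nonnegative, so these translates cannot cover a neighbourhood of 0.\<close>

lemma span_stabilizer: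
  assumes f: "facet_in F K f"
  shows "span (Gam E F \<inter> direction f) = direction f"
proof (rule ccontr)
  let ?H = "direction f"
  have sH: "span ?H = ?H" by (simp add: direction_def)
  assume ne: "span (Gam E F \<inter> ?H) \<noteq> ?H"
  have "span (Gam E F \<inter> ?H) \<subseteq> span ?H" by (intro span_mono) auto
  then have "span (Gam E F \<inter> ?H) \<subset> span ?H"
    using ne sH by (simp only: psubset_eq) metis
  then obtain u where u: "u \<noteq> 0" "u \<in> span ?H" "\<And>y. y \<in> span (Gam E F \<inter> ?H) \<Longrightarrow> orthogonal u y"
    using orthogonal_to_subspace_exists_gen by metis
  have uG: "u \<bullet> \<gamma> = 0" if "\<gamma> \<in> Gam E F \<inter> ?H" for \<gamma>
    using u(3)[OF span_base[OF that]] by (simp add: orthogonal_def)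
  have polf: "polytope f" using f K(2) face_of_polytope_polytope by (auto simp: facet_in_def)
  then have "compact f" "convex f" by (auto intro: polytope_imp_compact polytope_imp_convex)
  obtain x0 where x0: "x0 \<in> f" "\<And>y. y \<in> f \<Longrightarrow> u \<bullet> x0 \<le> u \<bullet> y"
    using continuous_attains_inf[OF \<open>compact f\<close> facet_nonempty[OF f]
        continuous_on_inner[OF continuous_on_const[of f u] continuous_on_id]] by blast
  \<comment> \<open>The minimum of \<open>u\<close> is attained on a face of \<open>f\<close>, and
    an extreme point of that face is a vertex of \<open>f\<close>.\<close>
  let ?g = "f \<inter> {x. u \<bullet> x = u \<bullet> x0}"
  have g: "?g face_of f"
    using x0 by (intro face_of_Int_supporting_hyperplane_ge \<open>convex f\<close>) auto
  then have "polytope ?g" using polf face_of_polytope_polytope by blast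
  moreover have "?g \<noteq> {}" using x0 by auto
  ultimately obtain v where "v extreme_point_of ?g"
    using extreme_point_exists_convex polytope_imp_compact polytope_imp_convex by blast
  then have v: "v extreme_point_of f" "u \<bullet> v = u \<bullet> x0"
    using extreme_point_of_face[OF g] by (auto simp: extreme_point_of_def)
  obtain U G where U: "openin (top_of_set ?H) U" "0 \<in> U" "G \<subseteq> Gam E F \<inter> ?H"
    "U \<subseteq> (\<Union>\<gamma>\<in>G. (\<lambda>x. (x - v) + \<gamma>) ` f)"
    using ac f v(1) unfolding almost_canonical_def by meson
  obtain e where e: "e > 0" "\<And>x. x \<in> ?H \<Longrightarrow> dist x 0 < e \<Longrightarrow> x \<in> U"
    using U(1,2) unfolding openin_euclidean_subtopology_iff by blast
  \<comment> \<open>A short step against \<open>u\<close>, which lands in the neighbourhood but on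
    the uncovered side.\<close>
  define y where "y = - ((e / (2 * norm u)) *\<^sub>R u)"
  have "y \<in> ?H" unfolding y_def using u(2) sH by (metis span_neg span_scale)
  moreover have "dist y 0 < e" using e(1) u(1) by (simp add: y_def)
  ultimately have "y \<in> U" by (rule e(2))
  then obtain \<gamma> x where \<gamma>: "\<gamma> \<in> G" "x \<in> f" "y = x - v + \<gamma>" using U(4) by auto
  have "u \<bullet> y = u \<bullet> x - u \<bullet> v" using uG[of \<gamma>] \<gamma> U(3) by (auto simp: inner_add_right inner_diff_right)
  then have "u \<bullet> y \<ge> 0" using x0(2)[OF \<gamma>(2)] v(2) by simp
  moreover have "u \<bullet> y < 0" using u(1) e(1) by (simp add: y_def)
  ultimately show False by simp
qed

text \<open>A basis of the direction can be taken inside the stabilizer, because the stabilizer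
  spans. Rounding down the coordinates of \<open>h\<close> moves it by a bounded amount, and fixed
  lattice lifts of the basis make the norm of \<open>z\<close> linear in that of
  \<open>h\<close>.\<close>

lemma round_in_stabilizer:
  assumes f: "facet_in F K f" and dir: "direction f = {x \<in> F. a \<bullet> x = 0}"
  shows "\<exists>C>0. \<forall>h\<in>direction f. \<exists>z\<in>int_lattice. a \<bullet> P z = 0 \<and>
           norm1 z \<le> C * (norm h + 1) \<and> norm (h - P z) \<le> C"
proof -
  let ?H = "direction f"
  obtain B where B: "B \<subseteq> Gam E F \<inter> ?H" "independent B" "Gam E F \<inter> ?H \<subseteq> span B"
    using maximal_independent_subset by blast
  have fin: "finite B" by (rule independent_imp_finite[OF B(2)])
  have "span (Gam E F \<inter> ?H) \<subseteq> span B" by (intro span_minimal B(3)) simp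
  then have HB: "?H \<subseteq> span B" using span_stabilizer[OF f] by simp
  have "\<forall>g\<in>B. \<exists>z. z \<in> int_lattice \<and> P z = g" using B(1) by (auto simp: Gam_eq)
  from bchoice[OF this] obtain \<zeta> where \<zeta>: "\<forall>g\<in>B. \<zeta> g \<in> int_lattice \<and> P (\<zeta> g) = g" ..
  have "\<forall>b. \<exists>\<phi>. linear \<phi> \<and> (\<forall>x\<in>B. \<phi> x = (if x = b then 1 else (0::real)))"
  proof
    fix b
    show "\<exists>\<phi>. linear \<phi> \<and> (\<forall>x\<in>B. \<phi> x = (if x = b then 1 else (0::real)))"
      using linear_independent_extend[OF B(2), of "\<lambda>x. if x = b then 1 else (0::real)"] by simp
  qed
  from choice[OF this] obtain \<phi> where
    "\<forall>b. linear (\<phi> b) \<and> (\<forall>x\<in>B. \<phi> b x = (if x = b then 1 else (0::real)))" ..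
  then have \<phi>: "\<And>b. linear (\<phi> b)" "\<And>b x. x \<in> B \<Longrightarrow> \<phi> b x = (if x = b then 1 else (0::real))"
    by auto
  have "\<forall>b. \<exists>M. M > 0 \<and> (\<forall>x. norm (\<phi> b x) \<le> M * norm x)"
  proof
    fix b
    show "\<exists>M. M > 0 \<and> (\<forall>x. norm (\<phi> b x) \<le> M * norm x)"
      using linear_bounded_pos[OF \<phi>(1)[of b]] by blast
  qed
  from choice[OF this] obtain M where "\<forall>b. M b > 0 \<and> (\<forall>x. norm (\<phi> b x) \<le> M b * norm x)" ..
  then have M: "\<And>b. M b > 0" "\<And>b x. \<bar>\<phi> b x\<bar> \<le> M b * norm x" by auto
  have expand: "h = (\<Sum>b\<in>B. \<phi> b h *\<^sub>R b)" if "h \<in> ?H" for h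
  proof -
    have "h \<in> span B" using HB that by auto
    then obtain c where c: "h = (\<Sum>b\<in>B. c b *\<^sub>R b)" unfolding span_finite[OF fin] by auto
    have "\<phi> b h = c b" if "b \<in> B" for b
    proof -
      have "\<phi> b h = (\<Sum>x\<in>B. c x * \<phi> b x)" unfolding c using \<phi>(1) by (simp add: linear_sum linear_scale)
      also have "\<dots> = (\<Sum>x\<in>B. if x = b then c b else 0)" using \<phi>(2) by (intro sum.cong) auto
      also have "\<dots> = c b" using fin that by simp
      finally show ?thesis .
    qed
    then show ?thesis using c by simp
  qed
  define C where "C = (\<Sum>b\<in>B. (M b + 1) * norm1 (\<zeta> b)) + (\<Sum>b\<in>B. norm b) + 1"
  have pos: "(M b + 1) * norm1 (\<zeta> b) \<ge> 0" for b using M(1)[of b] norm1_nonneg[of "\<zeta> b"] by simp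
  have C0: "C > 0" unfolding C_def by (intro add_nonneg_pos add_nonneg_nonneg sum_nonneg pos) auto
  have "\<exists>z\<in>int_lattice. a \<bullet> P z = 0 \<and> norm1 z \<le> C * (norm h + 1) \<and> norm (h - P z) \<le> C"
    if h: "h \<in> ?H" for h
  proof -
    define z where "z = (\<Sum>b\<in>B. of_int \<lfloor>\<phi> b h\<rfloor> *\<^sub>R \<zeta> b)"
    have zl: "z \<in> int_lattice"
      unfolding z_def using \<zeta> by (intro int_lattice_sum int_lattice_scaleR) auto
    have Pz: "P z = (\<Sum>b\<in>B. of_int \<lfloor>\<phi> b h\<rfloor> *\<^sub>R b)"
      unfolding z_def P_sum P_scale using \<zeta> by (intro sum.cong) auto
    have "a \<bullet> b = 0" if "b \<in> B" for b using B(1) that dir by auto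
    then have "a \<bullet> P z = 0" unfolding Pz by (simp add: inner_sum_right)
    moreover have "norm (h - P z) \<le> C"
    proof -
      have "h - P z = (\<Sum>b\<in>B. (\<phi> b h - of_int \<lfloor>\<phi> b h\<rfloor>) *\<^sub>R b)"
        unfolding Pz by (subst expand[OF h]) (simp add: sum_subtractf scaleR_left_diff_distrib)
      also have "norm \<dots> \<le> (\<Sum>b\<in>B. norm b)"
      proof (intro order_trans[OF norm_sum] sum_mono)
        fix b
        have "\<bar>\<phi> b h - of_int \<lfloor>\<phi> b h\<rfloor>\<bar> \<le> 1" by linarith
        then show "norm ((\<phi> b h - of_int \<lfloor>\<phi> b h\<rfloor>) *\<^sub>R b) \<le> norm b"
          by (simp add: mult_left_le_one_le)
      qed
      also have "\<dots> \<le> C" unfolding C_def using sum_nonneg[where A = B, OF pos] by simp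
      finally show ?thesis .
    qed
    moreover have "norm1 z \<le> C * (norm h + 1)"
    proof -
      have "norm1 z \<le> (\<Sum>b\<in>B. \<bar>of_int \<lfloor>\<phi> b h\<rfloor>\<bar> * norm1 (\<zeta> b))"
        unfolding z_def by (intro order_trans[OF norm1_sum] sum_mono) (simp add: norm1_scaleR)
      also have "\<dots> \<le> (\<Sum>b\<in>B. (M b + 1) * norm1 (\<zeta> b) * (norm h + 1))"
      proof (intro sum_mono)
        fix b
        have "\<bar>of_int \<lfloor>\<phi> b h\<rfloor>\<bar> \<le> \<bar>\<phi> b h\<bar> + 1" by linarith
        also have "\<dots> \<le> M b * norm h + 1" using M(2) by simp
        also have "\<dots> \<le> (M b + 1) * (norm h + 1)" using M(1)[of b] by (simp add: algebra_simps)
        finally show "\<bar>of_int \<lfloor>\<phi> b h\<rfloor>\<bar> * norm1 (\<zeta> b) \<le> (M b + 1) * norm1 (\<zeta> b) * (norm h + 1)"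
          using mult_right_mono[OF _ norm1_nonneg] by (metis (no_types, lifting) mult.assoc mult.commute)
      qed
      also have "\<dots> = (\<Sum>b\<in>B. (M b + 1) * norm1 (\<zeta> b)) * (norm h + 1)" by (simp add: sum_distrib_right)
      also have "\<dots> \<le> C * (norm h + 1)"
        unfolding C_def by (intro mult_right_mono) (auto intro!: add_nonneg_nonneg sum_nonneg)
      finally show ?thesis .
    qed
    ultimately show ?thesis using zl by blast
  qed
  then show ?thesis using C0 by blast
qed

text \<open>Start from n^expo values. Subtracting rounded stabilizer vectors keeps each value and
  brings all projections into one compact set. Of finitely many small balls covering it, one
  receives a fixed proportion of the vectors, and by density a lattice vector moves its centre close
  to \<open>q\<close>. The constants survive because the cover does not depend on n.\<close>

lemma many_values_near_point:
  assumes f: "facet_in F K f" and a: "a \<in> F" "a \<noteq> 0" and dir: "direction f = {x \<in> F. a \<bullet> x = 0}"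
    and q: "q \<in> F" and \<eta>: "\<eta> > 0"
  shows "\<exists>c>0. \<exists>C>0. \<forall>n\<ge>1. \<exists>Y\<subseteq>int_lattice. finite Y \<and> real (card Y) \<ge> c * real n ^ expo a \<and>
           inj_on (\<lambda>z. a \<bullet> P z) Y \<and> (\<forall>z\<in>Y. norm1 z \<le> C * real n \<and> norm (P z - q) \<le> \<eta>)"
proof -
  obtain z0 where z0: "z0 \<in> int_lattice" "a \<bullet> P z0 \<noteq> 0" using inner_P_nonzero[OF a] by auto
  obtain C0 where C0: "C0 > 0" "\<forall>n\<ge>1. \<exists>Y\<subseteq>int_lattice. finite Y \<and> card Y = n ^ expo a \<and>
            inj_on (\<lambda>z. a \<bullet> P z) Y \<and> (\<forall>z\<in>Y. norm1 z \<le> C0 * real n \<and> \<bar>a \<bullet> P z\<bar> \<le> C0)"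
    using count_lattice_values_ge[OF linear_inner_P z0] unfolding expo_def by blast
  obtain C1 where C1: "C1 > 0" and round: "\<forall>h\<in>direction f. \<exists>z\<in>int_lattice. a \<bullet> P z = 0 \<and>
           norm1 z \<le> C1 * (norm h + 1) \<and> norm (h - P z) \<le> C1"
    using round_in_stabilizer[OF f dir] by blast
  obtain BP where BP: "BP > 0" "\<And>x. norm (P x) \<le> BP * norm1 x" using P_bound by blast
  \<comment> \<open>C1 is the rounding error along the hyperplane, and C0 / norm a bounds the
    component along \<open>a\<close>.\<close>
  define R where "R = C1 + C0 / norm a"
  define C2 where "C2 = C0 + C1 * (BP * C0 + C0 / norm a + 1)"
  have na: "norm a > 0" using a(2) by simp
  let ?S = "cball 0 R \<inter> F"
  have "compact ?S" by (intro compact_Int_closed closed_subspace subspace_F) auto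
  then obtain Q where Q: "Q \<subseteq> ?S" "finite Q" "?S \<subseteq> (\<Union>y\<in>Q. ball y (\<eta> / 2))"
    using compactE_image[of ?S ?S "\<lambda>y. ball y (\<eta> / 2)"] \<eta> by (metis (no_types, lifting) UN_iff centre_in_ball half_gt_zero open_ball subsetI)
  have "\<forall>y\<in>Q. \<exists>g. g \<in> int_lattice \<and> norm (P g - (q - y)) < \<eta> / 2"
  proof
    fix y assume "y \<in> Q"
    then have "q - y \<in> F" using Q(1) q subspace_F by (auto intro: subspace_diff)
    then show "\<exists>g. g \<in> int_lattice \<and> norm (P g - (q - y)) < \<eta> / 2"
      using P_lattice_dense[of "q - y" "\<eta> / 2"] \<eta> by auto
  qed
  from bchoice[OF this] obtain g where g: "\<forall>y\<in>Q. g y \<in> int_lattice \<and> norm (P (g y) - (q - y)) < \<eta> / 2" ..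
  define C where "C = C2 + (\<Sum>y\<in>Q. norm1 (g y))"
  have C2: "C2 > 0" unfolding C2_def using C0 C1 BP na by (intro add_pos_nonneg mult_nonneg_nonneg add_nonneg_nonneg) auto
  have C: "C > 0" unfolding C_def using C2 by (intro add_pos_nonneg sum_nonneg norm1_nonneg)
  have main: "\<exists>Y\<subseteq>int_lattice. finite Y \<and> real (card Y) \<ge> (1 / (real (card Q) + 1)) * real n ^ expo a \<and>
           inj_on (\<lambda>z. a \<bullet> P z) Y \<and> (\<forall>z\<in>Y. norm1 z \<le> C * real n \<and> norm (P z - q) \<le> \<eta>)" if n: "n \<ge> 1" for n
  proof -
    from C0(2)[rule_format, OF n] obtain Y where Y: "Y \<subseteq> int_lattice" "finite Y" "card Y = n ^ expo a"
      "inj_on (\<lambda>z. a \<bullet> P z) Y" "\<And>z. z \<in> Y \<Longrightarrow> norm1 z \<le> C0 * real n \<and> \<bar>a \<bullet> P z\<bar> \<le> C0" by blast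
    have "\<forall>z\<in>Y. \<exists>u. u \<in> int_lattice \<and> a \<bullet> P u = a \<bullet> P z \<and> norm1 u \<le> C2 * n \<and> norm (P u) \<le> R"
    proof
      fix z assume z: "z \<in> Y"
      \<comment> \<open>The component of \<open>P z\<close> along \<open>a\<close>. It is bounded
        because the value is, so only the part in the hyperplane grows with n and has to be rounded
        away.\<close>
      define t where "t = (a \<bullet> P z / (a \<bullet> a)) *\<^sub>R a"
      have tn: "norm t \<le> C0 / norm a"
      proof -
        have "norm t = \<bar>a \<bullet> P z\<bar> / norm a" using na by (simp add: t_def dot_square_norm power2_eq_square)
        then show ?thesis using Y(5)[OF z] na by (simp add: divide_right_mono)
      qed
      have "P z - t \<in> direction f"
        unfolding dir t_def using a subspace_F P_mem by (auto simp: inner_diff_right intro!: subspace_diff subspace_scale)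
      from round[rule_format, OF this] obtain v where
        v: "v \<in> int_lattice" "a \<bullet> P v = 0" "norm1 v \<le> C1 * (norm (P z - t) + 1)" "norm (P z - t - P v) \<le> C1" by blast
      have "norm (P z - t) \<le> norm (P z) + norm t" by (rule norm_triangle_ineq4)
      also have "\<dots> \<le> BP * (C0 * n) + C0 / norm a"
        using BP(2)[of z] Y(5)[OF z] tn BP(1) by (intro add_mono) (auto intro: order_trans mult_left_mono)
      also have "\<dots> + 1 \<le> (BP * C0 + C0 / norm a + 1) * n"
      proof -
        have "(C0 / norm a + 1) * 1 \<le> (C0 / norm a + 1) * n" using n C0(1) na by (intro mult_left_mono) auto
        then show ?thesis by (simp add: algebra_simps)
      qed
      finally have "norm (P z - t) + 1 \<le> (BP * C0 + C0 / norm a + 1) * n" by simp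
      then have "norm1 v \<le> C1 * ((BP * C0 + C0 / norm a + 1) * n)"
        using v(3) C1 by (meson mult_left_mono order_trans less_imp_le)
      then have "norm1 (z - v) \<le> C2 * n"
        using norm1_triangle_diff[of z v] Y(5)[OF z] by (simp add: C2_def algebra_simps)
      moreover have "norm (P (z - v)) \<le> R"
      proof -
        have "P (z - v) = (P z - t - P v) + t" by (simp add: P_diff)
        then have "norm (P (z - v)) \<le> norm (P z - t - P v) + norm t" by (metis norm_triangle_ineq)
        then show ?thesis unfolding R_def using v(4) tn by linarith
      qed
      moreover have "z - v \<in> int_lattice" using Y(1) z v(1) by (intro int_lattice_diff) auto
      ultimately show "\<exists>u. u \<in> int_lattice \<and> a \<bullet> P u = a \<bullet> P z \<and> norm1 u \<le> C2 * n \<and> norm (P u) \<le> R"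
        using v(2) by (intro exI[of _ "z - v"]) (simp add: P_diff inner_diff_right)
    qed
    from bchoice[OF this] obtain u where
      u: "\<forall>z\<in>Y. u z \<in> int_lattice \<and> a \<bullet> P (u z) = a \<bullet> P z \<and> norm1 (u z) \<le> C2 * n \<and> norm (P (u z)) \<le> R" ..
    have "Y \<noteq> {}" using Y(3) n by auto
    moreover have "Y \<subseteq> (\<Union>y\<in>Q. {z. P (u z) \<in> ball y (\<eta> / 2)})"
    proof
      fix z assume "z \<in> Y"
      then have "P (u z) \<in> ?S" using u P_mem by simp
      then have "P (u z) \<in> (\<Union>y\<in>Q. ball y (\<eta> / 2))" using Q(3) by blast
      then show "z \<in> (\<Union>y\<in>Q. {z. P (u z) \<in> ball y (\<eta> / 2)})" by blast
    qed
    ultimately obtain y where y: "y \<in> Q" "card Y \<le> card Q * card (Y \<inter> {z. P (u z) \<in> ball y (\<eta> / 2)})"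
      using card_pigeonhole_le[OF Q(2) Y(2)] by blast
    let ?Y = "Y \<inter> {z. P (u z) \<in> ball y (\<eta> / 2)}"
    let ?s = "\<lambda>z. u z + g y"
    \<comment> \<open>Adding the same vector \<open>g y\<close> throughout the ball shifts all
      values by one constant, so they stay distinct.\<close>
    have inj: "inj_on ((\<lambda>z. a \<bullet> P z) \<circ> ?s) ?Y"
      using Y(4) u by (auto simp: inj_on_def P_add inner_add_right)
    have "real (card Y) \<le> real (card Q) * real (card ?Y)" using y(2) by (metis of_nat_le_iff of_nat_mult)
    also have "\<dots> \<le> (real (card Q) + 1) * real (card ?Y)" by (intro mult_right_mono) auto
    finally have "real (card ?Y) \<ge> (1 / (real (card Q) + 1)) * real n ^ expo a"
      by (simp add: Y(3) field_simps)
    moreover have "card (?s ` ?Y) = card ?Y" by (rule card_image[OF inj_on_imageI2[OF inj]])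
    moreover have "inj_on (\<lambda>z. a \<bullet> P z) (?s ` ?Y)" by (rule inj_on_imageI[OF inj])
    moreover have "?s ` ?Y \<subseteq> int_lattice" using u g y(1) by (auto intro: int_lattice_add)
    moreover have "norm1 (?s z) \<le> C * real n \<and> norm (P (?s z) - q) \<le> \<eta>" if z: "z \<in> ?Y" for z
    proof
      have "norm1 (g y) \<le> (\<Sum>y\<in>Q. norm1 (g y))" using Q(2) y(1) by (intro member_le_sum norm1_nonneg)
      also have "\<dots> * 1 \<le> (\<Sum>y\<in>Q. norm1 (g y)) * n"
        using n by (intro mult_left_mono sum_nonneg norm1_nonneg) auto
      finally have "norm1 (g y) \<le> (\<Sum>y\<in>Q. norm1 (g y)) * n" by simp
      moreover have "norm1 (u z) \<le> C2 * n" using u z by blast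
      ultimately show "norm1 (?s z) \<le> C * real n"
        using norm1_triangle[of "u z" "g y"] by (simp add: C_def algebra_simps)
      have "P (?s z) - q = (P (u z) - y) + (P (g y) - (q - y))" by (simp add: P_add)
      then have "norm (P (?s z) - q) \<le> norm (P (u z) - y) + norm (P (g y) - (q - y))" by (metis norm_triangle_ineq)
      moreover have "norm (P (u z) - y) < \<eta> / 2" using z by (simp add: dist_norm norm_minus_commute)
      moreover have "norm (P (g y) - (q - y)) < \<eta> / 2" using g y(1) by blast
      ultimately show "norm (P (?s z) - q) \<le> \<eta>" by linarith
    qed
    ultimately show ?thesis using Y(2) by (intro exI[of _ "?s ` ?Y"]) auto
  qed
  then show ?thesis using C by (intro exI[of _ "1 / (real (card Q) + 1)"] conjI exI[of _ C]) auto
qed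

subsection \<open>The upper bound\<close>

text \<open>The lattice displacements of a patch. They depend on the centre only through its
  projection \<open>w\<close>, so that counting takes place over \<open>K\<close>.\<close>

definition pattern :: "real ^ 'n \<Rightarrow> nat \<Rightarrow> (real ^ 'n) set" where
  "pattern w n = {z \<in> int_lattice. norm1 z \<le> real n \<and> w + P z \<in> K}"

lemma pattern_subset: "pattern w n \<subseteq> {z \<in> int_lattice. norm1 z \<le> real n}"
  by (auto simp: pattern_def)

lemma finite_patterns: "finite {pattern w n | w. Q w}"
  by (rule finite_subset[of _ "Pow {z \<in> int_lattice. norm1 z \<le> real n}"])
    (use pattern_subset finite_lattice_ball in auto)

lemma K_bounded: obtains R where "R > 0" "\<And>w. w \<in> K \<Longrightarrow> norm w \<le> R"
  using polytope_imp_bounded[OF K(2)] that unfolding bounded_pos by blast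

definition singular_normal :: "real ^ 'n \<Rightarrow> bool" where
  "singular_normal a \<longleftrightarrow> a \<in> F \<and> a \<noteq> 0 \<and> {x \<in> F. a \<bullet> x = 0} \<in> singular_hyperplanes F K"

text \<open>As \<open>w\<close> is bounded, a lattice vector for which a h \<bullet> P z is large
  satisfies or violates the inequality of \<open>h\<close> for all \<open>w\<close> at once. Only
  boundedly sized offsets discriminate between points, and of these there are about n^expo for each
  \<open>h\<close>.\<close>

lemma card_patterns_le:
  assumes hyp: "\<And>S. finite S \<Longrightarrow> independent S \<Longrightarrow> (\<And>a. a \<in> S \<Longrightarrow> singular_normal a) \<Longrightarrow> (\<Sum>a\<in>S. expo a) \<le> A"
  shows "\<exists>C>0. \<forall>n\<ge>1. real (card {pattern w n | w. w \<in> K}) \<le> C * real n ^ A"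
proof -
  obtain Hs :: "(real ^ 'n) set set" and a b where Hs: "finite Hs" "\<And>h. h \<in> Hs \<Longrightarrow> a h \<in> F"
    "\<And>h. h \<in> Hs \<Longrightarrow> a h \<noteq> 0" "\<And>x. x \<in> F \<Longrightarrow> x \<in> K \<longleftrightarrow> (\<forall>h\<in>Hs. a h \<bullet> x \<le> b h)"
    "\<And>h. h \<in> Hs \<Longrightarrow> {x \<in> F. a h \<bullet> x = 0} \<in> singular_hyperplanes F K"
    using halfspace_representation by blast
  obtain R where R: "R > 0" "\<And>w. w \<in> K \<Longrightarrow> norm w \<le> R" using K_bounded by blast
  \<comment> \<open>An upper bound for \<bar>a h \<bullet> w - b h\<bar> on \<open>K\<close>: beyond
    it, the sign of a h \<bullet> P z decides.\<close>
  define r where "r h = \<bar>b h\<bar> + norm (a h) * R" for h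
  have ar: "\<bar>a h \<bullet> w - b h\<bar> \<le> r h" if "w \<in> K" for h w
  proof -
    have "\<bar>a h \<bullet> w\<bar> \<le> norm (a h) * norm w" by (rule Cauchy_Schwarz_ineq2)
    also have "\<dots> \<le> norm (a h) * R" using R(2)[OF that] by (intro mult_left_mono) auto
    finally show ?thesis unfolding r_def by linarith
  qed
  let ?V = "\<lambda>n h. {t. \<bar>t\<bar> \<le> r h \<and> (\<exists>z\<in>int_lattice. norm1 z \<le> real n \<and> t = a h \<bullet> P z)}"
  have finV: "finite (?V n h)" for n h
  proof (rule finite_subset)
    show "?V n h \<subseteq> (\<lambda>z. a h \<bullet> P z) ` {z \<in> int_lattice. norm1 z \<le> real n}" by auto
    show "finite \<dots>" by (intro finite_imageI finite_lattice_ball)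
  qed
  have "\<forall>h\<in>Hs. \<exists>C. C > 0 \<and> (\<forall>n\<ge>1. real (card (?V n h)) \<le> C * real n ^ expo (a h))"
  proof
    fix h assume h: "h \<in> Hs"
    obtain z0 where z0: "z0 \<in> int_lattice" "a h \<bullet> P z0 \<noteq> 0" using inner_P_nonzero Hs(2,3) h by blast
    show "\<exists>C. C > 0 \<and> (\<forall>n\<ge>1. real (card (?V n h)) \<le> C * real n ^ expo (a h))"
      using count_lattice_values_le[OF linear_inner_P z0, of "r h"] unfolding expo_def by blast
  qed
  from bchoice[OF this] obtain Ch where
    Ch: "\<forall>h\<in>Hs. Ch h > 0 \<and> (\<forall>n\<ge>1. real (card (?V n h)) \<le> Ch h * real n ^ expo (a h))" ..
  \<comment> \<open>At least 1, so that C ^ card B grows with B and can be replaced by C ^ card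
    Hs.\<close>
  define C where "C = 1 + (\<Sum>h\<in>Hs. Ch h)"
  have ChC: "Ch h \<le> C" if "h \<in> Hs" for h
  proof -
    have "Ch h \<le> (\<Sum>h\<in>Hs. Ch h)" using Ch Hs(1) that by (intro member_le_sum) (auto intro: less_imp_le)
    then show ?thesis by (simp add: C_def)
  qed
  have "0 \<le> sum Ch Hs" by (rule sum_nonneg) (use Ch in \<open>auto intro: less_imp_le\<close>)
  then have C1: "C \<ge> 1" by (simp add: C_def)
  let ?A = "{A. A \<subseteq> Hs \<and> inj_on a A \<and> independent (a ` A)}"
  have finA: "finite ?A" using Hs(1) by (auto intro: finite_subset[of _ "Pow Hs"])
  have main: "real (card {pattern w n | w. w \<in> K}) \<le> (real (card ?A) + 1) * C ^ card Hs * real n ^ A" if n: "n \<ge> 1" for n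
  proof -
    define T where "T h = (\<lambda>t. b h - t) ` ?V n h" for h
    have finT: "finite (T h)" for h unfolding T_def by (intro finite_imageI finV)
    have cT: "real (card (T h)) \<le> C * real n ^ expo (a h)" if "h \<in> Hs" for h
    proof -
      have "real (card (T h)) \<le> real (card (?V n h))" unfolding T_def by (simp add: card_image_le finV)
      also have "\<dots> \<le> Ch h * real n ^ expo (a h)" using Ch n that by blast
      also have "\<dots> \<le> C * real n ^ expo (a h)" using ChC[OF that] by (intro mult_right_mono) auto
      finally show ?thesis .
    qed
    let ?S = "\<lambda>w. {i \<in> Sigma Hs T. a (fst i) \<bullet> w \<le> snd i}"
    \<comment> \<open>Decodes a pattern from the set of half-spaces containing \<open>w\<close>.
      Hence there are no more patterns than such sets.\<close>
    define D where "D S = {z \<in> int_lattice. norm1 z \<le> real n \<and>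
      (\<forall>h\<in>Hs. if \<bar>a h \<bullet> P z\<bar> \<le> r h then (h, b h - a h \<bullet> P z) \<in> S else a h \<bullet> P z < 0)}" for S
    have D: "pattern w n = D (?S w)" if w: "w \<in> K" for w
    proof -
      have "w + P z \<in> K \<longleftrightarrow> (\<forall>h\<in>Hs. if \<bar>a h \<bullet> P z\<bar> \<le> r h then (h, b h - a h \<bullet> P z) \<in> ?S w else a h \<bullet> P z < 0)"
        if z: "z \<in> int_lattice" "norm1 z \<le> real n" for z
      proof -
        have "w + P z \<in> F" using w K(1) P_mem subspace_F by (auto intro: subspace_add)
        then have "w + P z \<in> K \<longleftrightarrow> (\<forall>h\<in>Hs. a h \<bullet> w + a h \<bullet> P z \<le> b h)"
          using Hs(4) by (simp add: inner_add_right)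
        also have "\<dots> \<longleftrightarrow> (\<forall>h\<in>Hs. if \<bar>a h \<bullet> P z\<bar> \<le> r h then (h, b h - a h \<bullet> P z) \<in> ?S w else a h \<bullet> P z < 0)"
        proof (intro ball_cong refl)
          fix h assume h: "h \<in> Hs"
          show "a h \<bullet> w + a h \<bullet> P z \<le> b h \<longleftrightarrow>
            (if \<bar>a h \<bullet> P z\<bar> \<le> r h then (h, b h - a h \<bullet> P z) \<in> ?S w else a h \<bullet> P z < 0)"
          proof (cases "\<bar>a h \<bullet> P z\<bar> \<le> r h")
            case True
            then have "b h - a h \<bullet> P z \<in> T h" unfolding T_def using z by blast
            then show ?thesis using True h by auto
          next
            case False
            then show ?thesis using ar[OF w, of h] by auto
          qed
        qed
        finally show ?thesis .
      qed
      then show ?thesis unfolding pattern_def D_def by blast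
    qed
    have "{pattern w n | w. w \<in> K} = (\<lambda>w. pattern w n) ` K" by blast
    also have "\<dots> = (\<lambda>w. D (?S w)) ` K" using D by (intro image_cong) auto
    also have "\<dots> = D ` {?S w | w. w \<in> K}" by blast
    finally have "{pattern w n | w. w \<in> K} = D ` {?S w | w. w \<in> K}" .
    moreover have "finite {?S w | w. w \<in> K}"
    proof (rule finite_subset)
      show "{?S w | w. w \<in> K} \<subseteq> Pow (Sigma Hs T)" by blast
      have "finite (Sigma Hs T)" using Hs(1) finT by (rule finite_SigmaI)
      then show "finite (Pow (Sigma Hs T))" by simp
    qed
    ultimately have "card {pattern w n | w. w \<in> K} \<le> card {?S w | w. w \<in> K}"
      by (simp add: card_image_le)
    also have "\<dots> \<le> (\<Sum>B\<in>?A. \<Prod>h\<in>B. card (T h))"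
      by (rule card_halfspace_patterns_le[OF Hs(1) finT])
    finally have "real (card {pattern w n | w. w \<in> K}) \<le> real (\<Sum>B\<in>?A. \<Prod>h\<in>B. card (T h))"
      by (rule of_nat_mono)
    also have "\<dots> = (\<Sum>B\<in>?A. \<Prod>h\<in>B. real (card (T h)))" by simp
    also have "\<dots> \<le> (\<Sum>B\<in>?A. C ^ card Hs * real n ^ A)"
    proof (intro sum_mono)
      fix B assume B: "B \<in> ?A"
      have finB: "finite B" using B Hs(1) by (auto intro: finite_subset[of B Hs])
      have "(\<Prod>h\<in>B. real (card (T h))) \<le> (\<Prod>h\<in>B. C * real n ^ expo (a h))"
        using cT B by (intro prod_mono) auto
      also have "\<dots> = C ^ card B * real n ^ (\<Sum>h\<in>B. expo (a h))"
        by (simp add: prod.distrib power_sum)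
      also have "\<dots> \<le> C ^ card Hs * real n ^ A"
      proof (intro mult_mono power_increasing)
        show "card B \<le> card Hs" using B Hs(1) by (auto intro: card_mono)
        have "(\<Sum>h\<in>B. expo (a h)) = (\<Sum>a\<in>a ` B. expo a)" using B by (simp add: sum.reindex)
        also have "\<dots> \<le> A"
          using B finB Hs(2,3,5) by (intro hyp) (auto simp: singular_normal_def)
        finally show "(\<Sum>h\<in>B. expo (a h)) \<le> A" .
      qed (use C1 n in auto)
      finally show "(\<Prod>h\<in>B. real (card (T h))) \<le> C ^ card Hs * real n ^ A" .
    qed
    also have "\<dots> \<le> (real (card ?A) + 1) * C ^ card Hs * real n ^ A"
      using C1 by (simp add: algebra_simps)
    finally show ?thesis .
  qed
  have "(real (card ?A) + 1) * C ^ card Hs > 0" using C1 by (intro mult_pos_pos) auto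
  then show ?thesis using main by blast
qed

section \<open>Maximality of the sum of exponents\<close>

lemma singular_normal_of:
  assumes "h \<in> singular_hyperplanes F K"
  obtains a where "singular_normal a" "h = {x \<in> F. a \<bullet> x = 0}"
proof -
  obtain f where f: "facet_in F K f" "h = direction f" using assms by (auto simp: singular_hyperplanes_def)
  obtain a b where "a \<in> F" "a \<noteq> 0" "\<And>x. x \<in> K \<Longrightarrow> a \<bullet> x \<le> b" "f = K \<inter> {x. a \<bullet> x = b}"
    "direction f = {x \<in> F. a \<bullet> x = 0}" using facet_support[OF f(1)] by blast
  then show ?thesis using that assms f by (auto simp: singular_normal_def)
qed

text \<open>A hyperplane of \<open>F\<close> determines its normal up to a scalar, and independence
  excludes proportional vectors. This makes the passage from a basis of normals to indices
  injective.\<close>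

lemma same_hyperplane_imp_eq:
  assumes "independent B" "\<beta> \<in> B" "\<beta>' \<in> B" "\<beta> \<in> F" "\<beta>' \<in> F" "\<beta> \<noteq> 0"
    "{x \<in> F. \<beta> \<bullet> x = 0} = {x \<in> F. \<beta>' \<bullet> x = 0}"
  shows "\<beta> = \<beta>'"
proof (rule ccontr)
  assume ne: "\<beta> \<noteq> \<beta>'"
  define v where "v = \<beta>' - (\<beta> \<bullet> \<beta>' / (\<beta> \<bullet> \<beta>)) *\<^sub>R \<beta>"
  have "v \<in> F" "\<beta> \<bullet> v = 0"
    unfolding v_def using assms subspace_F by (auto simp: inner_diff_right intro!: subspace_diff subspace_scale)
  moreover from this have "\<beta>' \<bullet> v = 0" using assms(7) by blast
  ultimately have "v \<bullet> v = 0"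
    by (subst v_def) (simp add: inner_diff_left)
  then have "\<beta>' = (\<beta> \<bullet> \<beta>' / (\<beta> \<bullet> \<beta>)) *\<^sub>R \<beta>" by (simp add: v_def)
  moreover have "(\<beta> \<bullet> \<beta>' / (\<beta> \<bullet> \<beta>)) *\<^sub>R \<beta> \<in> span (B - {\<beta>'})"
    using assms(2) ne by (intro span_scale span_base) auto
  ultimately have "\<beta>' \<in> span (B - {\<beta>'})" by simp
  then show False using assms(1,3) by (auto simp: dependent_def)
qed

text \<open>The normals belonging to \<open>I\<close> span \<open>F\<close>, so they suffice to
  extend \<open>S\<close> to a basis made of singular normals. The hyperplanes of this basis form an
  admissible set of indices, to which the maximality applies.\<close>

lemma independent_normals_le:
  fixes H :: "nat \<Rightarrow> (real ^ 'n) set"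
  assumes H: "bij_betw H {1..m} (singular_hyperplanes F K)"
    and I: "I \<subseteq> {1..m}" "card I = CARD('n) - d" "(\<Inter>i\<in>I. H i) = {0}"
    and I_max: "\<And>J. J \<subseteq> {1..m} \<Longrightarrow> card J = CARD('n) - d \<Longrightarrow> (\<Inter>j\<in>J. H j) = {0} \<Longrightarrow>
                  (\<Sum>j\<in>J. sing_exponent E F (H j)) \<le> M"
    and S: "independent S" "\<And>a. a \<in> S \<Longrightarrow> singular_normal a"
  shows "int (\<Sum>a\<in>S. expo a) \<le> M"
proof -
  have "\<forall>i\<in>I. \<exists>a. singular_normal a \<and> H i = {x \<in> F. a \<bullet> x = 0}"
  proof
    fix i assume "i \<in> I"
    then have "H i \<in> singular_hyperplanes F K" using H I(1) by (auto simp: bij_betw_def)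
    then obtain a where "singular_normal a" "H i = {x \<in> F. a \<bullet> x = 0}" by (rule singular_normal_of)
    then show "\<exists>a. singular_normal a \<and> H i = {x \<in> F. a \<bullet> x = 0}" by (intro exI conjI)
  qed
  from bchoice[OF this] obtain a where a: "\<forall>i\<in>I. singular_normal (a i) \<and> H i = {x \<in> F. a i \<bullet> x = 0}" ..
  obtain B where B: "S \<subseteq> B" "B \<subseteq> S \<union> a ` I" "independent B" "S \<union> a ` I \<subseteq> span B"
    using maximal_independent_subset_extend[OF Un_upper1 S(1), of "a ` I"] by metis
  have normal: "singular_normal \<beta>" if "\<beta> \<in> B" for \<beta> using B(2) S(2) a that by blast
  then have BF: "B \<subseteq> F" by (auto simp: singular_normal_def)
  have finB: "finite B" by (rule independent_imp_finite[OF B(3)])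
  have spB: "span B = F"
  proof (rule ccontr)
    assume ne: "span B \<noteq> F"
    have sF: "span F = F" using subspace_F by (simp add: span_eq_iff)
    have "span B \<subset> span F" using ne sF span_mono[OF BF] by (simp only: psubset_eq) metis
    then obtain x where x: "x \<noteq> 0" "x \<in> span F" "\<And>y. y \<in> span B \<Longrightarrow> orthogonal x y"
      using orthogonal_to_subspace_exists_gen by metis
    \<comment> \<open>A vector of \<open>F\<close> orthogonal to the basis would lie in all
      hyperplanes of \<open>I\<close>, whose intersection is trivial.\<close>
    have "x \<in> H i" if "i \<in> I" for i
    proof -
      have "a i \<in> span B" using B(4) that by auto
      then have "a i \<bullet> x = 0" using x(3) by (metis orthogonal_def inner_commute)
      then show ?thesis using a that x(2) sF by auto
    qed
    then have "x \<in> (\<Inter>i\<in>I. H i)" by blast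
    then show False using I(3) x(1) by auto
  qed
  have cB: "card B = dim F" using dim_span_eq_card_independent[OF B(3)] spB by simp
  have "\<forall>\<beta>\<in>B. \<exists>j. j \<in> {1..m} \<and> H j = {x \<in> F. \<beta> \<bullet> x = 0}"
  proof
    fix \<beta> assume "\<beta> \<in> B"
    then have "{x \<in> F. \<beta> \<bullet> x = 0} \<in> H ` {1..m}"
      using normal H by (simp add: singular_normal_def bij_betw_def)
    then obtain j where "{x \<in> F. \<beta> \<bullet> x = 0} = H j" "j \<in> {1..m}" by (rule imageE)
    then show "\<exists>j. j \<in> {1..m} \<and> H j = {x \<in> F. \<beta> \<bullet> x = 0}" by (intro exI[of _ j]) simp
  qed
  from bchoice[OF this] obtain j where j: "\<forall>\<beta>\<in>B. j \<beta> \<in> {1..m} \<and> H (j \<beta>) = {x \<in> F. \<beta> \<bullet> x = 0}" ..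
  have inj: "inj_on j B"
  proof (rule inj_onI)
    fix \<beta> \<beta>' assume b: "\<beta> \<in> B" "\<beta>' \<in> B" "j \<beta> = j \<beta>'"
    have "H (j \<beta>) = {x \<in> F. \<beta> \<bullet> x = 0}" "H (j \<beta>') = {x \<in> F. \<beta>' \<bullet> x = 0}"
      using j b(1,2) by simp_all
    then have "{x \<in> F. \<beta> \<bullet> x = 0} = {x \<in> F. \<beta>' \<bullet> x = 0}" using b(3) by simp
    then show "\<beta> = \<beta>'"
      using b normal B(3) by (intro same_hyperplane_imp_eq) (auto simp: singular_normal_def)
  qed
  \<comment> \<open>The intersection of an empty family is the whole space, not \<open>F\<close>;
    nonemptiness is what confines the intersection below to \<open>F\<close>.\<close>
  have "B \<noteq> {}"
  proof
    assume "B = {}"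
    then have "card B = 0" by simp
    then show False using cB dim_F(2) by linarith
  qed
  have "(\<Inter>i\<in>j ` B. H i) = {0}"
  proof
    show "{0} \<subseteq> (\<Inter>i\<in>j ` B. H i)" using j subspace_0[OF subspace_F] by auto
    show "(\<Inter>i\<in>j ` B. H i) \<subseteq> {0}"
    proof
      fix x assume "x \<in> (\<Inter>i\<in>j ` B. H i)"
      then have x: "\<beta> \<bullet> x = 0 \<and> x \<in> F" if "\<beta> \<in> B" for \<beta> using j that by auto
      then have "x \<in> span B" using \<open>B \<noteq> {}\<close> spB by auto
      moreover have "orthogonal x \<beta>" if "\<beta> \<in> B" for \<beta>
        using x[OF that] unfolding orthogonal_def by (metis inner_commute)
      ultimately have "orthogonal x x" by (rule orthogonal_to_span)
      then show "x \<in> {0}" by (simp add: orthogonal_self)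
    qed
  qed
  moreover have "card (j ` B) = CARD('n) - d" using card_image[OF inj] cB dim_F(1) by simp
  moreover have "j ` B \<subseteq> {1..m}" using j by blast
  ultimately have "(\<Sum>i\<in>j ` B. sing_exponent E F (H i)) \<le> M" by (intro I_max)
  also have "(\<Sum>i\<in>j ` B. sing_exponent E F (H i)) = (\<Sum>\<beta>\<in>B. sing_exponent E F (H (j \<beta>)))"
    using inj by (simp add: sum.reindex)
  also have "\<dots> = (\<Sum>\<beta>\<in>B. int (expo \<beta>))"
    using j normal sing_exponent_eq by (intro sum.cong) (auto simp: singular_normal_def)
  finally have "(\<Sum>\<beta>\<in>B. int (expo \<beta>)) \<le> M" .
  \<comment> \<open>Exponents are nonnegative, so the added basis vectors only increase the
    sum.\<close>
  moreover have "(\<Sum>a\<in>S. int (expo a)) \<le> (\<Sum>\<beta>\<in>B. int (expo \<beta>))"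
    using B(1) finB by (intro sum_mono2) auto
  ultimately show ?thesis by simp
qed

end

section \<open>The grid of translated facets\<close>

lemma finite_gap:
  assumes "finite (T :: real set)" "\<sigma> > 0"
  shows "\<exists>\<epsilon>>0. \<epsilon> \<le> \<sigma> \<and> (\<forall>s\<in>T. \<forall>t\<in>T. s < t \<longrightarrow> s \<le> t - \<epsilon>)"
proof -
  let ?D = "insert \<sigma> ((\<lambda>(s, t). t - s) ` {(s, t) \<in> T \<times> T. s < t})"
  have "finite {(s, t) \<in> T \<times> T. s < t}"
    by (rule finite_subset[of _ "T \<times> T"]) (use assms(1) in auto)
  then have fin: "finite ?D" by simp
  have "Min ?D > 0" using fin assms(2) by (subst Min_gr_iff) auto
  moreover have "Min ?D \<le> \<sigma>" using fin by (intro Min_le) auto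
  moreover have "s \<le> t - Min ?D" if "s \<in> T" "t \<in> T" "s < t" for s t
  proof -
    have "t - s \<in> ?D" using that by (intro insertI2 image_eqI[of _ _ "(s, t)"]) auto
    then have "Min ?D \<le> t - s" using fin by (intro Min_le)
    then show ?thesis by simp
  qed
  ultimately show ?thesis by blast
qed

lemma finite_lower_bound:
  fixes f :: "'i \<Rightarrow> real"
  assumes "finite I" "\<And>i. i \<in> I \<Longrightarrow> f i > 0" "e > 0"
  obtains \<eta> where "\<eta> > 0" "\<eta> \<le> e" "\<And>i. i \<in> I \<Longrightarrow> \<eta> \<le> f i"
proof -
  let ?D = "insert e (f ` I)"
  have fin: "finite ?D" using assms(1) by simp
  have "Min ?D > 0" using fin assms by (subst Min_gr_iff) auto
  moreover have "Min ?D \<le> x" if "x \<in> ?D" for x using fin that by (intro Min_le)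
  ultimately show ?thesis using that[of "Min ?D"] by blast
qed

context cut_data
begin

lemma dual_family:
  fixes a :: "'i \<Rightarrow> real ^ 'n"
  assumes I: "finite I" "card I = dim F" and a: "\<And>i. i \<in> I \<Longrightarrow> a i \<in> F"
    and zero: "\<forall>x\<in>F. (\<forall>i\<in>I. a i \<bullet> x = 0) \<longrightarrow> x = 0"
  obtains u where "\<And>i. i \<in> I \<Longrightarrow> u i \<in> F"
    "\<And>i j. i \<in> I \<Longrightarrow> j \<in> I \<Longrightarrow> a j \<bullet> u i = (if i = j then 1 else 0)"
    "\<And>x. x \<in> F \<Longrightarrow> x = (\<Sum>i\<in>I. (a i \<bullet> x) *\<^sub>R u i)"
proof -
  have sF: "span F = F" using subspace_F by (simp add: span_eq_iff)
  have "\<exists>v. v \<in> F \<and> (\<forall>j\<in>I. a j \<bullet> v = (if i = j then 1 else 0))" if i: "i \<in> I" for i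
  proof -
    \<comment> \<open>These are too few vectors to span \<open>F\<close>. A nonzero vector
      orthogonal to them cannot be orthogonal to \<open>a i\<close> as well, so it can be normalized
      to a dual vector.\<close>
    let ?S = "a ` (I - {i})"
    have "dim (span ?S) \<le> card ?S" using I(1) by (simp add: dim_le_card')
    also have "\<dots> \<le> card (I - {i})" using I(1) by (intro card_image_le) simp
    also have "\<dots> < dim F" using i I by (metis card_Diff1_less)
    finally have "span ?S \<noteq> F" by auto
    moreover have "span ?S \<subseteq> span F" using a by (intro span_mono) auto
    ultimately have "span ?S \<subset> span F" using sF by (simp only: psubset_eq) metis
    then obtain v where v: "v \<noteq> 0" "v \<in> span F" "\<And>y. y \<in> span ?S \<Longrightarrow> orthogonal v y"
      using orthogonal_to_subspace_exists_gen by metis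
    have vj: "a j \<bullet> v = 0" if "j \<in> I" "j \<noteq> i" for j
    proof -
      have "orthogonal v (a j)" using that by (intro v(3) span_base) auto
      then show ?thesis by (metis orthogonal_def inner_commute)
    qed
    have vi: "a i \<bullet> v \<noteq> 0"
    proof
      assume 0: "a i \<bullet> v = 0"
      have "v = 0"
      proof (rule zero[rule_format])
        show "v \<in> F" using v(2) sF by simp
        show "a j \<bullet> v = 0" if "j \<in> I" for j using vj[OF that] 0 by (cases "j = i") auto
      qed
      then show False using v(1) by simp
    qed
    let ?u = "(1 / (a i \<bullet> v)) *\<^sub>R v"
    have "?u \<in> F" using v(2) sF subspace_F by (auto intro: subspace_scale)
    moreover have "a j \<bullet> ?u = (if i = j then 1 else 0)" if "j \<in> I" for j
      using vj[OF that] vi by auto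
    ultimately show ?thesis by blast
  qed
  then have "\<forall>i\<in>I. \<exists>v. v \<in> F \<and> (\<forall>j\<in>I. a j \<bullet> v = (if i = j then 1 else 0))" by (rule ballI)
  from bchoice[OF this] obtain u where u: "\<forall>i\<in>I. u i \<in> F \<and> (\<forall>j\<in>I. a j \<bullet> u i = (if i = j then 1 else 0))" ..
  have "x = (\<Sum>i\<in>I. (a i \<bullet> x) *\<^sub>R u i)" if x: "x \<in> F" for x
  proof -
    have "x - (\<Sum>i\<in>I. (a i \<bullet> x) *\<^sub>R u i) = 0"
    proof (rule zero[rule_format])
      show "x - (\<Sum>i\<in>I. (a i \<bullet> x) *\<^sub>R u i) \<in> F"
        using x u subspace_F by (intro subspace_diff subspace_sum subspace_scale) auto
      fix j assume j: "j \<in> I"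
      have "a j \<bullet> (\<Sum>i\<in>I. (a i \<bullet> x) *\<^sub>R u i) = (\<Sum>i\<in>I. if i = j then a j \<bullet> x else 0)"
        unfolding inner_sum_right using u j by (intro sum.cong) auto
      also have "\<dots> = a j \<bullet> x" using I(1) j by simp
      finally show "a j \<bullet> (x - (\<Sum>i\<in>I. (a i \<bullet> x) *\<^sub>R u i)) = 0" by (simp add: inner_diff_right)
    qed
    then show ?thesis by simp
  qed
  then show ?thesis using that[of u] u by simp
qed

lemma mem_lifted_points: "y \<in> lifted_points E K x \<longleftrightarrow> (\<exists>z\<in>int_lattice. y = x + z) \<and> P y \<in> K"
proof -
  have "y \<in> strip E K \<longleftrightarrow> P y \<in> K"
  proof
    assume "y \<in> strip E K"
    then obtain k e where ke: "k \<in> K" "e \<in> E" "y = k + e" by (auto simp: strip_def set_plus_def)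
    then have "P y = k" using K(1) by (auto simp: P_add P_on_F P_on_E)
    then show "P y \<in> K" using ke by simp
  next
    assume "P y \<in> K"
    then have "P y + (y - P y) \<in> K + E" using P_ker by (rule set_plus_intro)
    then show "y \<in> strip E K" by (simp add: strip_def)
  qed
  then show ?thesis by (auto simp: lifted_points_def elt_set_plus_def)
qed

lemma lifted_point_near:
  assumes "q \<in> F" "\<theta> > 0"
  obtains z where "z \<in> int_lattice" "norm (P (x + z) - q) < \<theta>"
proof -
  have "q - P x \<in> F" using assms(1) P_mem subspace_F by (auto intro: subspace_diff)
  then obtain z where "z \<in> int_lattice" "norm (P z - (q - P x)) < \<theta>" using P_lattice_dense assms(2) by blast
  then show ?thesis using that[of z] by (simp add: P_add algebra_simps)
qed

text \<open>In the coordinates \<open>w \<mapsto> a i \<bullet> w\<close>, near an interior point \<open>w0\<close>, the many translates of the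
  facet \<open>f i\<close> given by \<open>many_values_near_point\<close> are full coordinate hyperplanes with a translate
  of \<open>K\<close> on one side. They cut a neighbourhood of \<open>w0\<close> into boxes with distinct patterns.\<close>

lemma card_patterns_ge:
  fixes a :: "'i \<Rightarrow> real ^ 'n" and f :: "'i \<Rightarrow> (real ^ 'n) set"
  assumes I: "finite I" "card I = dim F"
    and f: "\<And>i. i \<in> I \<Longrightarrow> facet_in F K (f i)"
    and a: "\<And>i. i \<in> I \<Longrightarrow> a i \<in> F" "\<And>i. i \<in> I \<Longrightarrow> a i \<noteq> 0"
      "\<And>i x. i \<in> I \<Longrightarrow> x \<in> K \<Longrightarrow> a i \<bullet> x \<le> b i" "\<And>i. i \<in> I \<Longrightarrow> f i = K \<inter> {x. a i \<bullet> x = b i}"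
      "\<And>i. i \<in> I \<Longrightarrow> direction (f i) = {x \<in> F. a i \<bullet> x = 0}"
    and zero: "\<forall>x\<in>F. (\<forall>i\<in>I. a i \<bullet> x = 0) \<longrightarrow> x = 0"
  shows "\<exists>c>0. \<exists>C\<ge>1::nat. \<forall>x. \<forall>n\<ge>1.
           c * real n ^ (\<Sum>i\<in>I. expo (a i)) \<le> real (card {pattern (P y) (C * n) | y. y \<in> lifted_points E K x})"
proof -
  obtain u where u: "\<And>i. i \<in> I \<Longrightarrow> u i \<in> F"
    "\<And>i j. i \<in> I \<Longrightarrow> j \<in> I \<Longrightarrow> a j \<bullet> u i = (if i = j then 1 else 0)"
    "\<And>x. x \<in> F \<Longrightarrow> x = (\<Sum>i\<in>I. (a i \<bullet> x) *\<^sub>R u i)"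
    using dual_family[of I a, OF I a(1) zero] by blast
  obtain w0 \<eta>0 where w0: "w0 \<in> K" "\<eta>0 > 0" "\<And>w. w \<in> F \<Longrightarrow> norm (w - w0) \<le> \<eta>0 \<Longrightarrow> w \<in> K"
    using interior_point by blast
  have w0F: "w0 \<in> F" using w0(1) K(1) by auto
  have "\<forall>i\<in>I. \<exists>p. \<exists>\<delta>>0. p \<in> f i \<and> (\<forall>x. x \<in> F \<longrightarrow> norm (x - p) \<le> \<delta> \<longrightarrow> a i \<bullet> x \<le> b i \<longrightarrow> x \<in> K)"
  proof
    fix i assume i: "i \<in> I"
    obtain p \<delta> where "p \<in> f i" "\<delta> > 0" "\<And>x. x \<in> F \<Longrightarrow> norm (x - p) \<le> \<delta> \<Longrightarrow> a i \<bullet> x \<le> b i \<Longrightarrow> x \<in> K"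
      using half_ball[OF f[OF i] a(3)[OF i] a(4)[OF i] a(5)[OF i]] by blast
    then show "\<exists>p. \<exists>\<delta>>0. p \<in> f i \<and> (\<forall>x. x \<in> F \<longrightarrow> norm (x - p) \<le> \<delta> \<longrightarrow> a i \<bullet> x \<le> b i \<longrightarrow> x \<in> K)"
      by blast
  qed
  from bchoice[OF this] obtain p where
    "\<forall>i\<in>I. \<exists>\<delta>>0. p i \<in> f i \<and> (\<forall>x. x \<in> F \<longrightarrow> norm (x - p i) \<le> \<delta> \<longrightarrow> a i \<bullet> x \<le> b i \<longrightarrow> x \<in> K)" ..
  from bchoice[OF this] obtain \<delta> where
    p\<delta>: "\<forall>i\<in>I. \<delta> i > 0 \<and> p i \<in> f i \<and> (\<forall>x. x \<in> F \<longrightarrow> norm (x - p i) \<le> \<delta> i \<longrightarrow> a i \<bullet> x \<le> b i \<longrightarrow> x \<in> K)" ..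
  have pF: "p i \<in> F" and pb: "a i \<bullet> p i = b i" if "i \<in> I" for i
    using p\<delta> that a(4)[OF that] K(1) by auto
  \<comment> \<open>\<eta>0 keeps points near \<open>w0\<close> inside \<open>K\<close>; half of
    \<delta> leaves the other half for the displacement of the facet centre.\<close>
  obtain \<eta> where \<eta>: "\<eta> > 0" "\<eta> \<le> \<eta>0" "\<And>i. i \<in> I \<Longrightarrow> \<eta> \<le> \<delta> i / 2"
    using finite_lower_bound[of I "\<lambda>i. \<delta> i / 2" \<eta>0] I(1) p\<delta> w0(2) by auto
  define U where "U = (\<Sum>i\<in>I. norm (u i)) + 1"
  have U: "U > 0" unfolding U_def by (intro add_nonneg_pos sum_nonneg) auto
  \<comment> \<open>If all coordinates relative to \<open>w0\<close> are at most \<sigma>, the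
    distance to \<open>w0\<close> is at most \<eta>.\<close>
  define \<sigma> where "\<sigma> = \<eta> / U"
  have \<sigma>: "\<sigma> > 0" using \<eta> U by (simp add: \<sigma>_def)
  define N where "N = (\<Sum>i\<in>I. norm (a i)) + 1"
  have N: "N > 0" unfolding N_def by (intro add_nonneg_pos sum_nonneg) auto
  have aN: "norm (a i) \<le> N" if "i \<in> I" for i
    unfolding N_def using member_le_sum[OF that, of "\<lambda>i. norm (a i)"] I(1) by simp
  \<comment> \<open>Small against \<eta>, so that points near \<open>w0\<close> stay near the
    translated facet centre; small against \<sigma>, so that the grid values are at most
    \<sigma>/2.\<close>
  define \<kappa> where "\<kappa> = min \<eta> (\<sigma> / (2 * N))"
  have \<kappa>: "\<kappa> > 0" "\<kappa> \<le> \<eta>" "N * \<kappa> \<le> \<sigma> / 2"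
  proof -
    show "\<kappa> > 0" "\<kappa> \<le> \<eta>" using \<eta> \<sigma> N by (auto simp: \<kappa>_def)
    have "N * \<kappa> \<le> N * (\<sigma> / (2 * N))" using N by (intro mult_left_mono) (auto simp: \<kappa>_def)
    then show "N * \<kappa> \<le> \<sigma> / 2" using N by simp
  qed
  have "\<forall>i\<in>I. \<exists>c. \<exists>C>0. c > 0 \<and> (\<forall>n\<ge>1. \<exists>Y\<subseteq>int_lattice. finite Y \<and> real (card Y) \<ge> c * real n ^ expo (a i) \<and>
           inj_on (\<lambda>z. a i \<bullet> P z) Y \<and> (\<forall>z\<in>Y. norm1 z \<le> C * real n \<and> norm (P z - (p i - w0)) \<le> \<kappa>))"
  proof
    fix i assume i: "i \<in> I"
    have "p i - w0 \<in> F" using pF[OF i] w0F subspace_F by (auto intro: subspace_diff)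
    from many_values_near_point[OF f[OF i] a(1)[OF i] a(2)[OF i] a(5)[OF i] this \<kappa>(1)]
    show "\<exists>c. \<exists>C>0. c > 0 \<and> (\<forall>n\<ge>1. \<exists>Y\<subseteq>int_lattice. finite Y \<and> real (card Y) \<ge> c * real n ^ expo (a i) \<and>
           inj_on (\<lambda>z. a i \<bullet> P z) Y \<and> (\<forall>z\<in>Y. norm1 z \<le> C * real n \<and> norm (P z - (p i - w0)) \<le> \<kappa>))"
      by blast
  qed
  from bchoice[OF this] obtain c where "\<forall>i\<in>I. \<exists>C>0. c i > 0 \<and> (\<forall>n\<ge>1. \<exists>Y\<subseteq>int_lattice. finite Y \<and> real (card Y) \<ge> c i * real n ^ expo (a i) \<and>
           inj_on (\<lambda>z. a i \<bullet> P z) Y \<and> (\<forall>z\<in>Y. norm1 z \<le> C * real n \<and> norm (P z - (p i - w0)) \<le> \<kappa>))" ..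
  from bchoice[OF this] obtain Cf where Cf: "\<forall>i\<in>I. Cf i > 0 \<and> c i > 0 \<and> (\<forall>n\<ge>1. \<exists>Y\<subseteq>int_lattice. finite Y \<and> real (card Y) \<ge> c i * real n ^ expo (a i) \<and>
           inj_on (\<lambda>z. a i \<bullet> P z) Y \<and> (\<forall>z\<in>Y. norm1 z \<le> Cf i * real n \<and> norm (P z - (p i - w0)) \<le> \<kappa>))" ..
  \<comment> \<open>A common bound for the norms of all the translations per unit of n, which is why
    the patterns are taken at size C * n.\<close>
  define C where "C = nat \<lceil>\<Sum>i\<in>I. Cf i\<rceil> + 1"
  have CfC: "Cf i \<le> real C" if "i \<in> I" for i
  proof -
    have "Cf i \<le> (\<Sum>i\<in>I. Cf i)"
      using that I(1) Cf by (intro member_le_sum) (auto intro: less_imp_le)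
    also have "\<dots> \<le> real C" unfolding C_def by linarith
    finally show ?thesis .
  qed
  have main: "(\<Prod>i\<in>I. c i) * real n ^ (\<Sum>i\<in>I. expo (a i)) \<le> real (card {pattern (P y) (C * n) | y. y \<in> lifted_points E K x})"
    if n: "n \<ge> 1" for n x
  proof -
    have "\<forall>i\<in>I. \<exists>Y. Y \<subseteq> int_lattice \<and> finite Y \<and> real (card Y) \<ge> c i * real n ^ expo (a i) \<and>
           inj_on (\<lambda>z. a i \<bullet> P z) Y \<and> (\<forall>z\<in>Y. norm1 z \<le> Cf i * real n \<and> norm (P z - (p i - w0)) \<le> \<kappa>)"
      using Cf n by blast
    from bchoice[OF this] obtain Y where Y: "\<forall>i\<in>I. Y i \<subseteq> int_lattice \<and> finite (Y i) \<and> real (card (Y i)) \<ge> c i * real n ^ expo (a i) \<and>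
           inj_on (\<lambda>z. a i \<bullet> P z) (Y i) \<and> (\<forall>z\<in>Y i. norm1 z \<le> Cf i * real n \<and> norm (P z - (p i - w0)) \<le> \<kappa>)" ..
    \<comment> \<open>The position of the facet translated by -P z in the i-th coordinate relative
      to \<open>w0\<close>: near \<open>w0\<close>, adding \<open>P z\<close> to a point lands in
      \<open>K\<close> exactly when its i-th coordinate is at most this value.\<close>
    define \<tau> where "\<tau> i z = a i \<bullet> (p i - w0 - P z)" for i z
    define T where "T i = \<tau> i ` Y i" for i
    have finT: "finite (T i)" if "i \<in> I" for i using Y that by (simp add: T_def)
    have cardT: "c i * real n ^ expo (a i) \<le> real (card (T i))" if "i \<in> I" for i
    proof -
      have "inj_on (\<tau> i) (Y i)" using Y that by (auto simp: inj_on_def \<tau>_def inner_diff_right)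
      then show ?thesis using Y that by (simp add: T_def card_image)
    qed
    have T\<sigma>: "\<bar>t\<bar> \<le> \<sigma> / 2" if i: "i \<in> I" and t: "t \<in> T i" for i t
    proof -
      obtain z where z: "z \<in> Y i" "t = \<tau> i z" using t by (auto simp: T_def)
      have "\<bar>t\<bar> \<le> norm (a i) * norm (p i - w0 - P z)" unfolding z(2) \<tau>_def by (rule Cauchy_Schwarz_ineq2)
      also have "\<dots> \<le> N * \<kappa>"
        using Y i z(1) aN[OF i] N by (intro mult_mono) (auto simp: norm_minus_commute)
      finally show ?thesis using \<kappa>(3) by simp
    qed
    have "finite (\<Union>i\<in>I. T i)" using I(1) finT by (rule finite_UN_I)
    then obtain \<epsilon> where \<epsilon>: "\<epsilon> > 0" "\<epsilon> \<le> \<sigma> / 2"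
      "\<And>s t. s \<in> (\<Union>i\<in>I. T i) \<Longrightarrow> t \<in> (\<Union>i\<in>I. T i) \<Longrightarrow> s < t \<Longrightarrow> s \<le> t - \<epsilon>"
      using finite_gap[of _ "\<sigma> / 2"] \<sigma> by (metis half_gt_zero)
    have ex: "\<exists>y. y \<in> lifted_points E K x \<and>
        (\<forall>i\<in>I. \<forall>z\<in>Y i. z \<in> pattern (P y) (C * n) \<longleftrightarrow> g i \<le> \<tau> i z)" if g: "g \<in> PiE I T" for g
    proof -
      \<comment> \<open>A corner of the grid lowered by half a gap in every coordinate. Points of
        the lifted set approximate it to less than \<epsilon>/2 in each coordinate, so they fall
        strictly between g i - \<epsilon> and g i, where no grid value lies.\<close>
      define q where "q = w0 + (\<Sum>i\<in>I. (g i - \<epsilon> / 2) *\<^sub>R u i)"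
      have qF: "q \<in> F" unfolding q_def
        using w0F u(1) subspace_F by (intro subspace_add subspace_sum subspace_scale) auto
      have aq: "a j \<bullet> (q - w0) = g j - \<epsilon> / 2" if "j \<in> I" for j
      proof -
        have "a j \<bullet> (q - w0) = (\<Sum>i\<in>I. if i = j then g j - \<epsilon> / 2 else 0)"
          unfolding q_def add_diff_cancel_left' inner_sum_right using u(2) that by (intro sum.cong) auto
        also have "\<dots> = g j - \<epsilon> / 2" using I(1) that by simp
        finally show ?thesis .
      qed
      obtain z0 where z0: "z0 \<in> int_lattice" "norm (P (x + z0) - q) < \<epsilon> / (2 * N)"
        using lifted_point_near[OF qF, of "\<epsilon> / (2 * N)" x] \<epsilon>(1) N by auto
      define y where "y = x + z0"
      define s where "s i = a i \<bullet> (P y - w0)" for i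
      have s: "g i - \<epsilon> < s i" "s i < g i" if "i \<in> I" for i
      proof -
        have "\<bar>a i \<bullet> (P y - q)\<bar> \<le> norm (a i) * norm (P y - q)" by (rule Cauchy_Schwarz_ineq2)
        also have "\<dots> \<le> N * norm (P y - q)" using aN[OF that] by (intro mult_right_mono) auto
        also have "\<dots> < N * (\<epsilon> / (2 * N))" using z0(2) N unfolding y_def by (intro mult_strict_left_mono)
        also have "\<dots> = \<epsilon> / 2" using N by simp
        finally have "\<bar>a i \<bullet> (P y - q)\<bar> < \<epsilon> / 2" .
        moreover have "s i = a i \<bullet> (P y - q) + (g i - \<epsilon> / 2)"
          unfolding s_def aq[OF that, symmetric] by (simp add: inner_diff_right)
        ultimately show "g i - \<epsilon> < s i" "s i < g i" by linarith+
      qed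
      have s\<sigma>: "\<bar>s i\<bar> \<le> \<sigma>" if "i \<in> I" for i
        using s[OF that] T\<sigma>[OF that PiE_mem[OF g that]] \<epsilon>(2) by linarith
      have near: "norm (P y - w0) \<le> \<eta>"
      proof -
        have "P y - w0 \<in> F" using P_mem w0F subspace_F by (auto intro: subspace_diff)
        then have "P y - w0 = (\<Sum>i\<in>I. s i *\<^sub>R u i)" unfolding s_def by (rule u(3))
        also have "norm \<dots> \<le> (\<Sum>i\<in>I. norm (s i *\<^sub>R u i))" by (rule norm_sum)
        also have "\<dots> \<le> (\<Sum>i\<in>I. \<sigma> * norm (u i))"
          using s\<sigma> by (intro sum_mono) (simp add: mult_right_mono)
        also have "\<dots> \<le> \<sigma> * U" using \<sigma> by (simp add: U_def sum_distrib_left algebra_simps)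
        also have "\<dots> = \<eta>" using U by (simp add: \<sigma>_def)
        finally show ?thesis .
      qed
      then have "P y \<in> K" using w0(3)[OF P_mem] \<eta>(2) by simp
      then have "y \<in> lifted_points E K x" using z0(1) by (auto simp: mem_lifted_points y_def)
      moreover have "z \<in> pattern (P y) (C * n) \<longleftrightarrow> g i \<le> \<tau> i z" if i: "i \<in> I" and z: "z \<in> Y i" for i z
      proof -
        have zl: "z \<in> int_lattice" and zn: "norm1 z \<le> Cf i * n" and zp: "norm (P z - (p i - w0)) \<le> \<kappa>"
          using Y i z by auto
        have "norm1 z \<le> real (C * n)" using zn CfC[OF i] mult_right_mono[of "Cf i" "real C" "real n"] by simp
        then have "z \<in> pattern (P y) (C * n) \<longleftrightarrow> P y + P z \<in> K" using zl by (simp add: pattern_def)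
        \<comment> \<open>The point is within \<delta> i of the facet centre, where the one
          inequality of this facet decides membership in \<open>K\<close>.\<close>
        also have "\<dots> \<longleftrightarrow> a i \<bullet> (P y + P z) \<le> b i"
        proof
          show "P y + P z \<in> K \<Longrightarrow> a i \<bullet> (P y + P z) \<le> b i" by (rule a(3)[OF i])
          assume le: "a i \<bullet> (P y + P z) \<le> b i"
          have "P y + P z - p i = (P y - w0) + (P z - (p i - w0))" by simp
          then have "norm (P y + P z - p i) \<le> norm (P y - w0) + norm (P z - (p i - w0))" by (metis norm_triangle_ineq)
          also have "\<dots> \<le> \<delta> i" using near zp \<kappa>(2) \<eta>(3)[OF i] by linarith
          finally have "norm (P y + P z - p i) \<le> \<delta> i" .
          moreover have "P y + P z \<in> F" using P_mem subspace_F by (auto intro: subspace_add)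
          ultimately show "P y + P z \<in> K" using p\<delta> i le by blast
        qed
        also have "\<dots> \<longleftrightarrow> s i \<le> \<tau> i z"
          using pb[OF i] by (simp add: s_def \<tau>_def inner_diff_right inner_add_right) linarith
        also have "\<dots> \<longleftrightarrow> g i \<le> \<tau> i z"
        proof
          assume "s i \<le> \<tau> i z"
          show "g i \<le> \<tau> i z"
          proof (rule ccontr)
            assume "\<not> g i \<le> \<tau> i z"
            then have "\<tau> i z \<le> g i - \<epsilon>"
              using i z PiE_mem[OF g i] by (intro \<epsilon>(3)) (auto simp: T_def)
            then show False using \<open>s i \<le> \<tau> i z\<close> s(1)[OF i] by linarith
          qed
        qed (use s(2)[OF i] in linarith)
        finally show ?thesis .
      qed
      ultimately show ?thesis by blast
    qed
    have "\<forall>g\<in>PiE I T. \<exists>y. y \<in> lifted_points E K x \<and>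
        (\<forall>i\<in>I. \<forall>z\<in>Y i. z \<in> pattern (P y) (C * n) \<longleftrightarrow> g i \<le> \<tau> i z)" using ex by (rule ballI)
    from bchoice[OF this] obtain yy where yy: "\<forall>g\<in>PiE I T. yy g \<in> lifted_points E K x \<and>
        (\<forall>i\<in>I. \<forall>z\<in>Y i. z \<in> pattern (P (yy g)) (C * n) \<longleftrightarrow> g i \<le> \<tau> i z)" ..
    let ?G = "\<lambda>g. pattern (P (yy g)) (C * n)"
    \<comment> \<open>The pattern contains the lattice vectors with grid value at least g i, in
      particular one with equality. Equal patterns thus bound the corners by each other.\<close>
    have le: "g' i \<le> g i" if g: "g \<in> PiE I T" "g' \<in> PiE I T" "?G g = ?G g'" and i: "i \<in> I" for g g' i
    proof -
      obtain z where z: "z \<in> Y i" "g i = \<tau> i z" using PiE_mem[OF g(1) i] by (auto simp: T_def)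
      then have "z \<in> ?G g" using yy g(1) i by simp
      then have "z \<in> ?G g'" using g(3) by simp
      moreover have "z \<in> ?G g' \<longleftrightarrow> g' i \<le> \<tau> i z" using yy g(2) i z(1) by blast
      ultimately show ?thesis using z(2) by simp
    qed
    have inj: "inj_on ?G (PiE I T)"
    proof (rule inj_onI)
      fix g g' assume g: "g \<in> PiE I T" "g' \<in> PiE I T" "?G g = ?G g'"
      show "g = g'"
      proof (rule PiE_ext[OF g(1,2)])
        fix i assume "i \<in> I"
        then show "g i = g' i" using le[OF g] le[OF g(2,1) g(3)[symmetric]] by (intro antisym)
      qed
    qed
    have "(\<Prod>i\<in>I. c i) * real n ^ (\<Sum>i\<in>I. expo (a i)) = (\<Prod>i\<in>I. c i * real n ^ expo (a i))"
      by (simp add: prod.distrib power_sum)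
    also have "\<dots> \<le> (\<Prod>i\<in>I. real (card (T i)))"
      using cardT Cf by (intro prod_mono) (auto intro: less_imp_le)
    also have "\<dots> = real (card (PiE I T))" using I(1) by (simp add: card_PiE)
    also have "\<dots> = real (card (?G ` PiE I T))" by (simp add: card_image[OF inj])
    also have "\<dots> \<le> real (card {pattern (P y) (C * n) | y. y \<in> lifted_points E K x})"
    proof (intro of_nat_mono card_mono)
      show "finite {pattern (P y) (C * n) | y. y \<in> lifted_points E K x}"
        by (rule finite_subset[OF _ finite_patterns[of "C * n" "\<lambda>_. True"]]) blast
      show "?G ` PiE I T \<subseteq> {pattern (P y) (C * n) | y. y \<in> lifted_points E K x}" using yy by blast
    qed
    finally show ?thesis .
  qed
  have "(\<Prod>i\<in>I. c i) > 0" using Cf by (intro prod_pos) auto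
  moreover have "C \<ge> 1" by (simp add: C_def)
  ultimately show ?thesis using main by blast
qed

end

section \<open>Patches and patterns\<close>

lemma card_le_fibres:
  assumes "finite S" "\<And>Z. Z \<in> S \<Longrightarrow> card {Z' \<in> S. g Z' = g Z} \<le> M"
  shows "card S \<le> M * card (g ` S)"
proof -
  have "S = (\<Union>t\<in>g ` S. {Z \<in> S. g Z = t})" by auto
  then have "card S = card (\<Union>t\<in>g ` S. {Z \<in> S. g Z = t})" by simp
  also have "\<dots> \<le> (\<Sum>t\<in>g ` S. card {Z \<in> S. g Z = t})" using assms(1) by (intro card_UN_le) simp
  also have "\<dots> \<le> (\<Sum>t\<in>g ` S. M)" using assms(2) by (intro sum_mono) auto
  finally show ?thesis by (simp add: mult.commute)
qed

context cut_data
begin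

abbreviation Q where "Q \<equiv> proj E F"

lemma Q_add: "Q (x + y) = Q x + Q y" and Q_diff: "Q (x - y) = Q x - Q y" and Q_0: "Q 0 = 0"
  using linear_proj[OF compl(1)] by (simp_all add: linear_add linear_diff linear_0)

lemma Q_mem: "Q x \<in> E"
  using proj_mem[OF compl(1)] by auto

lemma inj_Q: "inj_on Q int_lattice"
  using data by (auto simp: cut_and_projection_def)

definition patch_class :: "(real ^ 'n) set \<Rightarrow> (real ^ 'n) set set" where
  "patch_class Z = {(\<lambda>z. e + Q z) ` Z | e. e \<in> E}"

lemma patch_eq: "patch E F K y n = (\<lambda>z. Q y + Q z) ` pattern (P y) n"
proof -
  have "y + z \<in> strip E K \<longleftrightarrow> P y + P z \<in> K" if "z \<in> int_lattice" for z
    using mem_lifted_points[of "y + z" y] that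
    by (auto simp: lifted_points_def P_add elt_set_plus_def)
  then have "(y +o int_lattice) \<inter> cball1 y (real n) \<inter> strip E K = (\<lambda>z. y + z) ` pattern (P y) n"
    by (auto simp: pattern_def cball1_def elt_set_plus_def)
  then show ?thesis unfolding patch_def by (simp add: image_image Q_add)
qed

text \<open>The centre contributes only the translation by \<open>Q y\<close>, which lies in
  \<open>E\<close> and is absorbed by the quotient.\<close>

lemma complexity_eq:
  "complexity E F K x n = card (patch_class ` {pattern (P y) n | y. y \<in> lifted_points E K x})"
proof -
  have cls: "translation_rel E `` {patch E F K y n} = patch_class (pattern (P y) n)" for y
  proof
    have "e +o patch E F K y n = (\<lambda>z. (e + Q y) + Q z) ` pattern (P y) n" for e
      unfolding patch_eq by (auto simp: elt_set_plus_def image_iff add.assoc)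
    then show "translation_rel E `` {patch E F K y n} \<subseteq> patch_class (pattern (P y) n)"
      using Q_mem[of y] subspace_E unfolding translation_rel_def patch_class_def
      by (auto intro!: subspace_add)
    show "patch_class (pattern (P y) n) \<subseteq> translation_rel E `` {patch E F K y n}"
    proof
      fix B assume "B \<in> patch_class (pattern (P y) n)"
      then obtain e where e: "e \<in> E" "B = (\<lambda>z. e + Q z) ` pattern (P y) n" by (auto simp: patch_class_def)
      have "B = (e - Q y) +o patch E F K y n"
        unfolding e(2) patch_eq by (auto simp: elt_set_plus_def image_iff)
      moreover have "e - Q y \<in> E" using e(1) Q_mem subspace_E by (auto intro: subspace_diff)
      ultimately show "B \<in> translation_rel E `` {patch E F K y n}" by (auto simp: translation_rel_def)
    qed
  qed
  have "{patch E F K y n | y. y \<in> lifted_points E K x} // translation_rel E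
      = (\<lambda>y. translation_rel E `` {patch E F K y n}) ` lifted_points E K x"
    unfolding quotient_def by blast
  also have "\<dots> = (\<lambda>y. patch_class (pattern (P y) n)) ` lifted_points E K x" by (simp add: cls)
  also have "\<dots> = patch_class ` {pattern (P y) n | y. y \<in> lifted_points E K x}" by blast
  finally show ?thesis by (simp add: complexity_def)
qed

lemma finite_lifted_patterns: "finite {pattern (P y) n | y. y \<in> lifted_points E K x}"
  by (rule finite_subset[OF _ finite_patterns[of n "\<lambda>_. True"]]) blast

lemma complexity_le: "complexity E F K x n \<le> card {pattern w n | w. w \<in> K}"
proof -
  have "complexity E F K x n \<le> card {pattern (P y) n | y. y \<in> lifted_points E K x}"
    unfolding complexity_eq by (rule card_image_le[OF finite_lifted_patterns])
  also have "\<dots> \<le> card {pattern w n | w. w \<in> K}"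
    by (intro card_mono finite_patterns) (auto simp: mem_lifted_points)
  finally show ?thesis .
qed

text \<open>Round \<open>e\<close> to a lattice vector \<open>r\<close>. As \<open>P\<close> kills
  \<open>e\<close>, the point w + P r stays in a fixed compact set, and by density and compactness
  one of finitely many further lattice vectors leads from there into \<open>K\<close>.\<close>

lemma relatively_dense:
  "\<exists>C\<ge>0. \<forall>w\<in>K. \<forall>e\<in>E. \<exists>z\<in>int_lattice. w + P z \<in> K \<and> norm1 (z - e) \<le> C"
proof -
  obtain w0 \<eta> where w0: "w0 \<in> K" "\<eta> > 0" "\<And>w. w \<in> F \<Longrightarrow> norm (w - w0) \<le> \<eta> \<Longrightarrow> w \<in> K"
    using interior_point by blast
  obtain R where R: "R > 0" "\<And>w. w \<in> K \<Longrightarrow> norm w \<le> R" using K_bounded by blast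
  obtain BP where BP: "BP > 0" "\<And>x. norm (P x) \<le> BP * norm1 x" using P_bound by blast
  \<comment> \<open>R bounds \<open>w\<close>; rounding errors have 1-norm at most CARD('n), so
    their projections have norm at most BP times that.\<close>
  let ?S = "cball 0 (R + BP * CARD('n)) \<inter> F"
  let ?U = "\<lambda>z. {x. norm (x + P z - w0) < \<eta>}"
  have "compact ?S" by (intro compact_Int_closed closed_subspace subspace_F) auto
  moreover have "open (?U z)" for z by (intro open_Collect_less continuous_intros)
  moreover have "?S \<subseteq> (\<Union>z\<in>int_lattice. ?U z)"
  proof
    fix x assume "x \<in> ?S"
    then have "w0 - x \<in> F" using w0(1) K(1) subspace_F by (auto intro: subspace_diff)
    then obtain z where "z \<in> int_lattice" "norm (P z - (w0 - x)) < \<eta>" using P_lattice_dense w0(2) by blast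
    then show "x \<in> (\<Union>z\<in>int_lattice. ?U z)" by (auto simp: algebra_simps)
  qed
  ultimately obtain Z where Z: "Z \<subseteq> int_lattice" "finite Z" "?S \<subseteq> (\<Union>z\<in>Z. ?U z)"
    using compactE_image[of ?S int_lattice ?U] by blast
  define C where "C = CARD('n) + (\<Sum>z\<in>Z. norm1 z)"
  have "C \<ge> 0" unfolding C_def by (intro add_nonneg_nonneg sum_nonneg norm1_nonneg) auto
  moreover have "\<exists>z\<in>int_lattice. w + P z \<in> K \<and> norm1 (z - e) \<le> C" if w: "w \<in> K" and e: "e \<in> E" for w e
  proof -
    define r :: "real ^ 'n" where "r = (\<chi> i. of_int \<lfloor>e $ i\<rfloor>)"
    have r: "r \<in> int_lattice" by (simp add: r_def int_lattice_def)
    have "norm1 (r - e) \<le> (\<Sum>i\<in>(UNIV :: 'n set). 1)"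
      unfolding norm1_def by (intro sum_mono) (simp add: r_def, linarith)
    then have rn: "norm1 (r - e) \<le> CARD('n)" by simp
    have "norm (P (r - e)) \<le> BP * CARD('n)"
      using BP(2)[of "r - e"] mult_left_mono[OF rn less_imp_le[OF BP(1)]] by linarith
    then have "norm (P r) \<le> BP * CARD('n)" using P_on_E[OF e] by (simp add: P_diff)
    then have "norm (w + P r) \<le> R + BP * CARD('n)"
      using R(2)[OF w] norm_triangle_ineq[of w "P r"] by linarith
    moreover have wr: "w + P r \<in> F" using w K(1) P_mem subspace_F by (auto intro: subspace_add)
    ultimately have "w + P r \<in> ?S" by simp
    then obtain z where z: "z \<in> Z" "norm (w + P r + P z - w0) < \<eta>" using Z(3) by blast
    have "w + P (r + z) \<in> K"
    proof (rule w0(3))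
      show "w + P (r + z) \<in> F" using w K(1) P_mem subspace_F by (auto intro: subspace_add)
      show "norm (w + P (r + z) - w0) \<le> \<eta>" using z(2) by (simp add: P_add add.assoc)
    qed
    moreover have "norm1 (r + z - e) \<le> C"
    proof -
      have "norm1 z \<le> (\<Sum>z\<in>Z. norm1 z)" using Z(2) z(1) by (intro member_le_sum norm1_nonneg)
      moreover have "norm1 ((r - e) + z) \<le> norm1 (r - e) + norm1 z" by (rule norm1_triangle)
      ultimately show ?thesis using rn by (simp add: C_def algebra_simps)
    qed
    moreover have "r + z \<in> int_lattice" using r z(1) Z(1) by (auto intro: int_lattice_add)
    ultimately show ?thesis by blast
  qed
  ultimately show ?thesis by blast
qed

text \<open>Two patterns with the same class differ by a lattice translation. It is bounded independently
  of \<open>n\<close>: a translation by a long vector of \<open>E\<close> would move a point of the pattern lying close to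
  the boundary of the ball of radius \<open>n\<close> out of the ball.\<close>

lemma same_class_translate:
  "\<exists>C. \<forall>n w w'. w \<in> K \<longrightarrow> w' \<in> K \<longrightarrow> patch_class (pattern w n) = patch_class (pattern w' n) \<longrightarrow>
     (\<exists>z0\<in>int_lattice. norm1 z0 \<le> C \<and> pattern w' n = (\<lambda>z. z + z0) ` pattern w n)"
proof -
  obtain C1 where C1: "C1 \<ge> 0" "\<forall>w\<in>K. \<forall>e\<in>E. \<exists>z\<in>int_lattice. w + P z \<in> K \<and> norm1 (z - e) \<le> C1"
    using relatively_dense by blast
  obtain R where R: "R > 0" "\<And>w. w \<in> K \<Longrightarrow> norm w \<le> R" using K_bounded by blast
  define C2 where "C2 = CARD('n) * (2 * R)"
  have C2: "C2 \<ge> 0" using R(1) by (simp add: C2_def)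
  have "\<exists>z0\<in>int_lattice. norm1 z0 \<le> 2 * C1 + 2 * C2 \<and> pattern w' n = (\<lambda>z. z + z0) ` pattern w n"
    if w: "w \<in> K" "w' \<in> K" and eq: "patch_class (pattern w n) = patch_class (pattern w' n)" for n w w'
  proof -
    \<comment> \<open>The origin belongs to both patterns. Its preimage \<open>z1\<close> shows that
      the translation in \<open>E\<close> is by minus the projection of a lattice vector, and
      injectivity of \<open>Q\<close> on the lattice lifts the equality of images.\<close>
    have z0': "0 \<in> pattern w' n" using w by (simp add: pattern_def P_0)
    have "(\<lambda>z. 0 + Q z) ` pattern w' n \<in> patch_class (pattern w' n)"
      unfolding patch_class_def using subspace_0[OF subspace_E] by blast
    then obtain e where e: "e \<in> E" "Q ` pattern w' n = (\<lambda>z. e + Q z) ` pattern w n"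
      unfolding eq[symmetric] by (auto simp: patch_class_def)
    have "0 \<in> (\<lambda>z. e + Q z) ` pattern w n" using z0' e(2) Q_0 by (metis image_eqI)
    then obtain z1 where z1: "z1 \<in> pattern w n" "e = - Q z1" by (auto simp: eq_neg_iff_add_eq_0)
    have z1l: "z1 \<in> int_lattice" "norm1 z1 \<le> n" "w + P z1 \<in> K" using z1(1) by (auto simp: pattern_def)
    define z0 where "z0 = - z1"
    have z0: "z0 \<in> int_lattice" "norm1 z0 \<le> n" using z1l int_lattice_uminus by (auto simp: z0_def)
    have "Q ` pattern w' n = Q ` (\<lambda>z. z + z0) ` pattern w n"
      unfolding e(2) image_image using z1(2) by (simp add: z0_def Q_diff)
    moreover have "(\<lambda>z. z + z0) ` pattern w n \<subseteq> int_lattice" "pattern w' n \<subseteq> int_lattice"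
      using z0(1) by (auto simp: pattern_def intro: int_lattice_add int_lattice_diff)
    ultimately have tr: "pattern w' n = (\<lambda>z. z + z0) ` pattern w n"
      using inj_on_image_eq_iff[OF inj_Q] by blast
    \<comment> \<open>Both \<open>w\<close> and w + P z1 lie in the bounded set \<open>K\<close>. So
      only the part along \<open>E\<close> could be long.\<close>
    have Pz0: "norm1 (P z0) \<le> C2"
    proof -
      have "norm (P z1) \<le> norm (w + P z1) + norm w" by (metis add_diff_cancel_left' norm_triangle_ineq4)
      also have "\<dots> \<le> 2 * R" using R(2)[OF w(1)] R(2)[OF z1l(3)] by simp
      finally have "real CARD('n) * norm (P z1) \<le> C2" unfolding C2_def by (intro mult_left_mono) auto
      then have "norm1 (P z1) \<le> C2" using norm1_le_norm[of "P z1"] by linarith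
      then show ?thesis by (simp add: z0_def P_uminus)
    qed
    have split: "z0 = Q z0 + P z0" by (simp add: proj_E_eq)
    have "norm1 (Q z0) \<le> 2 * C1 + C2"
    \<comment> \<open>For small n the translation is short because it joins points of the ball
      itself; otherwise n - C1 is available as a length.\<close>
    proof (cases "real n < C1")
      case True
      have "Q z0 = z0 - P z0" by (rule proj_E_eq)
      then have "norm1 (Q z0) \<le> norm1 z0 + norm1 (P z0)" using norm1_triangle_diff by metis
      then show ?thesis using True z0(2) Pz0 C1(1) by linarith
    next
      case False
      show ?thesis
      proof (cases "norm1 (Q z0) = 0")
        case True
        then show ?thesis using C1(1) C2 by simp
      next
        case False
        then have qn: "norm1 (Q z0) > 0" using norm1_nonneg[of "Q z0"] by linarith
        \<comment> \<open>Places \<rho> Q z0 at norm n - C1, so that a pattern vector within C1 of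
          it fits in the ball. Its translate by \<open>z0\<close> is near (\<rho> + 1) Q z0, of norm
          n - C1 + norm1 (Q z0), and must fit in the ball too.\<close>
        define \<rho> where "\<rho> = (real n - C1) / norm1 (Q z0)"
        have l0: "\<rho> \<ge> 0" using \<open>\<not> real n < C1\<close> qn by (simp add: \<rho>_def)
        have "\<rho> *\<^sub>R Q z0 \<in> E" using Q_mem subspace_E by (auto intro: subspace_scale)
        then obtain z where z: "z \<in> int_lattice" "w + P z \<in> K" "norm1 (z - \<rho> *\<^sub>R Q z0) \<le> C1"
          using C1(2) w(1) by blast
        have ln: "norm1 (\<rho> *\<^sub>R Q z0) = real n - C1"
          unfolding norm1_scaleR abs_of_nonneg[OF l0] using qn by (simp add: \<rho>_def)
        have "norm1 (\<rho> *\<^sub>R Q z0 + (z - \<rho> *\<^sub>R Q z0)) \<le> norm1 (\<rho> *\<^sub>R Q z0) + norm1 (z - \<rho> *\<^sub>R Q z0)"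
          by (rule norm1_triangle)
        then have "norm1 z \<le> n" using ln z(3) by simp
        then have "z + z0 \<in> pattern w' n" unfolding tr using z by (auto simp: pattern_def)
        then have le: "norm1 (z + z0) \<le> n" by (simp add: pattern_def)
        have q: "(\<rho> + 1) *\<^sub>R Q z0 = ((z + z0) - (z - \<rho> *\<^sub>R Q z0)) - P z0"
          using split by (simp add: algebra_simps)
        have "norm1 ((\<rho> + 1) *\<^sub>R Q z0) \<le> norm1 (z + z0) + norm1 (z - \<rho> *\<^sub>R Q z0) + norm1 (P z0)"
          unfolding q
          using norm1_triangle_diff[of "(z + z0) - (z - \<rho> *\<^sub>R Q z0)" "P z0"]
            norm1_triangle_diff[of "z + z0" "z - \<rho> *\<^sub>R Q z0"] by linarith
        also have "\<dots> \<le> n + C1 + C2" using le z(3) Pz0 by linarith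
        also have "norm1 ((\<rho> + 1) *\<^sub>R Q z0) = (real n - C1) + norm1 (Q z0)"
        proof -
          have "norm1 ((\<rho> + 1) *\<^sub>R Q z0) = (\<rho> + 1) * norm1 (Q z0)" unfolding norm1_scaleR using l0 by simp
          also have "\<dots> = norm1 (\<rho> *\<^sub>R Q z0) + norm1 (Q z0)"
            unfolding norm1_scaleR using l0 by (simp add: distrib_right)
          finally show ?thesis unfolding ln .
        qed
        finally show ?thesis by linarith
      qed
    qed
    moreover have "norm1 z0 \<le> norm1 (Q z0) + norm1 (P z0)"
      using norm1_triangle[of "Q z0" "P z0"] split by simp
    ultimately have "norm1 z0 \<le> 2 * C1 + 2 * C2" using Pz0 by linarith
    then show ?thesis using z0(1) tr by blast
  qed
  then show ?thesis by blast
qed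

text \<open>A pattern with given class is a translate of any other by one of the lattice vectors of
  norm at most \<open>C\<close>, and their number does not depend on n.\<close>

lemma card_patterns_le_complexity:
  "\<exists>M\<ge>1. \<forall>x n. card {pattern (P y) n | y. y \<in> lifted_points E K x} \<le> M * complexity E F K x n"
proof -
  obtain C where C: "\<forall>n w w'. w \<in> K \<longrightarrow> w' \<in> K \<longrightarrow> patch_class (pattern w n) = patch_class (pattern w' n) \<longrightarrow>
     (\<exists>z0\<in>int_lattice. norm1 z0 \<le> C \<and> pattern w' n = (\<lambda>z. z + z0) ` pattern w n)"
    using same_class_translate by blast
  let ?B = "{z \<in> int_lattice. norm1 (z :: real ^ 'n) \<le> C}"
  define M where "M = card ?B + 1"
  have "card {pattern (P y) n | y. y \<in> lifted_points E K x} \<le> M * complexity E F K x n" for x n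
    unfolding complexity_eq
  proof (rule card_le_fibres[OF finite_lifted_patterns])
    let ?S = "{pattern (P y) n | y. y \<in> lifted_points E K x}"
    fix Z assume "Z \<in> ?S"
    then obtain w where w: "w \<in> K" "Z = pattern w n" by (auto simp: mem_lifted_points)
    have "{Z' \<in> ?S. patch_class Z' = patch_class Z} \<subseteq> (\<lambda>z0. (\<lambda>z. z + z0) ` Z) ` ?B"
    proof
      fix Z' assume Z': "Z' \<in> {Z' \<in> ?S. patch_class Z' = patch_class Z}"
      then obtain w' where w': "w' \<in> K" "Z' = pattern w' n" by (auto simp: mem_lifted_points)
      have "patch_class (pattern w n) = patch_class (pattern w' n)" using Z' w(2) w'(2) by simp
      then obtain z0 where "z0 \<in> int_lattice" "norm1 z0 \<le> C" "pattern w' n = (\<lambda>z. z + z0) ` pattern w n"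
        using C w(1) w'(1) by blast
      then show "Z' \<in> (\<lambda>z0. (\<lambda>z. z + z0) ` Z) ` ?B" unfolding w(2) w'(2) by blast
    qed
    then have "card {Z' \<in> ?S. patch_class Z' = patch_class Z} \<le> card ?B"
      by (rule surj_card_le[OF finite_lattice_ball])
    then show "card {Z' \<in> ?S. patch_class Z' = patch_class Z} \<le> M" by (simp add: M_def)
  qed
  then show ?thesis by (intro exI[of _ M]) (simp add: M_def)
qed

text \<open>Discarding the longer vectors maps the larger patterns onto the smaller ones. This
  carries the lower bound from multiples of a constant to all sizes.\<close>

lemma card_patterns_mono:
  assumes "n \<le> n'"
  shows "card {pattern (P y) n | y. y \<in> lifted_points E K x} \<le> card {pattern (P y) n' | y. y \<in> lifted_points E K x}"
proof -
  have "pattern w n = {z \<in> pattern w n'. norm1 z \<le> real n}" for w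
    using assms by (auto simp: pattern_def)
  then have "{pattern (P y) n | y. y \<in> lifted_points E K x}
      \<subseteq> (\<lambda>Z. {z \<in> Z. norm1 z \<le> real n}) ` {pattern (P y) n' | y. y \<in> lifted_points E K x}" by blast
  then show ?thesis by (rule surj_card_le[OF finite_lifted_patterns])
qed

lemma card_patterns_pos: "card {pattern (P y) n | y. y \<in> lifted_points E K x} \<ge> 1"
proof -
  obtain w0 \<eta> where w0: "w0 \<in> K" "\<eta> > 0" "\<And>w. w \<in> F \<Longrightarrow> norm (w - w0) \<le> \<eta> \<Longrightarrow> w \<in> K"
    using interior_point by blast
  have "w0 \<in> F" using w0(1) K(1) by auto
  then obtain z where z: "z \<in> int_lattice" "norm (P (x + z) - w0) < \<eta>"
    using lifted_point_near[OF _ w0(2)] by blast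
  then have "x + z \<in> lifted_points E K x" using w0(3)[OF P_mem] by (auto simp: mem_lifted_points)
  then have "{pattern (P y) n | y. y \<in> lifted_points E K x} \<noteq> {}" by blast
  then have "card {pattern (P y) n | y. y \<in> lifted_points E K x} \<noteq> 0"
    using finite_lifted_patterns by (simp only: card_eq_0_iff) blast
  then show ?thesis by linarith
qed

lemma complexity_ge:
  fixes H :: "'i \<Rightarrow> (real ^ 'n) set"
  assumes I: "finite I" "card I = dim F" "\<And>i. i \<in> I \<Longrightarrow> H i \<in> singular_hyperplanes F K" "(\<Inter>i\<in>I. H i) = {0}"
  shows "\<exists>c>0. \<forall>x. \<forall>n\<ge>1. c * real n powi (\<Sum>i\<in>I. sing_exponent E F (H i)) \<le> real (complexity E F K x n)"
proof -
  have "\<forall>i\<in>I. \<exists>f. facet_in F K f \<and> H i = direction f"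
    using I(3) by (auto simp: singular_hyperplanes_def)
  from bchoice[OF this] obtain f where f: "\<forall>i\<in>I. facet_in F K (f i) \<and> H i = direction (f i)" ..
  have "\<forall>i\<in>I. \<exists>a. \<exists>b. a \<in> F \<and> a \<noteq> 0 \<and> (\<forall>x\<in>K. a \<bullet> x \<le> b) \<and> f i = K \<inter> {x. a \<bullet> x = b} \<and>
    direction (f i) = {x \<in> F. a \<bullet> x = 0}"
  proof
    fix i assume "i \<in> I"
    then have fi: "facet_in F K (f i)" using f by blast
    obtain a b where "a \<in> F" "a \<noteq> 0" "\<And>x. x \<in> K \<Longrightarrow> a \<bullet> x \<le> b" "f i = K \<inter> {x. a \<bullet> x = b}"
      "direction (f i) = {x \<in> F. a \<bullet> x = 0}" using facet_support[OF fi] by blast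
    then show "\<exists>a. \<exists>b. a \<in> F \<and> a \<noteq> 0 \<and> (\<forall>x\<in>K. a \<bullet> x \<le> b) \<and> f i = K \<inter> {x. a \<bullet> x = b} \<and>
      direction (f i) = {x \<in> F. a \<bullet> x = 0}" by (intro exI[of _ a] exI[of _ b] conjI ballI)
  qed
  from bchoice[OF this] obtain a where "\<forall>i\<in>I. \<exists>b. a i \<in> F \<and> a i \<noteq> 0 \<and> (\<forall>x\<in>K. a i \<bullet> x \<le> b) \<and>
    f i = K \<inter> {x. a i \<bullet> x = b} \<and> direction (f i) = {x \<in> F. a i \<bullet> x = 0}" ..
  from bchoice[OF this] obtain b where ab: "\<forall>i\<in>I. a i \<in> F \<and> a i \<noteq> 0 \<and> (\<forall>x\<in>K. a i \<bullet> x \<le> b i) \<and>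
    f i = K \<inter> {x. a i \<bullet> x = b i} \<and> direction (f i) = {x \<in> F. a i \<bullet> x = 0}" ..
  have zero: "\<forall>x\<in>F. (\<forall>i\<in>I. a i \<bullet> x = 0) \<longrightarrow> x = 0"
  proof (intro ballI impI)
    fix x assume "x \<in> F" "\<forall>i\<in>I. a i \<bullet> x = 0"
    then have "x \<in> (\<Inter>i\<in>I. H i)" using f ab by auto
    then show "x = 0" using I(4) by simp
  qed
  define A where "A = (\<Sum>i\<in>I. expo (a i))"
  have A: "(\<Sum>i\<in>I. sing_exponent E F (H i)) = int A"
  proof -
    have "(\<Sum>i\<in>I. sing_exponent E F (H i)) = (\<Sum>i\<in>I. int (expo (a i)))"
      using f ab sing_exponent_eq by (intro sum.cong) auto
    then show ?thesis by (simp add: A_def)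
  qed
  have "\<exists>c>0. \<exists>C\<ge>1::nat. \<forall>x. \<forall>n\<ge>1. c * real n ^ A \<le> real (card {pattern (P y) (C * n) | y. y \<in> lifted_points E K x})"
    unfolding A_def using f ab zero by (intro card_patterns_ge[of I f a b] I(1,2)) auto
  then obtain c and C :: nat where c: "c > 0" and C: "C \<ge> 1"
    and lower: "\<And>x n. n \<ge> 1 \<Longrightarrow> c * real n ^ A \<le> real (card {pattern (P y) (C * n) | y. y \<in> lifted_points E K x})"
    by blast
  obtain M where M: "M \<ge> 1" "\<forall>x n. card {pattern (P y) n | y. y \<in> lifted_points E K x} \<le> M * complexity E F K x n"
    using card_patterns_le_complexity by blast
  \<comment> \<open>For n < C the power is at most 1, and min c 1 makes the trivial bound by one
    pattern enough. For n \<ge> C, the quotient k = n div C is at least n / (2C), which accounts for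
    the factor 2.\<close>
  define c' where "c' = min c 1 / (2 * real C) ^ A"
  have c': "c' > 0" using c C by (simp add: c'_def)
  have pat: "c' * real n ^ A \<le> real (card {pattern (P y) n | y. y \<in> lifted_points E K x})" if n: "n \<ge> 1" for n x
  proof -
    have eq: "c' * real n ^ A = min c 1 * (real n / (2 * real C)) ^ A"
      by (simp add: c'_def power_divide)
    show ?thesis
    proof (cases "n < C")
      case True
      then have "(real n / (2 * real C)) ^ A \<le> 1" by (intro power_le_one) auto
      then have "min c 1 * (real n / (2 * real C)) ^ A \<le> 1 * 1" using c by (intro mult_mono) auto
      also have "\<dots> \<le> real (card {pattern (P y) n | y. y \<in> lifted_points E K x})"
        using card_patterns_pos[of n x] by linarith
      finally show ?thesis unfolding eq .
    next
      case False
      define k where "k = n div C"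
      have k: "k \<ge> 1" "C * k \<le> n" using False C by (auto simp: k_def div_greater_zero_iff Suc_le_eq)
      have "n < C * k + C" unfolding k_def using C dividend_less_times_div[of C n] by simp
      also have "\<dots> \<le> C * k + C * k" using k(1) by simp
      finally have "real n \<le> real (C * k + C * k)" by (intro of_nat_mono less_imp_le)
      then have "real n / (2 * real C) \<le> real k" using C by (simp add: field_simps)
      then have "min c 1 * (real n / (2 * real C)) ^ A \<le> c * real k ^ A"
        using c by (intro mult_mono power_mono) auto
      also have "\<dots> \<le> real (card {pattern (P y) (C * k) | y. y \<in> lifted_points E K x})" by (rule lower[OF k(1)])
      also have "\<dots> \<le> real (card {pattern (P y) n | y. y \<in> lifted_points E K x})"
        by (intro of_nat_mono card_patterns_mono k(2))
      finally show ?thesis unfolding eq .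
    qed
  qed
  have "c' / M * real n ^ A \<le> real (complexity E F K x n)" if n: "n \<ge> 1" for n x
  proof -
    have "card {pattern (P y) n | y. y \<in> lifted_points E K x} \<le> M * complexity E F K x n" using M(2) by blast
    then have "real (card {pattern (P y) n | y. y \<in> lifted_points E K x}) \<le> real (M * complexity E F K x n)"
      by (rule of_nat_mono)
    then have "c' * real n ^ A \<le> real M * real (complexity E F K x n)" using pat[OF n, of x] by simp
    then show ?thesis using M(1) by (simp add: field_simps)
  qed
  moreover have "c' / M > 0" using c' M(1) by simp
  ultimately show ?thesis unfolding A by (intro exI[of _ "c' / M"]) (simp add: power_int_of_nat)
qed

end

theorem theorem2p3:
  fixes E F K :: "(real ^ 'n) set"
    and H :: "nat \<Rightarrow> (real ^ 'n) set"
    and d m :: nat and I :: "nat set" and \<alpha> :: "nat \<Rightarrow> int"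
  assumes data: "cut_and_projection d E F K"
    and ac: "almost_canonical E F K"
    and H: "bij_betw H {1..m} (singular_hyperplanes F K)"
    and \<alpha>: "\<alpha> = (\<lambda>i. sing_exponent E F (H i))"
    and I: "I \<subseteq> {1..m}" "card I = CARD('n) - d" "(\<Inter>i\<in>I. H i) = {0}"
    and I_max: "\<And>J. J \<subseteq> {1..m} \<Longrightarrow> card J = CARD('n) - d \<Longrightarrow> (\<Inter>j\<in>J. H j) = {0} \<Longrightarrow>
                  (\<Sum>j\<in>J. \<alpha> j) \<le> (\<Sum>i\<in>I. \<alpha> i)"
  shows "\<exists>C1 C2 :: real. C1 > 0 \<and> C2 > 0 \<and>
           (\<forall>x \<in> Reg E K. \<forall>n :: nat. n \<ge> 1 \<longrightarrow>
              C1 * real n powi (\<Sum>i\<in>I. \<alpha> i) \<le> real (complexity E F K x n) \<and>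
              real (complexity E F K x n) \<le> C2 * real n powi (\<Sum>i\<in>I. \<alpha> i))"
proof -
  have dN: "d < CARD('n)" using data by (simp add: cut_and_projection_def)
  have finI: "finite I" by (rule finite_subset[OF I(1)]) simp
  have Hsing: "H i \<in> singular_hyperplanes F K" if "i \<in> I" for i
    using H I(1) that by (auto simp: bij_betw_def)
  have "K \<noteq> {}"
  proof
    \<comment> \<open>The empty set has affine dimension -1, so it could pass for a facet only if
      \<open>F\<close> had dimension 0, contrary to d < N.\<close>
    assume K: "K = {}"
    have "I \<noteq> {}" using I(2) dN by auto
    then obtain f where f: "facet_in F K f" using Hsing by (auto simp: singular_hyperplanes_def)
    then have "f = {}" unfolding K facet_in_def using face_of_imp_subset by blast
    then have "aff_dim ({} :: (real ^ 'n) set) = int (dim F) - 1" using f unfolding facet_in_def by blast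
    then have F0: "dim F = 0" unfolding aff_dim_empty_eq by linarith
    have "complementary E F" "dim E = d" using data by (auto simp: cut_and_projection_def)
    then have "dim {x + y |x y. x \<in> E \<and> y \<in> F} + dim (E \<inter> F) = d + dim F"
      using dim_sums_Int[of E F] by (simp add: complementary_def)
    moreover have "{x + y |x y. x \<in> E \<and> y \<in> F} = UNIV" 
    proof -
      have "E + F = UNIV" using \<open>complementary E F\<close> by (simp add: complementary_def)
      then show ?thesis unfolding set_plus_def by blast
    qed
    ultimately show False using F0 dN by simp
  qed
  then interpret cut_data E F K d using data ac by unfold_locales
  let ?M = "\<Sum>i\<in>I. sing_exponent E F (H i)"
  \<comment> \<open>Turns the integer power into a natural one, for which the counting bounds are
    stated.\<close>
  have "0 \<le> ?M"
  proof (rule sum_nonneg)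
    fix i assume "i \<in> I"
    then obtain a where "singular_normal a" "H i = {x \<in> F. a \<bullet> x = 0}"
      using singular_normal_of[OF Hsing] by blast
    then show "0 \<le> sing_exponent E F (H i)" using sing_exponent_eq by (simp add: singular_normal_def)
  qed
  then obtain A where A: "?M = int A" using nonneg_int_cases by blast
  have "(\<Sum>a\<in>S. expo a) \<le> A" if "independent S" "\<And>a. a \<in> S \<Longrightarrow> singular_normal a" for S
  proof -
    have "int (\<Sum>a\<in>S. expo a) \<le> int A"
      using I_max that unfolding \<alpha> A by (rule independent_normals_le[OF H I])
    then show ?thesis by (simp only: of_nat_le_iff)
  qed
  then obtain C2 where C2: "C2 > 0" "\<forall>n\<ge>1. real (card {pattern w n | w. w \<in> K}) \<le> C2 * real n ^ A"
    using card_patterns_le[of A] by blast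
  obtain C1 where C1: "C1 > 0" "\<forall>x. \<forall>n\<ge>1. C1 * real n powi ?M \<le> real (complexity E F K x n)"
    using complexity_ge[OF finI _ Hsing I(3)] I(2) dim_F(1) by auto
  have "real (complexity E F K x n) \<le> C2 * real n powi ?M" if "n \<ge> 1" for x n
  proof -
    have "real (complexity E F K x n) \<le> real (card {pattern w n | w. w \<in> K})"
      by (intro of_nat_mono complexity_le)
    also have "\<dots> \<le> C2 * real n ^ A" using C2(2) that by blast
    finally show ?thesis unfolding A by (simp add: power_int_of_nat)
  qed
  then show ?thesis unfolding \<alpha> using C1 C2(1) by blast
qed

end
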